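(* Let $r\in (0,1]$, $p\in [1,\infty )$, $q\in [r,\infty )$ and let $\omega ,v\in \mathscr P_E(\mathbf R^{2d})$ be such that $\omega$ is $v$-moderate. Then $$W\!L^{1,r}_{(v)}(\mathbf R^{2d}) *_\sigma W\!L^{p,q}_{(\omega)}(\mathbf R^{2d}) = W\!L^{p,q}_{(\omega)}(\mathbf R^{2d}) *_\sigma W\!L^{1,r}_{(v)}(\mathbf R^{2d}) = W\!L^{p,q}_{(\omega)}(\mathbf R^{2d}).$$
   Context: A weight on $\mathbf R^{2d}$ is a positive function $\omega$ with $\omega,1/\omega\in L^\infty_{loc}(\mathbf R^{2d})$. For weights $\omega,v$, $\omega$ is called $v$-moderate if there is a constant $C>0$ with $\omega(X+Y)\le C\omega(X)v(Y)$ for all $X,Y\in\mathbf R^{2d}$; $\mathscr P_E(\mathbf R^{2d})$ is the set of all weights which are $v$-moderate for some weight $v$. For $p\in[1,\infty]$, $q\in(0,\infty]$ and $\omega\in\mathscr P_E(\mathbf R^{2d})$, $W\!L^{p,q}_{(\omega)}(\mathbf R^{2d})$ consists of all measurable functions $f$ on $\mathbf R^{2d}$ such that $$\|f\|_{W\!L^{p,q}_{(\omega)}}\equiv\|\{a_f(k)\,\omega(k)\}_{k\in\mathbf Z^{2d}}\|_{\ell^q(\mathbf Z^{2d})}<\infty,\qquad a_f(k)=\|f\|_{L^p(k+Q)},\ Q=[0,1]^{2d}.$$ The twisted convolution is $$(a*_\sigma b)(X)=\Big(\frac2\pi\Big)^{d/2}\int_{\mathbf R^{2d}}a(X-Y)b(Y)e^{2i\sigma(X,Y)}\,dY,$$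 where $\sigma(X,Y)=\langle y,\xi\rangle-\langle x,\eta\rangle$ for $X=(x,\xi)$, $Y=(y,\eta)\in\mathbf R^{2d}$. For sets $E,F$, $E*_\sigma F=\{a*_\sigma b: a\in E,\ b\in F\}$ (single products). *)

theory Defs
  imports "HOL-Analysis.Analysis" "HOL-Probability.Essential_Supremum"
begin

subsection \<open>Weights\<close>

text \<open>
  Weights are honest functions rather than classes modulo null sets, since they are evaluated
  at lattice points below. Local boundedness is in the essential sense.
\<close>

definition Linf_loc :: "('a::euclidean_space \<Rightarrow> real) set" where
  "Linf_loc = {f \<in> borel_measurable lebesgue.
     \<forall>K. compact K \<longrightarrow> (\<exists>C. AE x in lebesgue. x \<in> K \<longrightarrow> \<bar>f x\<bar> \<le> C)}"

definition weight :: "('a::euclidean_space \<Rightarrow> real) \<Rightarrow> bool" where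
  "weight \<omega> \<longleftrightarrow> (\<forall>X. \<omega> X > 0) \<and> \<omega> \<in> Linf_loc \<and> (\<lambda>X. 1 / \<omega> X) \<in> Linf_loc"

definition moderate :: "('a::euclidean_space \<Rightarrow> real) \<Rightarrow> ('a \<Rightarrow> real) \<Rightarrow> bool" where
  "moderate v \<omega> \<longleftrightarrow> (\<exists>C>0. \<forall>X Y. \<omega> (X + Y) \<le> C * \<omega> X * v Y)"

definition P_E :: "('a::euclidean_space \<Rightarrow> real) set" where
  "P_E = {\<omega>. weight \<omega> \<and> (\<exists>v. weight v \<and> moderate v \<omega>)}"

subsection \<open>Wiener amalgam spaces\<close>

definition ennreal_powr :: "ennreal \<Rightarrow> real \<Rightarrow> ennreal" where
  "ennreal_powr x s = (if x = \<infinity> then \<infinity> else ennreal (enn2real x powr s))"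

text \<open>
  The \<open>L\<^sup>p(M)\<close> (quasi-)norm of a nonnegative function, for \<open>p \<in> (0, \<infinity>]\<close>; with the counting
  measure it is the \<open>\<ell>\<^sup>p\<close> (quasi-)norm.
\<close>

definition Lp_norm :: "ennreal \<Rightarrow> 'a measure \<Rightarrow> ('a \<Rightarrow> ennreal) \<Rightarrow> ennreal" where
  "Lp_norm p M g =
     (if p = \<infinity> then esssup M g
      else ennreal_powr (\<integral>\<^sup>+x. ennreal_powr (g x) (enn2real p) \<partial>M) (1 / enn2real p))"

definition lattice :: "'a::euclidean_space set" where
  "lattice = {k. \<forall>b\<in>Basis. k \<bullet> b \<in> \<int>}"

definition local_norm :: "ennreal \<Rightarrow> ('a::euclidean_space \<Rightarrow> complex) \<Rightarrow> 'a \<Rightarrow> ennreal" where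
  "local_norm p f k =
     Lp_norm p (restrict_space lebesgue ((+) k ` cbox 0 One)) (\<lambda>X. ennreal (norm (f X)))"

definition WL_norm ::
  "ennreal \<Rightarrow> ennreal \<Rightarrow> ('a::euclidean_space \<Rightarrow> real) \<Rightarrow> ('a \<Rightarrow> complex) \<Rightarrow> ennreal" where
  "WL_norm p q \<omega> f = Lp_norm q (count_space lattice) (\<lambda>k. local_norm p f k * ennreal (\<omega> k))"

definition WL ::
  "ennreal \<Rightarrow> ennreal \<Rightarrow> ('a::euclidean_space \<Rightarrow> real) \<Rightarrow> ('a \<Rightarrow> complex) set" where
  "WL p q \<omega> = {f \<in> borel_measurable lebesgue. WL_norm p q \<omega> f < \<infinity>}"

subsection \<open>Twisted convolution\<close>

text \<open>A point \<open>(x, \<xi>)\<close> of \<open>'d phase\<close> is a point of \<open>\<real>\<^sup>2\<^sup>d\<close> with \<open>d = CARD('d)\<close>.\<close>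

type_synonym 'd phase = "(real ^ 'd) \<times> (real ^ 'd)"

definition sympl :: "'d::finite phase \<Rightarrow> 'd phase \<Rightarrow> real" where
  "sympl X Y = fst Y \<bullet> snd X - fst X \<bullet> snd Y"

definition twisted_integrand ::
  "('d::finite phase \<Rightarrow> complex) \<Rightarrow> ('d phase \<Rightarrow> complex) \<Rightarrow> 'd phase \<Rightarrow> 'd phase \<Rightarrow> complex" where
  "twisted_integrand a b X Y = a (X - Y) * b Y * exp (2 * \<i> * of_real (sympl X Y))"

definition twisted_conv ::
  "('d::finite phase \<Rightarrow> complex) \<Rightarrow> ('d phase \<Rightarrow> complex) \<Rightarrow> 'd phase \<Rightarrow> complex"
  (infixl "*\<^sub>\<sigma>" 70) where
  "(a *\<^sub>\<sigma> b) X =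
     of_real ((2 / pi) powr (real CARD('d) / 2)) * (LINT Y|lebesgue. twisted_integrand a b X Y)"

text \<open>
  The Bochner integral is 0 on non-integrable functions, so the defining integral of
  \<open>a *\<^sub>\<sigma> b\<close> converges (almost everywhere) only if the following holds.
\<close>

definition twisted_convolvable ::
  "('d::finite phase \<Rightarrow> complex) \<Rightarrow> ('d phase \<Rightarrow> complex) \<Rightarrow> bool" where
  "twisted_convolvable a b \<longleftrightarrow>
     (AE X in lebesgue. integrable lebesgue (twisted_integrand a b X))"

text \<open>
  Functions are identified when they agree almost everywhere: a measurable function belongs to
  the product set if it is a representative of some \<open>a *\<^sub>\<sigma> b\<close>.
\<close>

definition twisted_conv_set ::
  "('d::finite phase \<Rightarrow> complex) set \<Rightarrow> ('d phase \<Rightarrow> complex) set \<Rightarrow> ('d phase \<Rightarrow> complex) set"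
  (infixl "\<^bold>*\<^sub>\<sigma>" 70) where
  "E \<^bold>*\<^sub>\<sigma> F = {f \<in> borel_measurable lebesgue.
     \<exists>a\<in>E. \<exists>b\<in>F. AE X in lebesgue. f X = (a *\<^sub>\<sigma> b) X}"

end

theory Submission
  imports Defs
begin

text \<open>
  Write \<open>A = WL 1 r v\<close> and \<open>B = WL p q \<omega>\<close>. After taking \<open>r\<close>-th powers all quasi-norms involved are
  subadditive, and splitting functions over lattice cubes reduces \<open>A * B \<subseteq> B\<close> to Minkowski's
  inequality on cubes and to \<open>\<ell>\<^sup>r * \<ell>\<^sup>q \<subseteq> \<ell>\<^sup>q\<close> on the lattice.

  For the converse, enlarge \<open>v\<close> to a submultiplicative weight, so that \<open>A\<close> is an algebra.
  Normalized indicators \<open>e\<close> of small cubes form a bounded approximate unit of \<open>A\<close> and \<open>B\<close>,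
  because \<open>p, q < \<infinity>\<close>, and \<open>f\<close> is factorized in the manner of Cohen. For small \<open>\<theta>\<close> put
  \<open>g = \<Sum>\<^sub>m\<^sub>\<ge>\<^sub>1 \<theta>\<^sup>m e\<^sup>m\<close> and \<open>R = (1 - \<theta>)(1 + g)\<close>, so that \<open>(1 - \<theta>) R\<^sup>-\<^sup>1 = 1 - \<theta> e\<close>.
  With \<open>e\<^sub>n\<close> chosen successively, \<open>R\<^sub>1 \<cdots> R\<^sub>n = (1 - \<theta>)\<^sup>n + a\<^sub>n\<close> with \<open>a\<^sub>n\<close> convergent in \<open>A\<close>, while
  \<open>b\<^sub>n = R\<^sub>n\<^sup>-\<^sup>1 \<cdots> R\<^sub>1\<^sup>-\<^sup>1 f\<close> converges in \<open>B\<close>; hence \<open>f = lim a\<^sub>n * lim b\<^sub>n\<close>. The products in the other order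
  follow by complex conjugation, which reverses twisted convolution.
\<close>

subsection \<open>Powers and Minkowski's inequality for extended nonnegative reals\<close>

text \<open>For r < 1 the spaces are only quasi-normed. Passing to r-th powers saves the triangle
  inequality at the price of homogeneity of degree r, which is enough for a Cohen argument driven by
  geometric series. The factor 1 - \<theta> in \<open>R\<close> is forced: where \<open>e\<close>
  acts like a unit, \<open>g\<close> acts like \<theta> / (1 - \<theta>), so \<open>R\<close> acts
  like the identity and both sequences can converge. The same factor makes the scalar part of the
  product vanish in the limit, which puts the left factor into the algebra itself. The uniform bound
  on \<open>e\<close> fixes \<theta> once and for all; only the quality of the approximation is
  chosen anew at each step. Moderateness of \<omega> makes \<open>B\<close> a module over the space
  with weight \<open>v\<close>, but products of elements of that space need not return to it. The
  larger weight gives a smaller space, whose elements are still admissible left factors. Finiteness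
  of p and q enters through dominated convergence, once on cubes and once over the lattice. The
  analysis is done with Borel functions and \<open>lborel\<close>, where Tonelli and Fubini are at
  hand; Lebesgue measurable functions are replaced by Borel representatives at the end.\<close>

lemma ennreal_powr_0 [simp]: "ennreal_powr 0 s = 0"
  by (simp add: ennreal_powr_def)

lemma ennreal_powr_top [simp]: "ennreal_powr \<infinity> s = \<infinity>" "ennreal_powr top s = \<infinity>"
  by (simp_all add: ennreal_powr_def)

lemma ennreal_powr_ennreal: "0 \<le> x \<Longrightarrow> ennreal_powr (ennreal x) s = ennreal (x powr s)"
  by (simp add: ennreal_powr_def)

lemma ennreal_powr_1 [simp]: "ennreal_powr x 1 = x"
  by (cases x) (simp_all add: ennreal_powr_ennreal)

lemma ennreal_powr_mono: "x \<le> y \<Longrightarrow> 0 \<le> s \<Longrightarrow> ennreal_powr x s \<le> ennreal_powr y s"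
  by (cases x; cases y) (auto simp: ennreal_powr_ennreal powr_mono2 top_unique)

lemma ennreal_powr_mult: "0 < s \<Longrightarrow> ennreal_powr (x * y) s = ennreal_powr x s * ennreal_powr y s"
  by (cases x; cases y)
     (auto simp: ennreal_powr_ennreal powr_mult ennreal_mult_top ennreal_top_mult
        simp flip: ennreal_mult)

lemma ennreal_powr_powr: "ennreal_powr (ennreal_powr x s) t = ennreal_powr x (s * t)"
  by (cases x) (auto simp: ennreal_powr_ennreal powr_powr)

lemma ennreal_powr_eq_0_iff: "ennreal_powr x s = 0 \<longleftrightarrow> x = 0"
  by (cases x) (auto simp: ennreal_powr_ennreal)

lemma ennreal_powr_eq_top_iff: "ennreal_powr x s = \<infinity> \<longleftrightarrow> x = \<infinity>"
  by (cases x) (auto simp: ennreal_powr_ennreal)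

lemma ennreal_powr_less_top_iff: "ennreal_powr x s < \<infinity> \<longleftrightarrow> x < \<infinity>"
  by (metis ennreal_powr_eq_top_iff infinity_ennreal_def less_top)

lemma measurable_ennreal_powr [measurable]:
  assumes [measurable]: "f \<in> borel_measurable M"
  shows "(\<lambda>x. ennreal_powr (f x) s) \<in> borel_measurable M"
  unfolding ennreal_powr_def by measurable

text \<open>With N the sum of the s-th powers, each f i ^ s is at most N, so f i = f i ^ s * (f i ^
  s) ^ (1/s - 1) is at most f i ^ s * N ^ (1/s - 1). Summing gives N ^ (1/s).\<close>

lemma nn_integral_powr_subadditive:
  assumes "0 < s" "s \<le> 1"
  shows "ennreal_powr (\<integral>\<^sup>+i. f i \<partial>count_space I) s \<le> (\<integral>\<^sup>+i. ennreal_powr (f i) s \<partial>count_space I)"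
proof (cases "\<integral>\<^sup>+i. ennreal_powr (f i) s \<partial>count_space I")
  case top
  then show ?thesis by simp
next
  case (real N)
  have le: "ennreal_powr (f i) s \<le> ennreal N" if "i \<in> I" for i
    using nn_integral_ge_point[OF that, of "\<lambda>i. ennreal_powr (f i) s"] real by simp
  have pt: "f i \<le> ennreal_powr (f i) s * ennreal (N powr (1 / s - 1))" if i: "i \<in> I" for i
  proof (cases "f i")
    case top
    then show ?thesis using le[OF i] by (simp add: top_unique)
  next
    case (real x)
    show ?thesis
    proof (cases "x = 0")
      case False
      with real have "0 < x" by simp
      have "x powr s \<le> N"
        using le[OF i] real \<open>0 \<le> N\<close> by (simp add: ennreal_powr_ennreal)
      then have "(x powr s) powr (1 / s - 1) \<le> N powr (1 / s - 1)"
        using assms by (intro powr_mono2) auto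
      moreover have "x = x powr s * (x powr s) powr (1 / s - 1)"
        using \<open>0 < x\<close> assms by (simp add: powr_powr algebra_simps flip: powr_add)
      ultimately have "x \<le> x powr s * N powr (1 / s - 1)"
        by (metis mult_left_mono powr_ge_zero)
      then show ?thesis using real
        by (simp add: ennreal_powr_ennreal flip: ennreal_mult)
    qed (use real in simp)
  qed
  have "(\<integral>\<^sup>+i. f i \<partial>count_space I)
      \<le> (\<integral>\<^sup>+i. ennreal_powr (f i) s * ennreal (N powr (1 / s - 1)) \<partial>count_space I)"
    using pt by (intro nn_integral_mono) auto
  also have "\<dots> = ennreal N * ennreal (N powr (1 / s - 1))"
    using real by (simp add: nn_integral_multc)
  also have "\<dots> = ennreal (N powr (1 / s))"
    using real by (cases "N = 0") (auto simp: powr_diff simp flip: ennreal_mult)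
  finally have "ennreal_powr (\<integral>\<^sup>+i. f i \<partial>count_space I) s \<le> ennreal_powr (ennreal (N powr (1 / s))) s"
    using assms by (intro ennreal_powr_mono) auto
  then show ?thesis
    using assms real by (simp add: ennreal_powr_ennreal powr_powr)
qed

text \<open>The tangent of x ^ P at t, with the negative term moved to the other side so that the
  inequality carries over to \<open>ennreal\<close>.\<close>

lemma powr_tangent:
  fixes P t g :: real
  assumes "1 \<le> P" "0 < t" "0 \<le> g"
  shows "P * t powr (P - 1) * g \<le> g powr P + (P - 1) * t powr P"
proof (cases "g = 0")
  case False
  with assms have "0 < g" by simp
  have "P * t powr (P - 1) * (g - t) \<le> g powr P - t powr P"
  proof (rule convex_on_imp_above_tangent[where A = "{0<..}" and f = "\<lambda>x. x powr P"])
    show "convex_on {0<..} (\<lambda>x. x powr P)" using assms by (intro Convex.powr_convex)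
    show "((\<lambda>x. x powr P) has_field_derivative P * t powr (P - 1)) (at t within {0<..})"
      using \<open>0 < t\<close> by (auto intro!: derivative_eq_intros)
  qed (use \<open>0 < g\<close> \<open>0 < t\<close> in \<open>auto simp: interior_open\<close>)
  moreover have "t powr (P - 1) * t = t powr P"
    using \<open>0 < t\<close> by (simp add: powr_diff)
  ultimately show ?thesis
    by (simp add: algebra_simps)
qed (use assms in simp)

lemma ennreal_powr_tangent:
  assumes "1 \<le> P" "0 < t"
  shows "ennreal (P * t powr (P - 1)) * g \<le> ennreal_powr g P + ennreal ((P - 1) * t powr P)"
proof (cases g)
  case (real x)
  then show ?thesis
    using powr_tangent[OF assms, of x] assms
    by (simp add: ennreal_powr_ennreal flip: ennreal_mult ennreal_plus)
qed simp

text \<open>Integrate the tangent inequality against f for arbitrary t > 0, then optimize in t.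
  Working with an upper bound A for the mass of f avoids normalizing f to a probability
  density.\<close>

lemma nn_integral_Jensen:
  assumes [measurable]: "f \<in> borel_measurable M" "g \<in> borel_measurable M"
    and f: "(\<integral>\<^sup>+x. f x \<partial>M) \<le> ennreal A" and A: "0 < A" and P: "1 \<le> P"
  shows "ennreal_powr (\<integral>\<^sup>+x. f x * g x \<partial>M) P
       \<le> ennreal (A powr (P - 1)) * (\<integral>\<^sup>+x. f x * ennreal_powr (g x) P \<partial>M)"
proof -
  define J where "J = (\<integral>\<^sup>+x. f x * ennreal_powr (g x) P \<partial>M)"
  have key: "ennreal (P * t powr (P - 1)) * (\<integral>\<^sup>+x. f x * g x \<partial>M)
      \<le> J + ennreal ((P - 1) * t powr P) * ennreal A" if "0 < t" for t
  proof -
    have "ennreal (P * t powr (P - 1)) * (\<integral>\<^sup>+x. f x * g x \<partial>M)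
        = (\<integral>\<^sup>+x. f x * (ennreal (P * t powr (P - 1)) * g x) \<partial>M)"
      by (subst nn_integral_cmult[symmetric]) (auto simp: ac_simps)
    also have "\<dots> \<le> (\<integral>\<^sup>+x. f x * (ennreal_powr (g x) P + ennreal ((P - 1) * t powr P)) \<partial>M)"
      by (intro nn_integral_mono mult_left_mono ennreal_powr_tangent P that) simp
    also have "\<dots> = J + ennreal ((P - 1) * t powr P) * (\<integral>\<^sup>+x. f x \<partial>M)"
      by (simp add: distrib_left nn_integral_add nn_integral_multc J_def mult.commute)
    also have "\<dots> \<le> J + ennreal ((P - 1) * t powr P) * ennreal A"
      by (intro add_left_mono mult_left_mono f) simp
    finally show ?thesis .
  qed
  show ?thesis
  proof (cases "\<integral>\<^sup>+x. f x * g x \<partial>M")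
    case top
    have "J = \<infinity>"
      using key[of 1] P A unfolding top by (cases J) (auto simp: ennreal_mult_top top_unique simp flip: ennreal_mult ennreal_plus)
    then show ?thesis using A by (simp add: J_def ennreal_mult_top)
  next
    case (real I)
    show ?thesis
    proof (cases "I = 0 \<or> J = \<infinity>")
      case True
      then show ?thesis using real A by (auto simp: J_def ennreal_mult_top)
    next
      case False
      then obtain j where j: "J = ennreal j" "0 \<le> j" by (cases J) auto
      \<comment> \<open>This t maximizes P t^(P-1) I - (P-1) t^P A, the lower bound for J.\<close>
      define t where "t = I / A"
      have t: "0 < t" using False real A by (simp add: t_def)
      have "P * t powr (P - 1) * I \<le> j + (P - 1) * t powr P * A"
        using key[OF t] P A \<open>0 \<le> I\<close> j t unfolding real
        by (simp flip: ennreal_mult ennreal_plus)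
      moreover
      have "t powr (P - 1) * I = t powr P * A"
        using t A by (simp add: powr_diff) (simp add: t_def)
      then have "P * t powr (P - 1) * I = P * (t powr P * A)"
        by (simp only: mult.assoc)
      ultimately have "P * (t powr P * A) \<le> j + (P - 1) * t powr P * A"
        by simp
      then have "t powr P * A \<le> j"
        by (simp add: algebra_simps)
      moreover have "I powr P = A powr (P - 1) * (t powr P * A)"
        using False real A by (simp add: t_def powr_divide powr_diff)
      ultimately have "I powr P \<le> A powr (P - 1) * j"
        by (metis mult_left_mono powr_ge_zero)
      then show ?thesis
        using real j A by (simp add: ennreal_powr_ennreal J_def[symmetric] flip: ennreal_mult)
    qed
  qed
qed

lemma measurable_nn_integral_count_space:
  fixes f :: "'i \<Rightarrow> 'a \<Rightarrow> ennreal"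
  assumes I: "countable I" and [measurable]: "\<And>i. i \<in> I \<Longrightarrow> f i \<in> borel_measurable M"
  shows "(\<lambda>x. \<integral>\<^sup>+i. f i x \<partial>count_space I) \<in> borel_measurable M"
proof (cases "finite I")
  case True
  then show ?thesis by (simp add: nn_integral_count_space_finite)
next
  case False
  then have "bij_betw (from_nat_into I) UNIV I"
    using I by (intro bij_betw_from_nat_into)
  then have *: "(\<integral>\<^sup>+i. f i x \<partial>count_space I) = (\<Sum>n. f (from_nat_into I n) x)" for x
    using nn_integral_bij_count_space[of "from_nat_into I" UNIV I "\<lambda>i. f i x"]
    by (simp add: nn_integral_count_space_nat)
  have [measurable]: "f (from_nat_into I n) \<in> borel_measurable M" for n
    using False by (intro assms from_nat_into) auto
  show ?thesis unfolding * by measurable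
qed

text \<open>Write F i = c i * G i with c i the L^P norm of F i, so that each G i with c i nonzero
  has norm 1. Jensen with the weights c i, of total mass C, bounds the P-th power of the sum by C ^
  (P - 1) times the sum of c i * G i ^ P, and integrating gives C ^ P.\<close>

lemma nn_integral_Minkowski:
  fixes F :: "'i \<Rightarrow> 'a \<Rightarrow> ennreal"
  assumes I: "countable I" and [measurable]: "\<And>i. i \<in> I \<Longrightarrow> F i \<in> borel_measurable M" and P: "1 \<le> P"
  shows "ennreal_powr (\<integral>\<^sup>+x. ennreal_powr (\<integral>\<^sup>+i. F i x \<partial>count_space I) P \<partial>M) (1 / P)
       \<le> (\<integral>\<^sup>+i. ennreal_powr (\<integral>\<^sup>+x. ennreal_powr (F i x) P \<partial>M) (1 / P) \<partial>count_space I)"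
proof -
  define c where "c i = ennreal_powr (\<integral>\<^sup>+x. ennreal_powr (F i x) P \<partial>M) (1 / P)" for i
  have cP: "ennreal_powr (c i) P = (\<integral>\<^sup>+x. ennreal_powr (F i x) P \<partial>M)" for i
    using P by (simp add: c_def ennreal_powr_powr)
  show ?thesis
  proof (cases "\<integral>\<^sup>+i. c i \<partial>count_space I")
    case top
    then show ?thesis by (simp add: c_def)
  next
    case (real C)
    have fin: "c i \<noteq> \<infinity>" if "i \<in> I" for i
      using nn_integral_ge_point[OF that, of c] real by (auto simp: top_unique)
    have AE: "AE x in M. \<forall>i\<in>I. F i x = c i * (F i x / c i)"
    proof (subst AE_ball_countable[OF I], safe)
      fix i assume i: "i \<in> I"
      show "AE x in M. F i x = c i * (F i x / c i)"
      \<comment> \<open>If c i = 0 the quotient carries no information, but then F i vanishes almost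
        everywhere.\<close>
      proof (cases "c i = 0")
        case True
        then have "(\<integral>\<^sup>+x. ennreal_powr (F i x) P \<partial>M) = 0"
          using cP[of i] by simp
        then have "AE x in M. ennreal_powr (F i x) P = 0"
          using i by (subst (asm) nn_integral_0_iff_AE) auto
        then show ?thesis by eventually_elim (use True in \<open>simp add: ennreal_powr_eq_0_iff\<close>)
      next
        case False
        then show ?thesis using fin[OF i]
          by (auto simp: ennreal_times_divide ennreal_mult_divide_eq mult.commute[of "c i"] less_top)
      qed
    qed
    define G where "G i x = F i x / c i" for i x
    have [measurable]: "G i \<in> borel_measurable M" if "i \<in> I" for i
      using that unfolding G_def by measurable
    have "(\<integral>\<^sup>+x. ennreal_powr (\<integral>\<^sup>+i. F i x \<partial>count_space I) P \<partial>M)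
        = (\<integral>\<^sup>+x. ennreal_powr (\<integral>\<^sup>+i. c i * G i x \<partial>count_space I) P \<partial>M)"
      using AE by (intro nn_integral_cong_AE, eventually_elim)
        (auto simp: G_def intro!: arg_cong2[where f = ennreal_powr] nn_integral_cong)
    also have "\<dots> \<le> ennreal (C powr P)"
    proof (cases "C = 0")
      case True
      then have "AE i in count_space I. c i = 0"
        using real nn_integral_0_iff_AE[of c "count_space I"] by simp
      then have "(\<integral>\<^sup>+i. c i * G i x \<partial>count_space I) = 0" for x
        by (subst nn_integral_0_iff_AE) auto
      then show ?thesis by simp
    next
      case False
      with real have C: "0 < C" by simp
      have "(\<integral>\<^sup>+x. ennreal_powr (\<integral>\<^sup>+i. c i * G i x \<partial>count_space I) P \<partial>M)
          \<le> (\<integral>\<^sup>+x. ennreal (C powr (P - 1)) * (\<integral>\<^sup>+i. c i * ennreal_powr (G i x) P \<partial>count_space I) \<partial>M)"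
        using real by (intro nn_integral_mono nn_integral_Jensen C P) auto
      also have "\<dots> = ennreal (C powr (P - 1)) * (\<integral>\<^sup>+x. (\<integral>\<^sup>+i. c i * ennreal_powr (G i x) P \<partial>count_space I) \<partial>M)"
        by (intro nn_integral_cmult measurable_nn_integral_count_space) (auto simp: I)
      also have "(\<integral>\<^sup>+x. (\<integral>\<^sup>+i. c i * ennreal_powr (G i x) P \<partial>count_space I) \<partial>M)
          = (\<integral>\<^sup>+i. (\<integral>\<^sup>+x. c i * ennreal_powr (G i x) P \<partial>M) \<partial>count_space I)"
        by (intro nn_integral_count_space_nn_integral I) auto
      also have "\<dots> \<le> (\<integral>\<^sup>+i. c i \<partial>count_space I)"
      proof (intro nn_integral_mono)
        fix i assume "i \<in> space (count_space I)"
        then have i: "i \<in> I" by simp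
        show "(\<integral>\<^sup>+x. c i * ennreal_powr (G i x) P \<partial>M) \<le> c i"
        proof (cases "c i = 0")
          case False
          then obtain r where r: "c i = ennreal r" "0 < r" using fin[OF i] by (cases "c i") auto
          have "F i x / c i = F i x * ennreal (1 / r)" for x
            using r by (simp add: divide_ennreal_def inverse_ennreal inverse_eq_divide)
          then have "(\<integral>\<^sup>+x. ennreal_powr (G i x) P \<partial>M) = ennreal_powr (c i) P * ennreal ((1 / r) powr P)"
            using P i r by (simp add: G_def ennreal_powr_mult nn_integral_multc ennreal_powr_ennreal flip: cP)
          also have "\<dots> = 1"
            using r by (simp add: ennreal_powr_ennreal powr_divide flip: ennreal_mult)
          finally show ?thesis using i by (simp add: nn_integral_cmult)
        qed simp
      qed
      also have "ennreal (C powr (P - 1)) * (\<integral>\<^sup>+i. c i \<partial>count_space I) = ennreal (C powr P)"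
        using C real by (simp add: powr_diff flip: ennreal_mult)
      finally show ?thesis by (simp add: mult_left_mono)
    qed
    finally have "ennreal_powr (\<integral>\<^sup>+x. ennreal_powr (\<integral>\<^sup>+i. F i x \<partial>count_space I) P \<partial>M) (1 / P)
        \<le> ennreal_powr (ennreal (C powr P)) (1 / P)"
      using P by (intro ennreal_powr_mono) auto
    also have "\<dots> = ennreal C" using real P by (simp add: ennreal_powr_ennreal powr_powr)
    finally show ?thesis using real by (simp add: c_def)
  qed
qed

subsection \<open>Factorization in quasi-normed modules\<close>

text \<open>\<open>N\<close> stands for the r-th power of a quasi-norm, extended by
  \<open>top\<close> to a surrounding vector space; the space proper is the set where
  \<open>N\<close> is finite. Completeness is phrased for series with an explicit tail bound, which
  is what pointwise summation of functions yields.\<close>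

locale quasi_norm =
  fixes r :: real and N :: "'x::real_vector \<Rightarrow> ennreal"
  assumes r_pos: "0 < r"
    and triangle: "N (x + y) \<le> N x + N y"
    and scale: "N (c *\<^sub>R x) = ennreal (\<bar>c\<bar> powr r) * N x"
    and definite: "N x = 0 \<Longrightarrow> x = 0"
    and complete: "(\<Sum>n. N (u n)) < top \<Longrightarrow> \<exists>s. \<forall>n. N (s - (\<Sum>i<n. u i)) \<le> (\<Sum>i. N (u (i + n)))"
begin

lemma zero [simp]: "N 0 = 0"
  using scale[of 0 0] by simp

lemma minus [simp]: "N (- x) = N x"
  using scale[of "-1" x] by simp

lemma minus_commute: "N (x - y) = N (y - x)"
  using minus[of "x - y"] by simp

lemma add_le:
  assumes "N x \<le> ennreal u" "N y \<le> ennreal w" "0 \<le> u" "0 \<le> w"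
  shows "N (x + y) \<le> ennreal (u + w)"
  using order_trans[OF triangle add_mono[OF assms(1,2)]] assms(3,4) by simp

lemma scale_le:
  assumes "N x \<le> ennreal u" "0 \<le> u"
  shows "N (c *\<^sub>R x) \<le> ennreal (\<bar>c\<bar> powr r * u)"
  using mult_left_mono[OF assms(1), of "ennreal (\<bar>c\<bar> powr r)"] assms(2)
  by (simp add: scale ennreal_mult)

lemma finite_add: "N x < top \<Longrightarrow> N y < top \<Longrightarrow> N (x + y) < top"
  using triangle[of x y] by (auto simp: less_top[symmetric] top_unique)

lemma finite_scale: "N x < top \<Longrightarrow> N (c *\<^sub>R x) < top"
  by (simp add: scale ennreal_mult_less_top)

lemma finite_diff: "N x < top \<Longrightarrow> N y < top \<Longrightarrow> N (x - y) < top"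
  using finite_add[of x "- y"] by simp

text \<open>Stands in for uniqueness of limits: an identity between limits is obtained by bounding
  the difference of its two sides geometrically.\<close>

lemma eq_0_of_geometric:
  assumes "\<And>n. N x \<le> ennreal (C * \<theta> ^ n)" "0 \<le> \<theta>" "\<theta> < 1"
  shows "x = 0"
proof -
  have "(\<lambda>n. ennreal (C * \<theta> ^ n)) \<longlonglongrightarrow> ennreal (C * 0)"
    by (intro tendsto_intros LIMSEQ_power_zero) (use assms in auto)
  then have "N x \<le> 0"
    using assms(1) by (intro LIMSEQ_le_const[of _ 0]) auto
  then show ?thesis by (intro definite) simp
qed

text \<open>Cauchy sequences occur below only with geometric increments. The limit comes with its
  rate of convergence, so that no topology on the vector space has to be set up.\<close>

lemma telescoping_limit:
  assumes diff: "\<And>n. N (x (Suc n) - x n) \<le> ennreal (C * \<theta> ^ n)" and "0 \<le> \<theta>" "\<theta> < 1" "0 \<le> C"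
  shows "\<exists>s. \<forall>n. N (s - x n) \<le> ennreal (C / (1 - \<theta>) * \<theta> ^ n)"
proof -
  have sum: "(\<Sum>i. N (x (Suc (i + n)) - x (i + n))) \<le> ennreal (C / (1 - \<theta>) * \<theta> ^ n)" for n
  proof -
    have "(\<lambda>i. C * \<theta> ^ n * \<theta> ^ i) sums (C * \<theta> ^ n * (1 / (1 - \<theta>)))"
      using assms by (intro sums_mult geometric_sums) auto
    then have "(\<Sum>i. ennreal (C * \<theta> ^ (i + n))) = ennreal (C / (1 - \<theta>) * \<theta> ^ n)"
      using assms by (intro suminf_ennreal_eq) (auto simp: power_add mult_ac)
    moreover have "(\<Sum>i. N (x (Suc (i + n)) - x (i + n))) \<le> (\<Sum>i. ennreal (C * \<theta> ^ (i + n)))"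
      by (intro suminf_le diff) auto
    ultimately show ?thesis by simp
  qed
  define u where "u n = x (Suc n) - x n" for n
  have "(\<Sum>n. N (u n)) < top"
    using sum[of 0] by (simp add: u_def order.strict_trans1)
  from complete[OF this] obtain s where s: "N (s - (\<Sum>i<n. u i)) \<le> (\<Sum>i. N (u (i + n)))" for n
    by blast
  have "N (s + x 0 - x n) \<le> ennreal (C / (1 - \<theta>) * \<theta> ^ n)" for n
    using order_trans[OF s[of n]] sum[of n]
    by (simp add: u_def sum_lessThan_telescope algebra_simps)
  then show ?thesis by blast
qed

end

text \<open>The module laws are demanded for elements of finite quasi-norm only, since convolution
  integrals may diverge elsewhere. \<open>mul\<close> acts on one ambient type, so that the algebra
  is itself the instance \<open>N = NA\<close>.\<close>

locale quasi_module = quasi_norm r N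
  for r :: real and N :: "'x::real_vector \<Rightarrow> ennreal" +
  fixes mul :: "'x \<Rightarrow> 'x \<Rightarrow> 'x" and NA :: "'x \<Rightarrow> ennreal" and K :: real
  assumes K_ge_1: "1 \<le> K"
    and mul_bound: "NA a < top \<Longrightarrow> N h < top \<Longrightarrow> N (mul a h) \<le> ennreal K * NA a * N h"
    and mul_add_left: "NA a < top \<Longrightarrow> NA a' < top \<Longrightarrow> N h < top \<Longrightarrow> mul (a + a') h = mul a h + mul a' h"
    and mul_add_right: "NA a < top \<Longrightarrow> N h < top \<Longrightarrow> N h' < top \<Longrightarrow> mul a (h + h') = mul a h + mul a h'"
    and mul_scale_left: "NA a < top \<Longrightarrow> N h < top \<Longrightarrow> mul (c *\<^sub>R a) h = c *\<^sub>R mul a h"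
    and mul_scale_right: "NA a < top \<Longrightarrow> N h < top \<Longrightarrow> mul a (c *\<^sub>R h) = c *\<^sub>R mul a h"
    and mul_assoc: "NA a < top \<Longrightarrow> NA a' < top \<Longrightarrow> N h < top \<Longrightarrow> mul (mul a a') h = mul a (mul a' h)"
begin

lemma mul_le:
  assumes "NA a \<le> ennreal u" "N h \<le> ennreal w" "0 \<le> u" "0 \<le> w"
  shows "N (mul a h) \<le> ennreal (K * u * w)"
proof -
  have "N (mul a h) \<le> ennreal K * NA a * N h"
    using assms by (intro mul_bound) (auto intro: order.strict_trans1)
  also have "\<dots> \<le> ennreal K * ennreal u * ennreal w"
    by (intro mult_mono assms) auto
  finally show ?thesis using assms K_ge_1 by (simp add: ennreal_mult)
qed

lemma finite_mul: "NA a < top \<Longrightarrow> N h < top \<Longrightarrow> N (mul a h) < top"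
  using mul_bound[of a h] by (auto simp: ennreal_mult_less_top intro: order.strict_trans1)

lemma mul_diff_right:
  "NA a < top \<Longrightarrow> N h < top \<Longrightarrow> N h' < top \<Longrightarrow> mul a (h - h') = mul a h - mul a h'"
  using mul_add_right[of a h "(-1) *\<^sub>R h'"] mul_scale_right[of a h' "-1"] by simp

end

text \<open>The unit must approximate from the right on the algebra and from the left on the module,
  because the factors \<open>R\<close> accumulate to the right of \<open>a\<close> and their
  inverses to the left of \<open>b\<close>. The bound \<open>M\<close> must not depend on
  \<open>a\<close>, \<open>b\<close> or \<epsilon>.\<close>

locale quasi_algebra_module =
  A: quasi_module r NA mul NA K + B: quasi_module r NB mul NA K
  for r K :: real and NA NB :: "'x::real_vector \<Rightarrow> ennreal" and mul +
  fixes M :: real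
  assumes approx_unit: "NA a < top \<Longrightarrow> NB b < top \<Longrightarrow> 0 < \<epsilon> \<Longrightarrow>
    \<exists>e. NA e \<le> ennreal M \<and> NA (mul a e - a) \<le> ennreal \<epsilon> \<and> NB (mul e b - b) \<le> ennreal \<epsilon>"
begin

lemma A_mul_diff_left:
  "NA a < top \<Longrightarrow> NA a' < top \<Longrightarrow> NA h < top \<Longrightarrow> mul (a - a') h = mul a h - mul a' h"
  using A.mul_add_left[of a "(-1) *\<^sub>R a'" h] A.mul_scale_left[of a' h "-1"] by simp

lemma B_mul_diff_left:
  "NA a < top \<Longrightarrow> NA a' < top \<Longrightarrow> NB h < top \<Longrightarrow> mul (a - a') h = mul a h - mul a' h"
  using B.mul_add_left[of a "(-1) *\<^sub>R a'" h] B.mul_scale_left[of a' h "-1"] by simp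

text \<open>Here \<open>1 + g\<close> is the inverse of \<open>1 - \<theta> e\<close>, given by the Neumann series.\<close>

lemma ex_resolvent:
  assumes e: "NA e \<le> ennreal m" and \<theta>: "0 < \<theta>" "\<theta> powr r * K * m \<le> 1 / 2" "0 \<le> m"
  shows "\<exists>g. NA g \<le> 1 \<and> g = \<theta> *\<^sub>R (e + mul e g) \<and> g = \<theta> *\<^sub>R (e + mul g e)"
proof -
  have e_fin: "NA e < top" using e by (auto intro: order.strict_trans1)
  \<comment> \<open>The term u n is (\<theta> e)^(n+1).\<close>
  define u where "u = rec_nat (\<theta> *\<^sub>R e) (\<lambda>n x. \<theta> *\<^sub>R mul e x)"
  have u0: "u 0 = \<theta> *\<^sub>R e" and uS: "u (Suc n) = \<theta> *\<^sub>R mul e (u n)" for n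
    by (simp_all add: u_def)
  have \<theta>m: "\<theta> powr r * m \<le> 1 / 2"
  proof -
    have "\<theta> powr r * m * 1 \<le> \<theta> powr r * m * K"
      using \<theta> A.K_ge_1 by (intro mult_left_mono) auto
    then show ?thesis using \<theta> by (simp add: mult_ac)
  qed
  have u_le: "NA (u n) \<le> ennreal ((1 / 2) * (1 / 2) ^ n)" for n
  proof (induction n)
    case 0
    have "NA (u 0) \<le> ennreal (\<theta> powr r * m)"
      using A.scale_le[OF e, of \<theta>] \<theta> by (simp add: u0)
    also have "\<dots> \<le> ennreal (1 / 2)" using \<theta>m by (intro ennreal_leI)
    finally show ?case by simp
  next
    case (Suc n)
    have "NA (u (Suc n)) \<le> ennreal (\<bar>\<theta>\<bar> powr r * (K * m * ((1 / 2) * (1 / 2) ^ n)))"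
      unfolding uS using A.K_ge_1 \<theta> by (intro A.scale_le A.mul_le e Suc) auto
    also have "\<bar>\<theta>\<bar> powr r * (K * m * ((1 / 2) * (1 / 2) ^ n)) \<le> (1 / 2) * ((1 / 2) * (1 / 2) ^ n)"
      using mult_right_mono[OF \<theta>(2), of "(1 / 2) * (1 / 2) ^ n"] \<theta>(1) by (simp add: mult_ac)
    finally show ?case by simp (meson ennreal_leI order_trans)
  qed
  then have u_fin: "NA (u n) < top" for n
    by (rule order.strict_trans1) simp
  \<comment> \<open>Multiplying by e from the left or from the right gives the same powers. Both
    recursions are used, since g has to satisfy a left and a right resolvent equation.\<close>
  have uS': "u (Suc n) = \<theta> *\<^sub>R mul (u n) e" for n
  proof (induction n)
    case 0
    then show ?case by (simp add: uS u0 A.mul_scale_left A.mul_scale_right e_fin)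
  next
    case (Suc n)
    have "u (Suc (Suc n)) = \<theta> *\<^sub>R mul e (\<theta> *\<^sub>R mul (u n) e)"
      by (simp add: uS[of "Suc n"] Suc)
    also have "\<dots> = \<theta> *\<^sub>R mul (\<theta> *\<^sub>R mul e (u n)) e"
      by (simp add: A.mul_scale_left A.mul_scale_right A.mul_assoc A.finite_mul e_fin u_fin)
    finally show ?case by (simp add: uS)
  qed
  define S where "S n = (\<Sum>i<n. u i)" for n
  have S_fin: "NA (S n) < top" for n
    by (induction n) (auto simp: S_def A.finite_add u_fin)
  have S1: "S (Suc n) = \<theta> *\<^sub>R (e + mul e (S n))" for n
  proof (induction n)
    case 0
    have "mul e 0 = 0" using A.mul_scale_right[of e 0 0] e_fin by simp
    then show ?case by (simp add: S_def u0)
  next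
    case (Suc n)
    have "S (Suc (Suc n)) = S (Suc n) + u (Suc n)" by (simp add: S_def)
    also have "\<dots> = \<theta> *\<^sub>R (e + (mul e (S n) + mul e (u n)))"
      by (simp add: Suc uS scaleR_add_right)
    also have "mul e (S n) + mul e (u n) = mul e (S n + u n)"
      by (simp add: A.mul_add_right e_fin S_fin u_fin)
    finally show ?case by (simp add: S_def)
  qed
  have S2: "S (Suc n) = \<theta> *\<^sub>R (e + mul (S n) e)" for n
  proof (induction n)
    case 0
    have "mul 0 e = 0" using A.mul_scale_left[of 0 e 0] e_fin by simp
    then show ?case by (simp add: S_def u0)
  next
    case (Suc n)
    have "S (Suc (Suc n)) = S (Suc n) + u (Suc n)" by (simp add: S_def)
    also have "\<dots> = \<theta> *\<^sub>R (e + (mul (S n) e + mul (u n) e))"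
      by (simp add: Suc uS' scaleR_add_right)
    also have "mul (S n) e + mul (u n) e = mul (S n + u n) e"
      by (simp add: A.mul_add_left e_fin S_fin u_fin)
    finally show ?case by (simp add: S_def)
  qed
  have "\<exists>g. \<forall>n. NA (g - S n) \<le> ennreal ((1 / 2) / (1 - 1 / 2) * (1 / 2) ^ n)"
    using u_le by (intro A.telescoping_limit) (auto simp: S_def)
  then obtain g where g: "NA (g - S n) \<le> ennreal ((1 / 2) ^ n)" for n
    by auto
  have g1: "NA g \<le> 1" using g[of 0] by (simp add: S_def)
  then have g_fin: "NA g < top" by (auto intro: order.strict_trans1)
  have g': "NA (S n - g) \<le> ennreal ((1 / 2) ^ n)" for n
    using g[of n] by (simp add: A.minus_commute)
  \<comment> \<open>The first summand is the distance from g to S (Suc n); the second is the image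
    of g - S n under \<theta> e, where \<theta>^r K m <= 1/2 supplies the other half.\<close>
  have bnd: "(1 / 2) ^ Suc n + \<bar>\<theta>\<bar> powr r * (K * m * (1 / 2) ^ n) \<le> 1 * (1 / 2 :: real) ^ n" for n
  proof -
    have "\<theta> powr r * K * m * (1 / 2) ^ n \<le> 1 / 2 * (1 / 2) ^ n"
      by (intro mult_right_mono \<theta>) simp
    moreover have "\<bar>\<theta>\<bar> powr r * (K * m * (1 / 2) ^ n) = \<theta> powr r * K * m * (1 / 2) ^ n"
      using \<theta>(1) by (simp only: abs_of_pos mult.assoc)
    moreover have "(1 / 2) ^ Suc n = 1 / 2 * (1 / 2 :: real) ^ n" by simp
    ultimately show ?thesis by linarith
  qed
  have bnd': "(1 / 2) ^ Suc n + \<bar>\<theta>\<bar> powr r * (K * (1 / 2) ^ n * m) \<le> 1 * (1 / 2 :: real) ^ n" for n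
    using bnd[of n] by (simp add: mult_ac)
  have "g - \<theta> *\<^sub>R (e + mul e g) = 0"
  proof (rule A.eq_0_of_geometric)
    fix n
    have "g - \<theta> *\<^sub>R (e + mul e g) = (g - S (Suc n)) + \<theta> *\<^sub>R mul e (S n - g)"
      by (simp add: S1 A.mul_diff_right e_fin S_fin g_fin algebra_simps)
    also have "NA \<dots> \<le> ennreal ((1 / 2) ^ Suc n + \<bar>\<theta>\<bar> powr r * (K * m * (1 / 2) ^ n))"
      using A.K_ge_1 \<theta> by (intro A.add_le A.scale_le A.mul_le g g' e) auto
    also have "\<dots> \<le> ennreal (1 * (1 / 2) ^ n)" by (rule ennreal_leI[OF bnd])
    finally show "NA (g - \<theta> *\<^sub>R (e + mul e g)) \<le> ennreal (1 * (1 / 2) ^ n)" .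
  qed auto
  moreover have "g - \<theta> *\<^sub>R (e + mul g e) = 0"
  proof (rule A.eq_0_of_geometric)
    fix n
    have "g - \<theta> *\<^sub>R (e + mul g e) = (g - S (Suc n)) + \<theta> *\<^sub>R mul (S n - g) e"
      by (simp add: S2 A_mul_diff_left e_fin S_fin g_fin algebra_simps)
    also have "NA \<dots> \<le> ennreal ((1 / 2) ^ Suc n + \<bar>\<theta>\<bar> powr r * (K * (1 / 2) ^ n * m))"
      using A.K_ge_1 \<theta> by (intro A.add_le A.scale_le A.mul_le g g' e) auto
    also have "\<dots> \<le> ennreal (1 * (1 / 2) ^ n)" by (rule ennreal_leI[OF bnd'])
    finally show "NA (g - \<theta> *\<^sub>R (e + mul g e)) \<le> ennreal (1 * (1 / 2) ^ n)" .
  qed auto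
  ultimately show ?thesis using g1 by auto
qed

text \<open>With \<tau> = 1 - \<theta> and R = \<tau> (1 + g), the product (\<tau>^n + a) b is
  rewritten as ((\<tau>^n + a) R) (R^-1 b). Here a' is the non-scalar part of the first bracket and
  b' is the second bracket; the adjoined unit is only notation and appears as the separate scalar
  term.\<close>

lemma factorization_step:
  assumes \<theta>: "0 < \<theta>" "\<theta> \<le> 1 / 2" "\<theta> powr r * K * max 0 M \<le> 1 / 2"
    and a: "NA a < top" and b: "NB b < top" and f: "f = (1 - \<theta>) ^ n *\<^sub>R b + mul a b"
  shows "\<exists>a' b'. NA a' < top \<and> NB b' < top \<and> f = (1 - \<theta>) ^ Suc n *\<^sub>R b' + mul a' b' \<and>
    NA (a' - a) \<le> ennreal (2 * ((1 - \<theta>) powr r) ^ n) \<and> NB (b' - b) \<le> ennreal ((1 / 2) ^ n)"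
proof -
  define \<tau> where "\<tau> = 1 - \<theta>"
  define q where "q = \<tau> powr r"
  have \<tau>: "0 < \<tau>" "\<tau> < 1" using \<theta> by (auto simp: \<tau>_def)
  have q: "0 < q" "q < 1" using \<tau> A.r_pos powr_less_mono2[of r \<tau> 1] by (auto simp: q_def)
  have K1: "0 < 1 + K" using A.K_ge_1 by simp
  \<comment> \<open>The change of a contains an error of size \<epsilon> + K \<epsilon>, to be kept
    below q^n; the change of b is to be kept below (1/2)^n.\<close>
  define \<epsilon> where "\<epsilon> = min (q ^ n / (1 + K)) ((1 / 2) ^ n)"
  have \<epsilon>: "0 < \<epsilon>" using q K1 by (simp add: \<epsilon>_def)
  obtain e where e: "NA e \<le> ennreal M" "NA (mul a e - a) \<le> ennreal \<epsilon>" "NB (mul e b - b) \<le> ennreal \<epsilon>"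
    using approx_unit[OF a b \<epsilon>] by blast
  \<comment> \<open>A negative M is read as 0 by \<open>ennreal\<close>, so the resolvent is built
    with the nonnegative bound \<open>max 0 M\<close>.\<close>
  have e': "NA e \<le> ennreal (max 0 M)" using e(1) by (cases "0 \<le> M") (auto simp: ennreal_neg)
  obtain g where g1: "NA g \<le> 1" and g2: "g = \<theta> *\<^sub>R (e + mul e g)" and g3: "g = \<theta> *\<^sub>R (e + mul g e)"
    using ex_resolvent[OF e' \<theta>(1,3)] by auto
  have g1': "NA g \<le> ennreal 1" using g1 by simp
  have fin [simp]: "NA a < top" "NB b < top" "NA e < top" "NA g < top"
    using a b e(1) g1 by (auto intro: order.strict_trans1)
  note [simp] = A.finite_mul B.finite_mul A.finite_add B.finite_add A.finite_diff B.finite_diff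
    A.finite_scale B.finite_scale
  define b' where "b' = (1 / \<tau>) *\<^sub>R (b - \<theta> *\<^sub>R mul e b)"
  define a' where "a' = \<tau> ^ Suc n *\<^sub>R g + \<tau> *\<^sub>R (a + mul a g)"
  have b'_fin [simp]: "NB b' < top" by (simp add: b'_def)
  have a'_fin [simp]: "NA a' < top" by (simp add: a'_def)
  have "\<tau> *\<^sub>R b' = b - \<theta> *\<^sub>R mul e b" using \<tau> by (simp add: b'_def)
  moreover have "mul g (\<tau> *\<^sub>R b') = \<tau> *\<^sub>R mul g b'" by (simp add: B.mul_scale_right)
  moreover have "mul g (b - \<theta> *\<^sub>R mul e b) = mul g b - \<theta> *\<^sub>R mul (mul g e) b"
    by (simp add: B.mul_diff_right B.mul_scale_right B.mul_assoc)
  moreover have "mul g b = \<theta> *\<^sub>R mul e b + \<theta> *\<^sub>R mul (mul g e) b"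
    by (subst g3) (simp add: B.mul_scale_left B.mul_add_left scaleR_add_right)
  \<comment> \<open>This is R (R^-1 b) = b: the identity (1 + g) (1 - \<theta> e) = 1 amounts to g =
    \<theta> (e + g e).\<close>
  ultimately have Rb': "\<tau> *\<^sub>R (b' + mul g b') = b"
    by (simp add: scaleR_add_right)
  have "mul a b = \<tau> *\<^sub>R (mul a b' + mul a (mul g b'))"
    unfolding Rb'[symmetric] by (simp add: B.mul_scale_right B.mul_add_right)
  moreover have "\<tau> ^ n *\<^sub>R b = \<tau> ^ Suc n *\<^sub>R b' + \<tau> ^ Suc n *\<^sub>R mul g b'"
    unfolding Rb'[symmetric] by (simp add: scaleR_add_right mult.commute)
  moreover have "mul a' b' = \<tau> ^ Suc n *\<^sub>R mul g b' + \<tau> *\<^sub>R (mul a b' + mul a (mul g b'))"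
    unfolding a'_def by (simp add: B.mul_scale_left B.mul_add_left B.mul_assoc)
  ultimately have f': "f = \<tau> ^ Suc n *\<^sub>R b' + mul a' b'"
    using f by (simp add: \<tau>_def)
  have "\<tau> *\<^sub>R (b' - b) = \<theta> *\<^sub>R (b - mul e b)"
    using \<tau> by (simp add: b'_def \<tau>_def scaleR_diff_right scaleR_diff_left)
  then have "(1 / \<tau>) *\<^sub>R \<tau> *\<^sub>R (b' - b) = (1 / \<tau>) *\<^sub>R \<theta> *\<^sub>R (b - mul e b)"
    by (rule arg_cong)
  then have "b' - b = (\<theta> / \<tau>) *\<^sub>R (b - mul e b)"
    using \<tau> by simp
  also have "NB \<dots> \<le> ennreal (\<bar>\<theta> / \<tau>\<bar> powr r * \<epsilon>)"
    using e(3) \<epsilon> by (intro B.scale_le) (auto simp: B.minus_commute)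
  \<comment> \<open>Here \<theta> <= 1/2 is used, which gives \<theta> / \<tau> <= 1.\<close>
  also have "\<bar>\<theta> / \<tau>\<bar> powr r \<le> 1 powr r"
    using \<theta> \<tau> A.r_pos by (intro powr_mono2) (auto simp: \<tau>_def)
  then have "\<bar>\<theta> / \<tau>\<bar> powr r * \<epsilon> \<le> 1 * (1 / 2) ^ n"
    using \<epsilon> by (intro mult_mono) (auto simp: \<epsilon>_def)
  finally have b'b: "NB (b' - b) \<le> ennreal ((1 / 2) ^ n)"
    by (simp add: ennreal_leI)
  \<comment> \<open>The other equation, g = \<theta> (e + e g), brings out the small quantity a e -
    a. The only remaining term of a' - a is \<tau>^(n+1) g, which decays by itself.\<close>
  have "mul a g = \<theta> *\<^sub>R (mul a e + mul (mul a e) g)"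
    by (subst g2) (simp add: A.mul_scale_right A.mul_add_right A.mul_assoc)
  then have "a' - a = \<tau> ^ Suc n *\<^sub>R g + \<theta> *\<^sub>R ((mul a e - a) + mul (mul a e - a) g)"
    by (simp add: a'_def \<tau>_def A_mul_diff_left algebra_simps)
  also have "NA \<dots> \<le> ennreal (\<bar>\<tau> ^ Suc n\<bar> powr r * 1 + \<bar>\<theta>\<bar> powr r * (\<epsilon> + K * \<epsilon> * 1))"
    using \<epsilon> A.K_ge_1 by (intro A.add_le A.scale_le A.mul_le g1' e(2)) auto
  also have "\<bar>\<tau> ^ Suc n\<bar> powr r * 1 + \<bar>\<theta>\<bar> powr r * (\<epsilon> + K * \<epsilon> * 1) \<le> 2 * q ^ n"
  proof -
    have "\<bar>\<tau> ^ Suc n\<bar> powr r = q ^ Suc n"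
      using \<tau> by (simp only: abs_of_pos zero_less_power q_def powr_powr mult.commute powr_gt_zero flip: powr_realpow)
    also have "\<dots> \<le> q ^ n" using q by (simp add: mult_left_le_one_le)
    finally have 1: "\<bar>\<tau> ^ Suc n\<bar> powr r \<le> q ^ n" .
    have "\<bar>\<theta>\<bar> powr r \<le> 1 powr r" using \<theta> A.r_pos by (intro powr_mono2) auto
    then have "\<bar>\<theta>\<bar> powr r * (\<epsilon> * (1 + K)) \<le> 1 * (q ^ n / (1 + K) * (1 + K))"
      using \<epsilon> K1 by (intro mult_mono) (auto simp: \<epsilon>_def)
    also have "1 * (q ^ n / (1 + K) * (1 + K)) = q ^ n" using K1 by simp
    finally show ?thesis using 1 by (simp only: distrib_left distrib_right mult_1_right mult_1 ac_simps)
  qed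
  finally have a'a: "NA (a' - a) \<le> ennreal (2 * q ^ n)"
    by (simp add: ennreal_leI)
  show ?thesis
    using a'_fin b'_fin f' a'a b'b unfolding q_def \<tau>_def by blast
qed

theorem factorization:
  assumes f: "NB f < top"
  shows "\<exists>a b. NA a < top \<and> NB b < top \<and> f = mul a b"
proof -
  \<comment> \<open>Chosen so that \<theta>^r * K * max 0 M <= 1/2, which makes the Neumann series
    converge with ratio 1/2. The summand 1 keeps the denominator positive.\<close>
  define \<theta> where "\<theta> = min (1 / 2) ((1 / (2 * K * (max 0 M + 1))) powr (1 / r))"
  have K0: "0 < K" using A.K_ge_1 by simp
  have \<theta>: "0 < \<theta>" "\<theta> \<le> 1 / 2" using K0 by (auto simp: \<theta>_def)
  have "\<theta> powr r \<le> ((1 / (2 * K * (max 0 M + 1))) powr (1 / r)) powr r"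
    using \<theta> A.r_pos by (intro powr_mono2) (auto simp: \<theta>_def)
  also have "\<dots> = 1 / (2 * K * (max 0 M + 1))" using A.r_pos K0 by (simp add: powr_powr)
  finally have "\<theta> powr r * (K * (max 0 M + 1)) \<le> 1 / (2 * K * (max 0 M + 1)) * (K * (max 0 M + 1))"
    using K0 by (intro mult_right_mono) auto
  also have "\<dots> = 1 / 2" using K0 by simp
  finally have "\<theta> powr r * (K * (max 0 M + 1)) \<le> 1 / 2" .
  moreover have "\<theta> powr r * (K * max 0 M) \<le> \<theta> powr r * (K * (max 0 M + 1))"
    using K0 by (intro mult_left_mono) auto
  ultimately have \<theta>': "\<theta> powr r * K * max 0 M \<le> 1 / 2" unfolding mult.assoc by linarith
  define \<tau> where "\<tau> = 1 - \<theta>"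
  define q where "q = \<tau> powr r"
  have \<tau>: "0 < \<tau>" "\<tau> < 1" using \<theta> by (auto simp: \<tau>_def)
  have q: "0 < q" "q < 1" using \<tau> A.r_pos powr_less_mono2[of r \<tau> 1] by (auto simp: q_def)
  \<comment> \<open>The pairs are (a_n, b_n), starting from (0, f), where the scalar part is still
    1.\<close>
  define P where "P n x \<longleftrightarrow> NA (fst x) < top \<and> NB (snd x) < top \<and>
      f = \<tau> ^ n *\<^sub>R snd x + mul (fst x) (snd x) \<and> (n = 0 \<longrightarrow> x = (0, f))" for n and x :: "'x \<times> 'x"
  define Q where "Q n x y \<longleftrightarrow> NA (fst y - fst x) \<le> ennreal (2 * q ^ n) \<and>
      NB (snd y - snd x) \<le> ennreal (1 * (1 / 2) ^ n)" for n and x y :: "'x \<times> 'x"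
  have "\<exists>F. \<forall>n. P n (F n) \<and> Q n (F n) (F (Suc n))"
  proof (rule dependent_nat_choice)
    have "mul 0 f = 0" using B.mul_scale_left[of 0 f 0] f by simp
    then show "\<exists>x. P 0 x" using f by (auto simp: P_def)
  next
    fix x n assume "P n x"
    then show "\<exists>y. P (Suc n) y \<and> Q n x y"
      using factorization_step[OF \<theta> \<theta>', of "fst x" "snd x" f n]
      by (auto simp: P_def Q_def \<tau>_def q_def)
  qed
  then obtain F where F: "P n (F n)" "Q n (F n) (F (Suc n))" for n by blast
  define \<alpha> \<beta> where "\<alpha> n = fst (F n)" and "\<beta> n = snd (F n)" for n
  have fin [simp]: "NA (\<alpha> n) < top" "NB (\<beta> n) < top" for n
    using F(1)[of n] by (auto simp: P_def \<alpha>_def \<beta>_def)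
  have feq: "f = \<tau> ^ n *\<^sub>R \<beta> n + mul (\<alpha> n) (\<beta> n)" for n
    using F(1)[of n] by (simp add: P_def \<alpha>_def \<beta>_def)
  define c where "c = 2 / (1 - q)"
  have c: "0 \<le> c" using q by (simp add: c_def)
  have "\<exists>a. \<forall>n. NA (a - \<alpha> n) \<le> ennreal (2 / (1 - q) * q ^ n)"
    using F(2) q by (intro A.telescoping_limit) (auto simp: Q_def \<alpha>_def)
  then obtain a where a: "NA (a - \<alpha> n) \<le> ennreal (c * q ^ n)" for n
    by (auto simp: c_def)
  have "\<exists>b. \<forall>n. NB (b - \<beta> n) \<le> ennreal (1 / (1 - 1 / 2) * (1 / 2) ^ n)"
    using F(2) by (intro B.telescoping_limit) (auto simp: Q_def \<beta>_def)
  then obtain b where b: "NB (b - \<beta> n) \<le> ennreal (2 * (1 / 2) ^ n)" for n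
    by auto
  have a_fin: "NA a < top"
    using A.finite_add[of "a - \<alpha> 0" "\<alpha> 0"] order.strict_trans1[OF a[of 0]] by simp
  have b_fin: "NB b < top"
    using B.finite_add[of "b - \<beta> 0" "\<beta> 0"] order.strict_trans1[OF b[of 0]] by simp
  obtain x where x: "NA a = ennreal x" "0 \<le> x" using a_fin by (cases "NA a") auto
  obtain y where y: "NB b = ennreal y" "0 \<le> y" using b_fin by (cases "NB b") auto
  have \<alpha>_le: "NA (\<alpha> n) \<le> ennreal (x + c)" for n
  proof -
    have "NA (\<alpha> n - a) \<le> ennreal (c * q ^ n)" using a[of n] by (simp add: A.minus_commute)
    also have "\<dots> \<le> ennreal (c * 1)"
      using c q by (intro ennreal_leI mult_left_mono power_le_one) auto
    finally have "NA (\<alpha> n - a) \<le> ennreal c" by simp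
    then show ?thesis using A.add_le[of a x "\<alpha> n - a" c] x c by simp
  qed
  have b': "NB (\<beta> n - b) \<le> ennreal (2 * (1 / 2) ^ n)" for n
    using b[of n] by (simp add: B.minus_commute)
  have \<beta>_le: "NB (\<beta> n) \<le> ennreal (y + 2)" for n
  proof -
    have "NB (\<beta> n - b) \<le> ennreal (2 * (1 / 2) ^ n)" by (rule b')
    also have "\<dots> \<le> ennreal (2 * 1)" by (intro ennreal_leI mult_left_mono power_le_one) auto
    finally show ?thesis using B.add_le[of b y "\<beta> n - b" 2] y by simp
  qed
  \<comment> \<open>A common ratio for the two geometric rates, q for the left factors and 1/2 for
    the right ones.\<close>
  define Q' where "Q' = max q (1 / 2)"
  have Q': "0 \<le> Q'" "Q' < 1" "q ^ n \<le> Q' ^ n" "(1 / 2) ^ n \<le> Q' ^ n" for n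
    using q by (auto simp: Q'_def intro!: power_mono)
  define C where "C = (y + 2) + (K * c * y + K * (x + c) * 2)"
  have "f - mul a b = 0"
  proof (rule B.eq_0_of_geometric)
    fix n
    \<comment> \<open>Three errors: the vanishing scalar part, the distance of \<alpha> n from a,
      and the distance of \<beta> n from b.\<close>
    have "f - mul a b = \<tau> ^ n *\<^sub>R \<beta> n + (mul (\<alpha> n - a) b + mul (\<alpha> n) (\<beta> n - b))"
      by (subst feq[of n]) (simp add: B_mul_diff_left B.mul_diff_right a_fin b_fin)
    also have "NB \<dots> \<le> ennreal (\<bar>\<tau> ^ n\<bar> powr r * (y + 2) +
        (K * (c * q ^ n) * y + K * (x + c) * (2 * (1 / 2) ^ n)))"
      using a[of n] A.K_ge_1 c q x y
      by (intro B.add_le B.scale_le B.mul_le \<beta>_le b' \<alpha>_le) (auto simp: A.minus_commute)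
    also have "\<bar>\<tau> ^ n\<bar> powr r = q ^ n"
      using \<tau> by (simp only: abs_of_pos zero_less_power q_def powr_powr mult.commute powr_gt_zero flip: powr_realpow)
    also have "ennreal (q ^ n * (y + 2) + (K * (c * q ^ n) * y + K * (x + c) * (2 * (1 / 2) ^ n)))
        \<le> ennreal (Q' ^ n * (y + 2) + (K * (c * Q' ^ n) * y + K * (x + c) * (2 * Q' ^ n)))"
      using K0 x y c Q' by (intro ennreal_leI add_mono mult_right_mono mult_left_mono) auto
    also have "Q' ^ n * (y + 2) + (K * (c * Q' ^ n) * y + K * (x + c) * (2 * Q' ^ n)) = C * Q' ^ n"
      by (simp add: C_def algebra_simps)
    finally show "NB (f - mul a b) \<le> ennreal (C * Q' ^ n)" .
  qed (use Q' in auto)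
  then show ?thesis using a_fin b_fin by auto
qed

end

subsection \<open>Local norms on lattice cubes\<close>

abbreviation unit_cube :: "'a::euclidean_space \<Rightarrow> 'a set" where
  "unit_cube k \<equiv> cbox k (k + One)"

section \<open>Lattice points, unit cubes and differences of unit cubes\<close>

lemma of_int_floor_Ints: "x \<in> \<int> \<Longrightarrow> of_int \<lfloor>x\<rfloor> = (x :: real)"
  by (elim Ints_cases) simp

lemma lattice_expansion:
  assumes "k \<in> lattice"
  shows "k = (\<Sum>b\<in>Basis. of_int \<lfloor>k \<bullet> b\<rfloor> *\<^sub>R b)"
  using assms by (subst euclidean_representation[of k, symmetric], intro sum.cong)
    (simp_all add: lattice_def of_int_floor_Ints)

lemma countable_lattice: "countable (lattice :: 'a::euclidean_space set)"
proof (rule countable_subset)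
  show "lattice \<subseteq> (\<lambda>f. \<Sum>b\<in>Basis. of_int (f b) *\<^sub>R b) ` (PiE Basis (\<lambda>_. UNIV) :: ('a \<Rightarrow> int) set)"
  proof
    fix k :: 'a assume k: "k \<in> lattice"
    show "k \<in> (\<lambda>f. \<Sum>b\<in>Basis. of_int (f b) *\<^sub>R b) ` (PiE Basis (\<lambda>_. UNIV) :: ('a \<Rightarrow> int) set)"
    proof
      show "k = (\<Sum>b\<in>Basis. of_int ((\<lambda>b\<in>Basis. \<lfloor>k \<bullet> b\<rfloor>) b) *\<^sub>R b)"
        using lattice_expansion[OF k] by simp
    qed (simp add: restrict_def PiE_def extensional_def)
  qed
qed (auto intro!: countable_PiE)

text \<open>Differences of points of k + Q and j + Q lie in the union of the cubes k - j + l + Q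
  over these l. Their number enters all convolution constants.\<close>

definition offsets :: "'a::euclidean_space set" where
  "offsets = {l \<in> lattice. \<forall>b\<in>Basis. \<bar>l \<bullet> b\<bar> \<le> 1}"

lemma finite_offsets: "finite (offsets :: 'a::euclidean_space set)"
proof (rule finite_subset)
  show "offsets \<subseteq> (\<lambda>f. \<Sum>b\<in>Basis. of_int (f b) *\<^sub>R b) ` (PiE Basis (\<lambda>_. {-1..1}) :: ('a \<Rightarrow> int) set)"
  proof
    fix k :: 'a assume k: "k \<in> offsets"
    show "k \<in> (\<lambda>f. \<Sum>b\<in>Basis. of_int (f b) *\<^sub>R b) ` (PiE Basis (\<lambda>_. {-1..1}) :: ('a \<Rightarrow> int) set)"
    proof
      show "k = (\<Sum>b\<in>Basis. of_int ((\<lambda>b\<in>Basis. \<lfloor>k \<bullet> b\<rfloor>) b) *\<^sub>R b)"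
        using lattice_expansion[of k] k by (simp add: offsets_def)
      have "\<lfloor>k \<bullet> b\<rfloor> \<in> {-1..1}" if "b \<in> Basis" for b
      proof -
        have "\<bar>k \<bullet> b\<bar> \<le> 1" using k that by (simp add: offsets_def)
        then have "-1 \<le> \<lfloor>k \<bullet> b\<rfloor>" "\<lfloor>k \<bullet> b\<rfloor> \<le> 1" by linarith+
        then show ?thesis by simp
      qed
      then show "(\<lambda>b\<in>Basis. \<lfloor>k \<bullet> b\<rfloor>) \<in> PiE Basis (\<lambda>_. {-1..1})"
        by (simp add: restrict_def PiE_def extensional_def Pi_def)
    qed
  qed
qed (auto intro!: finite_PiE)

lemma lattice_add: "k \<in> lattice \<Longrightarrow> l \<in> lattice \<Longrightarrow> k + l \<in> lattice"
  and lattice_diff: "k \<in> lattice \<Longrightarrow> l \<in> lattice \<Longrightarrow> k - l \<in> lattice"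
  and zero_in_lattice: "0 \<in> lattice"
  by (auto simp: lattice_def inner_add_left inner_diff_left)

lemma offsets_lattice: "l \<in> offsets \<Longrightarrow> l \<in> lattice"
  by (simp add: offsets_def)

lemma floor_lattice: "(\<Sum>b\<in>Basis. of_int \<lfloor>x \<bullet> b\<rfloor> *\<^sub>R b) \<in> lattice"
  by (simp add: lattice_def inner_sum_left_Basis)

lemma ex_unit_cube: "\<exists>k\<in>lattice. x \<in> unit_cube k"
proof
  show "x \<in> unit_cube (\<Sum>b\<in>Basis. of_int \<lfloor>x \<bullet> b\<rfloor> *\<^sub>R b)"
    by (auto simp: mem_box inner_add_left inner_sum_left_Basis)
qed (rule floor_lattice)

lemma diff_in_unit_cube:
  assumes x: "x \<in> unit_cube k" and y: "y \<in> unit_cube j" and "k \<in> lattice" "j \<in> lattice"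
  shows "\<exists>l\<in>offsets. x - y \<in> unit_cube (k - j + l)"
proof -
  define u where "u = x - y - (k - j)"
  \<comment> \<open>The corner of a unit cube containing u. A coordinate of u may equal 1, so its
    floor ranges over -1, 0 and 1.\<close>
  define l where "l = (\<Sum>b\<in>Basis. of_int \<lfloor>u \<bullet> b\<rfloor> *\<^sub>R b)"
  have u: "\<bar>u \<bullet> b\<bar> \<le> 1" if "b \<in> Basis" for b
    using x y that by (force simp: u_def mem_box inner_add_left inner_diff_left abs_le_iff)
  have "\<bar>of_int \<lfloor>u \<bullet> b\<rfloor> :: real\<bar> \<le> 1" if "b \<in> Basis" for b
  proof -
    have "-1 \<le> \<lfloor>u \<bullet> b\<rfloor>" "\<lfloor>u \<bullet> b\<rfloor> \<le> 1" using u[OF that] by linarith+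
    then show ?thesis by linarith
  qed
  then have "l \<in> offsets"
    by (simp add: offsets_def l_def floor_lattice inner_sum_left_Basis)
  moreover have "x - y \<in> unit_cube (k - j + l)"
  proof -
    have "(k - j + l) \<bullet> b \<le> (x - y) \<bullet> b \<and> (x - y) \<bullet> b \<le> (k - j + l + One) \<bullet> b" if "b \<in> Basis" for b
    proof -
      have "of_int \<lfloor>u \<bullet> b\<rfloor> \<le> u \<bullet> b" "u \<bullet> b \<le> of_int \<lfloor>u \<bullet> b\<rfloor> + 1" by linarith+
      moreover have "u \<bullet> b = (x - y) \<bullet> b - (k - j) \<bullet> b" by (simp add: u_def inner_diff_left)
      moreover have "l \<bullet> b = of_int \<lfloor>u \<bullet> b\<rfloor>" using that by (simp add: l_def inner_sum_left_Basis)
      moreover have "One \<bullet> b = 1" using that by simp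
      ultimately show ?thesis
        unfolding inner_add_left by linarith
    qed
    then show ?thesis by (simp add: mem_box)
  qed
  ultimately show ?thesis by blast
qed

text \<open>The local norm for a finite exponent and a nonnegative function. Keeping the cube as an
  indicator inside the power leaves all integrals over \<open>lborel\<close>, where they can be
  translated and interchanged.\<close>

definition cube_norm :: "real \<Rightarrow> ('a::euclidean_space \<Rightarrow> ennreal) \<Rightarrow> 'a \<Rightarrow> ennreal" where
  "cube_norm p F k =
     ennreal_powr (\<integral>\<^sup>+x. ennreal_powr (F x * indicator (unit_cube k) x) p \<partial>lborel) (1 / p)"

text \<open>The \<open>r\<close>-th power of the amalgam quasi-norm: for \<open>r \<le> min 1 q\<close> it is subadditive.\<close>

definition amalgam ::
  "real \<Rightarrow> real \<Rightarrow> real \<Rightarrow> ('a::euclidean_space \<Rightarrow> real) \<Rightarrow> ('a \<Rightarrow> ennreal) \<Rightarrow> ennreal" where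
  "amalgam r p q \<omega> F =
     ennreal_powr (\<integral>\<^sup>+k. ennreal_powr (cube_norm p F k * ennreal (\<omega> k)) q \<partial>count_space lattice) (r / q)"

lemma cube_norm_mono_AE:
  assumes "AE x in lborel. F x \<le> G x" "1 \<le> p"
  shows "cube_norm p F k \<le> cube_norm p G k"
  unfolding cube_norm_def using assms
  by (intro ennreal_powr_mono nn_integral_mono_AE) (auto intro!: ennreal_powr_mono mult_right_mono)

lemma cube_norm_Minkowski:
  assumes "countable I" and [measurable]: "\<And>i. i \<in> I \<Longrightarrow> F i \<in> borel_measurable borel" and "1 \<le> p"
  shows "cube_norm p (\<lambda>x. \<integral>\<^sup>+i. F i x \<partial>count_space I) k \<le> (\<integral>\<^sup>+i. cube_norm p (F i) k \<partial>count_space I)"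
proof -
  have "(\<integral>\<^sup>+i. F i x \<partial>count_space I) * indicator (unit_cube k) x
      = (\<integral>\<^sup>+i. F i x * indicator (unit_cube k) x \<partial>count_space I)" for x
    by (simp add: nn_integral_multc)
  then show ?thesis
    unfolding cube_norm_def
    using nn_integral_Minkowski[OF assms(1), of "\<lambda>i x. F i x * indicator (unit_cube k) x" lborel p] assms(3)
    by simp
qed

lemma cube_norm_cmult:
  assumes "1 \<le> p" and [measurable]: "F \<in> borel_measurable borel"
  shows "cube_norm p (\<lambda>x. c * F x) k = c * cube_norm p F k"
proof -
  have "cube_norm p (\<lambda>x. c * F x) k =
      ennreal_powr (\<integral>\<^sup>+x. ennreal_powr c p * ennreal_powr (F x * indicator (unit_cube k) x) p \<partial>lborel) (1 / p)"
    using assms by (simp add: cube_norm_def mult.assoc ennreal_powr_mult)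
  also have "\<dots> = ennreal_powr (ennreal_powr c p) (1 / p) * cube_norm p F k"
    using assms by (simp add: nn_integral_cmult ennreal_powr_mult cube_norm_def)
  finally show ?thesis using assms by (simp add: ennreal_powr_powr)
qed

lemma cube_norm_powr:
  "1 \<le> p \<Longrightarrow> ennreal_powr (cube_norm p F k) p = (\<integral>\<^sup>+x. ennreal_powr (F x * indicator (unit_cube k) x) p \<partial>lborel)"
  by (simp add: cube_norm_def ennreal_powr_powr)

lemma cube_norm_1: "cube_norm 1 F k = (\<integral>\<^sup>+x. F x * indicator (unit_cube k) x \<partial>lborel)"
  by (simp add: cube_norm_def)

text \<open>The twisting factor has modulus 1, so this untwisted convolution, applied to moduli,
  governs integrability and all norm bounds.\<close>

definition nn_conv :: "('a::euclidean_space \<Rightarrow> ennreal) \<Rightarrow> ('a \<Rightarrow> ennreal) \<Rightarrow> 'a \<Rightarrow> ennreal" where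
  "nn_conv a H x = (\<integral>\<^sup>+y. a y * H (x - y) \<partial>lborel)"

lemma measurable_nn_conv [measurable]:
  assumes [measurable]: "a \<in> borel_measurable borel" "H \<in> borel_measurable borel"
  shows "nn_conv a H \<in> borel_measurable borel"
  unfolding nn_conv_def[abs_def] by measurable

lemma nn_integral_lborel_shift:
  assumes [measurable]: "f \<in> borel_measurable borel"
  shows "(\<integral>\<^sup>+x. f (c + x) \<partial>lborel) = (\<integral>\<^sup>+x. f x \<partial>(lborel :: 'a::euclidean_space measure))"
  by (subst lborel_distr_plus[of c, symmetric]) (simp add: nn_integral_distr)

text \<open>Translation by a point y of j + Q spreads the cube k + Q over the finitely many cubes k
  - j + l + Q, and Minkowski's inequality over \<open>offsets\<close> adds up their norms.\<close>

lemma cube_norm_shift_le: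
  fixes H :: "'a::euclidean_space \<Rightarrow> ennreal"
  assumes [measurable]: "H \<in> borel_measurable borel" and p: "1 \<le> p"
    and "k \<in> lattice" "j \<in> lattice" "y \<in> unit_cube j"
  shows "cube_norm p (\<lambda>x. H (x - y)) k \<le> (\<Sum>l\<in>offsets. cube_norm p H (k - j + l))"
proof -
  have "(\<integral>\<^sup>+x. ennreal_powr (H (x - y) * indicator (unit_cube k) x) p \<partial>lborel)
      = (\<integral>\<^sup>+x. ennreal_powr (H x * indicator (unit_cube k) (y + x)) p \<partial>lborel)"
    by (subst nn_integral_lborel_shift[of _ y, symmetric]) auto
  also have "\<dots> \<le> (\<integral>\<^sup>+x. ennreal_powr (\<integral>\<^sup>+l. H x * indicator (unit_cube (k - j + l)) x \<partial>count_space offsets) p \<partial>lborel)"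
  proof (intro nn_integral_mono ennreal_powr_mono)
    fix x
    show "H x * indicator (unit_cube k) (y + x) \<le> (\<integral>\<^sup>+l. H x * indicator (unit_cube (k - j + l)) x \<partial>count_space offsets)"
    proof (cases "y + x \<in> unit_cube k")
      case True
      then obtain l where l: "l \<in> offsets" "x \<in> unit_cube (k - j + l)"
        using diff_in_unit_cube[of "y + x" k y j] assms by auto
      show ?thesis
        using nn_integral_ge_point[OF l(1), of "\<lambda>l. H x * indicator (unit_cube (k - j + l)) x"] l True
        by simp
    qed simp
  qed (use p in auto)
  finally have "cube_norm p (\<lambda>x. H (x - y)) k
      \<le> ennreal_powr (\<integral>\<^sup>+x. ennreal_powr (\<integral>\<^sup>+l. H x * indicator (unit_cube (k - j + l)) x \<partial>count_space offsets) p \<partial>lborel) (1 / p)"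
    unfolding cube_norm_def using p by (intro ennreal_powr_mono) auto
  also have "\<dots> \<le> (\<integral>\<^sup>+l. cube_norm p H (k - j + l) \<partial>count_space offsets)"
    unfolding cube_norm_def using p finite_offsets
    by (intro nn_integral_Minkowski) (auto intro: countable_finite)
  finally show ?thesis
    by (simp add: nn_integral_count_space_finite finite_offsets)
qed

text \<open>Minkowski's inequality in integral form, from Jensen with weight \<open>a\<close> and
  Tonelli. The bound \<open>S\<close> is asked only where \<open>a\<close> is nonzero, so that the
  support of \<open>a\<close> can be exploited; this serves both the convolution bound and the
  approximate identity.\<close>

lemma cube_norm_integral_le:
  fixes D :: "'a::euclidean_space \<Rightarrow> 'a \<Rightarrow> ennreal"
  assumes [measurable]: "a \<in> borel_measurable borel" "case_prod D \<in> borel_measurable (borel \<Otimes>\<^sub>M borel)"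
    and p: "1 \<le> p"
    and S: "\<And>y. a y \<noteq> 0 \<Longrightarrow> cube_norm p (\<lambda>x. D x y) k \<le> S"
    and fin: "(\<integral>\<^sup>+y. a y \<partial>lborel) < top"
  shows "cube_norm p (\<lambda>x. \<integral>\<^sup>+y. a y * D x y \<partial>lborel) k \<le> (\<integral>\<^sup>+y. a y \<partial>lborel) * S"
proof (cases "(\<integral>\<^sup>+y. a y \<partial>lborel) = 0")
  case True
  then have ae: "AE y in lborel. a y = 0" by (subst (asm) nn_integral_0_iff_AE) auto
  have "(\<integral>\<^sup>+y. a y * D x y \<partial>lborel) = 0" for x
    by (subst nn_integral_0_iff_AE) (use ae in \<open>auto elim: eventually_mono\<close>)
  then show ?thesis by (simp add: cube_norm_def)
next
  case False
  then obtain A where A: "(\<integral>\<^sup>+y. a y \<partial>lborel) = ennreal A" "0 < A"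
    using fin by (cases "\<integral>\<^sup>+y. a y \<partial>lborel") (auto simp: top_unique)
  have "(\<integral>\<^sup>+x. ennreal_powr ((\<integral>\<^sup>+y. a y * D x y \<partial>lborel) * indicator (unit_cube k) x) p \<partial>lborel)
      = (\<integral>\<^sup>+x. ennreal_powr (\<integral>\<^sup>+y. a y * (D x y * indicator (unit_cube k) x) \<partial>lborel) p \<partial>lborel)"
    by (intro nn_integral_cong) (simp add: mult.assoc[symmetric] nn_integral_multc)
  also have "\<dots> \<le> (\<integral>\<^sup>+x. ennreal (A powr (p - 1)) *
      (\<integral>\<^sup>+y. a y * ennreal_powr (D x y * indicator (unit_cube k) x) p \<partial>lborel) \<partial>lborel)"
    using A p by (intro nn_integral_mono nn_integral_Jensen) auto
  also have "\<dots> = ennreal (A powr (p - 1)) *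
      (\<integral>\<^sup>+x. (\<integral>\<^sup>+y. a y * ennreal_powr (D x y * indicator (unit_cube k) x) p \<partial>lborel) \<partial>lborel)"
    by (intro nn_integral_cmult) auto
  also have "(\<integral>\<^sup>+x. (\<integral>\<^sup>+y. a y * ennreal_powr (D x y * indicator (unit_cube k) x) p \<partial>lborel) \<partial>lborel)
      = (\<integral>\<^sup>+y. (\<integral>\<^sup>+x. a y * ennreal_powr (D x y * indicator (unit_cube k) x) p \<partial>lborel) \<partial>lborel)"
    by (intro lborel_pair.Fubini') auto
  also have "\<dots> = (\<integral>\<^sup>+y. a y * (\<integral>\<^sup>+x. ennreal_powr (D x y * indicator (unit_cube k) x) p \<partial>lborel) \<partial>lborel)"
    by (intro nn_integral_cong nn_integral_cmult) auto
  also have "\<dots> \<le> (\<integral>\<^sup>+y. a y * ennreal_powr S p \<partial>lborel)"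
  proof (intro nn_integral_mono)
    fix y
    show "a y * (\<integral>\<^sup>+x. ennreal_powr (D x y * indicator (unit_cube k) x) p \<partial>lborel) \<le> a y * ennreal_powr S p"
    proof (cases "a y = 0")
      case False
      have "(\<integral>\<^sup>+x. ennreal_powr (D x y * indicator (unit_cube k) x) p \<partial>lborel)
          = ennreal_powr (cube_norm p (\<lambda>x. D x y) k) p" using p by (simp add: cube_norm_powr)
      also have "\<dots> \<le> ennreal_powr S p" using p S[OF False] by (intro ennreal_powr_mono) auto
      finally show ?thesis by (intro mult_left_mono) auto
    qed simp
  qed
  also have "\<dots> = ennreal A * ennreal_powr S p" using A by (simp add: nn_integral_multc)
  finally have "(\<integral>\<^sup>+x. ennreal_powr ((\<integral>\<^sup>+y. a y * D x y \<partial>lborel) * indicator (unit_cube k) x) p \<partial>lborel)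
      \<le> ennreal (A powr (p - 1)) * (ennreal A * ennreal_powr S p)" by (simp add: mult_left_mono)
  also have "\<dots> = ennreal (A powr p) * ennreal_powr S p"
    using A by (simp add: mult.assoc[symmetric] powr_diff flip: ennreal_mult)
  also have "\<dots> = ennreal_powr (ennreal A * S) p"
    using A p by (simp add: ennreal_powr_mult ennreal_powr_ennreal)
  finally have "cube_norm p (\<lambda>x. \<integral>\<^sup>+y. a y * D x y \<partial>lborel) k \<le> ennreal_powr (ennreal_powr (ennreal A * S) p) (1 / p)"
    unfolding cube_norm_def using p by (intro ennreal_powr_mono) auto
  then show ?thesis using p A by (simp add: ennreal_powr_powr)
qed

text \<open>Cut \<open>a\<close> into its pieces on the cubes j + Q; overlaps on faces only enlarge
  the sum. Each piece has finite mass and sits in a single cube, so the two preceding lemmas apply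
  to it.\<close>

lemma cube_norm_conv_le:
  fixes a H :: "'a::euclidean_space \<Rightarrow> ennreal"
  assumes [measurable]: "a \<in> borel_measurable borel" "H \<in> borel_measurable borel"
    and p: "1 \<le> p" and k: "k \<in> lattice"
    and fin: "\<And>j. j \<in> lattice \<Longrightarrow> cube_norm 1 a j < top"
  shows "cube_norm p (nn_conv a H) k \<le>
    (\<integral>\<^sup>+j. cube_norm 1 a j * (\<Sum>l\<in>offsets. cube_norm p H (k - j + l)) \<partial>count_space lattice)"
proof -
  define aj where "aj j y = a y * indicator (unit_cube j) y" for j y
  have [measurable]: "aj j \<in> borel_measurable borel" for j by (simp add: aj_def[abs_def])
  have "nn_conv a H x \<le> (\<integral>\<^sup>+j. nn_conv (aj j) H x \<partial>count_space lattice)" for x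
  proof -
    have "nn_conv a H x \<le> (\<integral>\<^sup>+y. (\<integral>\<^sup>+j. aj j y * H (x - y) \<partial>count_space lattice) \<partial>lborel)"
      unfolding nn_conv_def
    proof (intro nn_integral_mono)
      fix y :: 'a
      obtain j where j: "j \<in> lattice" "y \<in> unit_cube j" using ex_unit_cube by blast
      show "a y * H (x - y) \<le> (\<integral>\<^sup>+j. aj j y * H (x - y) \<partial>count_space lattice)"
        using nn_integral_ge_point[OF j(1), of "\<lambda>j. aj j y * H (x - y)"] j by (simp add: aj_def)
    qed
    also have "\<dots> = (\<integral>\<^sup>+j. nn_conv (aj j) H x \<partial>count_space lattice)"
      unfolding nn_conv_def by (intro nn_integral_count_space_nn_integral countable_lattice) auto
    finally show ?thesis .
  qed
  then have "cube_norm p (nn_conv a H) k \<le> cube_norm p (\<lambda>x. \<integral>\<^sup>+j. nn_conv (aj j) H x \<partial>count_space lattice) k"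
    using p by (intro cube_norm_mono_AE) auto
  also have "\<dots> \<le> (\<integral>\<^sup>+j. cube_norm p (nn_conv (aj j) H) k \<partial>count_space lattice)"
    using p by (intro cube_norm_Minkowski countable_lattice) auto
  also have "\<dots> \<le> (\<integral>\<^sup>+j. cube_norm 1 a j * (\<Sum>l\<in>offsets. cube_norm p H (k - j + l)) \<partial>count_space lattice)"
  proof (intro nn_integral_mono)
    fix j :: 'a assume "j \<in> space (count_space lattice)"
    then have j: "j \<in> lattice" by simp
    have eq: "cube_norm 1 a j = (\<integral>\<^sup>+y. aj j y \<partial>lborel)" by (simp add: cube_norm_1 aj_def)
    show "cube_norm p (nn_conv (aj j) H) k \<le> cube_norm 1 a j * (\<Sum>l\<in>offsets. cube_norm p H (k - j + l))"
      unfolding nn_conv_def[abs_def] eq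
    proof (rule cube_norm_integral_le)
      fix y assume "aj j y \<noteq> 0"
      then have "y \<in> unit_cube j" by (auto simp: aj_def indicator_def split: if_splits)
      then show "cube_norm p (\<lambda>x. H (x - y)) k \<le> (\<Sum>l\<in>offsets. cube_norm p H (k - j + l))"
        using p k j by (intro cube_norm_shift_le) auto
    next
      show "(\<integral>\<^sup>+y. aj j y \<partial>lborel) < top" using fin[OF j] eq by simp
    qed (use p in auto)
  qed
  finally show ?thesis .
qed

subsection \<open>Amalgam quasi-norms\<close>

text \<open>The r-th power of the l^q quasi-norm, so that sums of sequences can be estimated without
  a quasi-triangle constant.\<close>

definition seq_norm :: "real \<Rightarrow> real \<Rightarrow> ('a::euclidean_space \<Rightarrow> ennreal) \<Rightarrow> ennreal" where
  "seq_norm r q \<gamma> = ennreal_powr (\<integral>\<^sup>+k. ennreal_powr (\<gamma> k) q \<partial>count_space lattice) (r / q)"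

lemma amalgam_seq_norm: "amalgam r p q \<omega> F = seq_norm r q (\<lambda>k. cube_norm p F k * ennreal (\<omega> k))"
  by (simp add: amalgam_def seq_norm_def)

lemma seq_norm_mono:
  assumes "\<And>k. k \<in> lattice \<Longrightarrow> \<gamma> k \<le> \<delta> k" "0 < r" "r \<le> q"
  shows "seq_norm r q \<gamma> \<le> seq_norm r q \<delta>"
  unfolding seq_norm_def using assms
  by (intro ennreal_powr_mono nn_integral_mono) (auto intro!: ennreal_powr_mono)

text \<open>The r-th power is first taken inside the sum over i, which is possible for r <= 1. Then
  Minkowski's inequality applies with the exponent q / r, which is at least 1 because r <=
  q.\<close>

lemma seq_norm_Minkowski:
  assumes "countable I" "0 < r" "r \<le> 1" "r \<le> q"
  shows "seq_norm r q (\<lambda>k. \<integral>\<^sup>+i. \<gamma> i k \<partial>count_space I) \<le> (\<integral>\<^sup>+i. seq_norm r q (\<gamma> i) \<partial>count_space I)"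
proof -
  have P: "1 \<le> q / r" "1 / (q / r) = r / q" using assms by auto
  have pw: "ennreal_powr (ennreal_powr x r) (q / r) = ennreal_powr x q" for x
    using assms by (simp add: ennreal_powr_powr)
  have "seq_norm r q (\<lambda>k. \<integral>\<^sup>+i. \<gamma> i k \<partial>count_space I)
      \<le> ennreal_powr (\<integral>\<^sup>+k. ennreal_powr (\<integral>\<^sup>+i. ennreal_powr (\<gamma> i k) r \<partial>count_space I) (q / r) \<partial>count_space lattice) (r / q)"
    unfolding seq_norm_def pw[symmetric] using assms
    by (intro ennreal_powr_mono nn_integral_mono nn_integral_powr_subadditive) auto
  also have "\<dots> \<le> (\<integral>\<^sup>+i. seq_norm r q (\<gamma> i) \<partial>count_space I)"
    using nn_integral_Minkowski[OF assms(1), of "\<lambda>i k. ennreal_powr (\<gamma> i k) r" "count_space lattice" "q / r"] P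
    by (simp add: seq_norm_def pw)
  finally show ?thesis .
qed

lemma seq_norm_sum:
  assumes "finite I" "0 < r" "r \<le> 1" "r \<le> q"
  shows "seq_norm r q (\<lambda>k. \<Sum>i\<in>I. \<gamma> i k) \<le> (\<Sum>i\<in>I. seq_norm r q (\<gamma> i))"
  using seq_norm_Minkowski[of I r q \<gamma>] assms by (simp add: nn_integral_count_space_finite countable_finite)

lemma seq_norm_cmult:
  assumes "0 < r" "r \<le> q"
  shows "seq_norm r q (\<lambda>k. c * \<gamma> k) = ennreal_powr c r * seq_norm r q \<gamma>"
  unfolding seq_norm_def using assms
  by (simp add: ennreal_powr_mult nn_integral_cmult ennreal_powr_powr)

lemma seq_norm_shift:
  fixes m :: "'a::euclidean_space"
  assumes m: "m \<in> lattice"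
  shows "seq_norm r q (\<lambda>k. \<gamma> (k + m)) = seq_norm r q \<gamma>"
proof -
  have "bij_betw (\<lambda>k. k + m) lattice lattice"
    using m by (intro bij_betwI[where g = "\<lambda>k. k - m"]) (auto simp: lattice_add lattice_diff)
  from nn_integral_bij_count_space[OF this, of "\<lambda>k. ennreal_powr (\<gamma> k) q"]
  show ?thesis by (simp add: seq_norm_def)
qed

text \<open>Every shift has the quasi-norm of \<gamma>, by translation invariance of the lattice, so
  only the number of offsets enters.\<close>

lemma seq_norm_shifts_le:
  fixes \<gamma> :: "'a::euclidean_space \<Rightarrow> ennreal"
  assumes "0 < r" "r \<le> 1" "r \<le> q" "j \<in> lattice"
  shows "seq_norm r q (\<lambda>k. \<Sum>l\<in>offsets. c * \<gamma> (k - j + l))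
    \<le> of_nat (card (offsets :: 'a set)) * (ennreal_powr c r * seq_norm r q \<gamma>)"
proof -
  have "seq_norm r q (\<lambda>k. \<Sum>l\<in>offsets. c * \<gamma> (k - j + l))
      \<le> (\<Sum>l\<in>offsets. seq_norm r q (\<lambda>k. c * \<gamma> (k - j + l)))"
    using assms by (intro seq_norm_sum finite_offsets) auto
  also have "\<dots> = (\<Sum>l\<in>(offsets::'a set). ennreal_powr c r * seq_norm r q \<gamma>)"
  proof (intro sum.cong refl)
    fix l :: 'a assume "l \<in> offsets"
    then have "l - j \<in> lattice" using assms offsets_lattice lattice_diff by blast
    from seq_norm_shift[OF this, of r q \<gamma>]
    show "seq_norm r q (\<lambda>k. c * \<gamma> (k - j + l)) = ennreal_powr c r * seq_norm r q \<gamma>"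
      using assms by (simp add: seq_norm_cmult algebra_simps)
  qed
  finally show ?thesis by simp
qed

lemma amalgam_mono_AE:
  assumes "AE x in lborel. F x \<le> G x" "0 < r" "1 \<le> p" "r \<le> q"
  shows "amalgam r p q \<omega> F \<le> amalgam r p q \<omega> G"
  unfolding amalgam_seq_norm using assms
  by (intro seq_norm_mono mult_right_mono cube_norm_mono_AE) auto

lemma amalgam_cong:
  assumes "AE x in lborel. F x = G x"
  shows "amalgam r p q \<omega> F = amalgam r p q \<omega> G"
proof -
  have "cube_norm p F k = cube_norm p G k" for k
    unfolding cube_norm_def using assms
    by (intro arg_cong2[where f = ennreal_powr] refl nn_integral_cong_AE) (auto elim: eventually_mono)
  then show ?thesis by (simp add: amalgam_def)
qed

lemma amalgam_Minkowski:
  assumes "countable I" and [measurable]: "\<And>i. i \<in> I \<Longrightarrow> F i \<in> borel_measurable borel"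
    and "0 < r" "r \<le> 1" "1 \<le> p" "r \<le> q"
  shows "amalgam r p q \<omega> (\<lambda>x. \<integral>\<^sup>+i. F i x \<partial>count_space I) \<le> (\<integral>\<^sup>+i. amalgam r p q \<omega> (F i) \<partial>count_space I)"
proof -
  have "amalgam r p q \<omega> (\<lambda>x. \<integral>\<^sup>+i. F i x \<partial>count_space I)
      \<le> seq_norm r q (\<lambda>k. \<integral>\<^sup>+i. cube_norm p (F i) k * ennreal (\<omega> k) \<partial>count_space I)"
    unfolding amalgam_seq_norm using assms
    by (intro seq_norm_mono) (auto simp: nn_integral_multc intro!: mult_right_mono cube_norm_Minkowski)
  also have "\<dots> \<le> (\<integral>\<^sup>+i. amalgam r p q \<omega> (F i) \<partial>count_space I)"
    unfolding amalgam_seq_norm using assms by (intro seq_norm_Minkowski)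
  finally show ?thesis .
qed

lemma amalgam_suminf:
  assumes [measurable]: "\<And>i. F i \<in> borel_measurable borel"
    and "0 < r" "r \<le> 1" "1 \<le> p" "r \<le> q"
  shows "amalgam r p q \<omega> (\<lambda>x. \<Sum>i. F i x) \<le> (\<Sum>i. amalgam r p q \<omega> (F i))"
  using amalgam_Minkowski[of "UNIV :: nat set" F r p q \<omega>] assms
  by (simp add: nn_integral_count_space_nat)

lemma amalgam_add:
  assumes [measurable]: "F \<in> borel_measurable borel" "G \<in> borel_measurable borel"
    and "0 < r" "r \<le> 1" "1 \<le> p" "r \<le> q"
  shows "amalgam r p q \<omega> (\<lambda>x. F x + G x) \<le> amalgam r p q \<omega> F + amalgam r p q \<omega> G"
  using amalgam_Minkowski[of "UNIV :: bool set" "\<lambda>b. if b then F else G" r p q \<omega>] assms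
  by (simp add: nn_integral_count_space_finite UNIV_bool add.commute)

lemma amalgam_cmult:
  assumes "0 < r" "1 \<le> p" "r \<le> q" "F \<in> borel_measurable borel"
  shows "amalgam r p q \<omega> (\<lambda>x. c * F x) = ennreal_powr c r * amalgam r p q \<omega> F"
  unfolding amalgam_seq_norm using assms by (simp add: cube_norm_cmult mult.assoc seq_norm_cmult)

lemma cube_norm_less_top:
  assumes "amalgam r p q \<omega> F < top" "0 < \<omega> k" "k \<in> lattice" "0 < r" "r \<le> q"
  shows "cube_norm p F k < top"
proof -
  have "(\<integral>\<^sup>+k. ennreal_powr (cube_norm p F k * ennreal (\<omega> k)) q \<partial>count_space lattice) < \<infinity>"
    using assms(1) unfolding amalgam_def by (subst (asm) infinity_ennreal_def[symmetric], subst (asm) ennreal_powr_less_top_iff)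
  then have "ennreal_powr (cube_norm p F k * ennreal (\<omega> k)) q < \<infinity>"
    using nn_integral_ge_point[OF assms(3), of "\<lambda>k. ennreal_powr (cube_norm p F k * ennreal (\<omega> k)) q"]
    by (rule order.strict_trans1[rotated])
  then have "cube_norm p F k * ennreal (\<omega> k) < \<infinity>"
    by (simp only: ennreal_powr_less_top_iff)
  then show ?thesis using assms(2)
    by (cases "cube_norm p F k") (auto simp: ennreal_top_mult)
qed

lemma AE_unit_cubes:
  assumes "\<And>k. k \<in> lattice \<Longrightarrow> AE x in M. x \<in> unit_cube k \<longrightarrow> P x"
  shows "AE x in M. P (x :: 'a::euclidean_space)"
proof -
  have "AE x in M. \<forall>k\<in>lattice. x \<in> unit_cube k \<longrightarrow> P x"
    using assms countable_lattice by (intro AE_ball_countable') auto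
  then show ?thesis
  proof eventually_elim
    case (elim x)
    then show ?case using ex_unit_cube[of x] by blast
  qed
qed

lemma AE_less_top_of_amalgam:
  assumes "amalgam r p q \<omega> F < top" "\<And>k. 0 < \<omega> k" "0 < r" "1 \<le> p" "r \<le> q"
    and [measurable]: "F \<in> borel_measurable borel"
  shows "AE x in lborel. F x < top"
proof (rule AE_unit_cubes)
  fix k :: 'a assume k: "k \<in> lattice"
  have "cube_norm p F k < \<infinity>" using cube_norm_less_top[OF assms(1,2) k] assms by simp
  then have "(\<integral>\<^sup>+x. ennreal_powr (F x * indicator (unit_cube k) x) p \<partial>lborel) < \<infinity>"
    by (simp only: cube_norm_def ennreal_powr_less_top_iff)
  then have "AE x in lborel. ennreal_powr (F x * indicator (unit_cube k) x) p \<noteq> \<infinity>"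
    by (intro nn_integral_noteq_infinite) auto
  then show "AE x in lborel. x \<in> unit_cube k \<longrightarrow> F x < top"
    by eventually_elim (auto simp: less_top[symmetric])
qed

lemma AE_eq_0_of_amalgam:
  assumes "amalgam r p q \<omega> F = 0" "\<And>k. 0 < \<omega> k" "0 < r" "1 \<le> p" "r \<le> q"
    and [measurable]: "F \<in> borel_measurable borel"
  shows "AE x in lborel. F x = 0"
proof (rule AE_unit_cubes)
  fix k :: 'a assume k: "k \<in> lattice"
  have "ennreal_powr (cube_norm p F k * ennreal (\<omega> k)) q \<le> 0"
    using nn_integral_ge_point[OF k, of "\<lambda>k. ennreal_powr (cube_norm p F k * ennreal (\<omega> k)) q"] assms(1)
    by (simp add: amalgam_def ennreal_powr_eq_0_iff)
  then have "cube_norm p F k = 0"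
    using assms(2)[of k] by (simp add: ennreal_powr_eq_0_iff)
  then have "AE x in lborel. ennreal_powr (F x * indicator (unit_cube k) x) p = 0"
    by (simp add: cube_norm_def ennreal_powr_eq_0_iff nn_integral_0_iff_AE)
  then show "AE x in lborel. x \<in> unit_cube k \<longrightarrow> F x = 0"
    by eventually_elim (auto simp: ennreal_powr_eq_0_iff)
qed

text \<open>Moderateness distributes \<omega> k over the cubes at j and k - j + l, which leaves a
  discrete convolution of \<open>c\<close> with \<gamma>. Countable subadditivity and shift
  invariance of \<open>seq_norm\<close> give the discrete l^r, l^q bound, and the sum of the c j ^ r
  is a constant times the r-th power of the quasi-norm of \<open>a\<close>.\<close>

lemma amalgam_conv_le:
  fixes a H :: "'a::euclidean_space \<Rightarrow> ennreal"
  assumes [measurable]: "a \<in> borel_measurable borel" "H \<in> borel_measurable borel"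
    and par: "0 < r" "r \<le> 1" "1 \<le> p" "r \<le> q"
    and pos: "\<And>k. 0 < \<omega> k" "\<And>k. 0 < v k" and "0 \<le> E"
    and E: "\<And>k j l. l \<in> offsets \<Longrightarrow> \<omega> k \<le> E * \<omega> (k - j + l) * v j"
    and fin: "amalgam r 1 r v a < top"
  shows "amalgam r p q \<omega> (nn_conv a H) \<le>
    ennreal (E powr r * real (card (offsets :: 'a set))) * amalgam r 1 r v a * amalgam r p q \<omega> H"
proof -
  define \<gamma> where "\<gamma> k = cube_norm p H k * ennreal (\<omega> k)" for k
  define c where "c j = ennreal E * (cube_norm 1 a j * ennreal (v j))" for j
  have a_fin: "cube_norm 1 a j < top" if "j \<in> lattice" for j
    using cube_norm_less_top[OF fin pos(2) that] par by simp
  have "cube_norm p (nn_conv a H) k * ennreal (\<omega> k)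
      \<le> (\<integral>\<^sup>+j. (\<Sum>l\<in>offsets. c j * \<gamma> (k - j + l)) \<partial>count_space lattice)" if k: "k \<in> lattice" for k
  proof -
    have "cube_norm p (nn_conv a H) k * ennreal (\<omega> k)
        \<le> (\<integral>\<^sup>+j. cube_norm 1 a j * (\<Sum>l\<in>offsets. cube_norm p H (k - j + l)) \<partial>count_space lattice) * ennreal (\<omega> k)"
      using par k a_fin by (intro mult_right_mono cube_norm_conv_le) auto
    also have "\<dots> = (\<integral>\<^sup>+j. (\<Sum>l\<in>offsets. cube_norm 1 a j * (cube_norm p H (k - j + l) * ennreal (\<omega> k))) \<partial>count_space lattice)"
      by (subst nn_integral_multc[symmetric]) (auto simp: sum_distrib_left sum_distrib_right mult.assoc)
    also have "\<dots> \<le> (\<integral>\<^sup>+j. (\<Sum>l\<in>offsets. c j * \<gamma> (k - j + l)) \<partial>count_space lattice)"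
    proof (intro nn_integral_mono sum_mono)
      fix j l :: 'a assume l: "l \<in> offsets"
      have "ennreal (\<omega> k) \<le> ennreal E * ennreal (\<omega> (k - j + l)) * ennreal (v j)"
        using E[OF l, of k j] pos[THEN less_imp_le] \<open>0 \<le> E\<close>
        by (simp add: ennreal_leI flip: ennreal_mult)
      then have "cube_norm 1 a j * (cube_norm p H (k - j + l) * ennreal (\<omega> k))
          \<le> cube_norm 1 a j * (cube_norm p H (k - j + l) * (ennreal E * ennreal (\<omega> (k - j + l)) * ennreal (v j)))"
        by (intro mult_left_mono) auto
      then show "cube_norm 1 a j * (cube_norm p H (k - j + l) * ennreal (\<omega> k)) \<le> c j * \<gamma> (k - j + l)"
        by (simp add: c_def \<gamma>_def mult_ac)
    qed
    finally show ?thesis .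
  qed
  then have "amalgam r p q \<omega> (nn_conv a H)
      \<le> seq_norm r q (\<lambda>k. \<integral>\<^sup>+j. (\<Sum>l\<in>offsets. c j * \<gamma> (k - j + l)) \<partial>count_space lattice)"
    unfolding amalgam_seq_norm using par by (intro seq_norm_mono) auto
  also have "\<dots> \<le> (\<integral>\<^sup>+j. seq_norm r q (\<lambda>k. \<Sum>l\<in>offsets. c j * \<gamma> (k - j + l)) \<partial>count_space lattice)"
    using par by (intro seq_norm_Minkowski countable_lattice)
  also have "\<dots> \<le> (\<integral>\<^sup>+j. of_nat (card (offsets :: 'a set)) * (ennreal_powr (c j) r * seq_norm r q \<gamma>) \<partial>count_space lattice)"
    using par by (intro nn_integral_mono seq_norm_shifts_le) auto
  also have "\<dots> = of_nat (card (offsets :: 'a set)) * ((\<integral>\<^sup>+j. ennreal_powr (c j) r \<partial>count_space lattice) * seq_norm r q \<gamma>)"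
    by (simp add: nn_integral_cmult nn_integral_multc)
  also have "(\<integral>\<^sup>+j. ennreal_powr (c j) r \<partial>count_space lattice) = ennreal (E powr r) * amalgam r 1 r v a"
    using par \<open>0 \<le> E\<close>
    by (simp add: c_def ennreal_powr_mult[of r "ennreal E"] nn_integral_cmult amalgam_def ennreal_powr_ennreal)
  also have "seq_norm r q \<gamma> = amalgam r p q \<omega> H"
    by (simp add: amalgam_seq_norm \<gamma>_def[abs_def])
  finally show ?thesis
    by (simp add: ennreal_mult ennreal_of_nat_eq_real_of_nat mult_ac)
qed

subsection \<open>Approximate identities\<close>

lemma tendsto_ennreal_powr_0:
  assumes "(f \<longlongrightarrow> 0) F" "0 < s"
  shows "((\<lambda>x. ennreal_powr (f x) s) \<longlongrightarrow> 0) F"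
proof (rule order_tendstoI)
  fix a :: ennreal assume "0 < a"
  then have "0 < ennreal_powr a (1 / s)"
    using ennreal_powr_eq_0_iff[of a "1 / s"] by (simp add: zero_less_iff_neq_zero)
  from order_tendstoD(2)[OF assms(1) this]
  show "\<forall>\<^sub>F x in F. ennreal_powr (f x) s < a"
  proof eventually_elim
    case (elim x)
    show ?case
    proof (rule ccontr)
      assume "\<not> ennreal_powr (f x) s < a"
      then have "ennreal_powr a (1 / s) \<le> ennreal_powr (ennreal_powr (f x) s) (1 / s)"
        using assms by (intro ennreal_powr_mono) auto
      then show False using elim assms by (simp add: ennreal_powr_powr)
    qed
  qed
qed simp

section \<open>Dominated convergence and approximation on cubes\<close>

lemma cube_norm_add:
  assumes [measurable]: "F \<in> borel_measurable borel" "G \<in> borel_measurable borel" and "1 \<le> p"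
  shows "cube_norm p (\<lambda>x. F x + G x) k \<le> cube_norm p F k + cube_norm p G k"
  using cube_norm_Minkowski[of "UNIV :: bool set" "\<lambda>b. if b then F else G" p k] assms
  by (simp add: nn_integral_count_space_finite UNIV_bool add.commute)

lemma emeasure_unit_cube: "emeasure lborel (unit_cube (k :: 'a::euclidean_space)) = 1"
  by (subst emeasure_lborel_cbox) (auto simp: inner_add_left)

lemma cube_norm_le_const:
  assumes "\<And>x. x \<in> unit_cube k \<Longrightarrow> F x \<le> c" "1 \<le> p"
  shows "cube_norm p F k \<le> c"
proof -
  have "(\<integral>\<^sup>+x. ennreal_powr (F x * indicator (unit_cube k) x) p \<partial>lborel)
      \<le> (\<integral>\<^sup>+x. ennreal_powr c p * indicator (unit_cube k) x \<partial>lborel)"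
    using assms by (intro nn_integral_mono) (auto simp: indicator_def intro!: ennreal_powr_mono)
  also have "\<dots> = ennreal_powr c p"
    by (simp add: nn_integral_cmult_indicator emeasure_unit_cube)
  finally have "cube_norm p F k \<le> ennreal_powr (ennreal_powr c p) (1 / p)"
    unfolding cube_norm_def using assms by (intro ennreal_powr_mono) auto
  then show ?thesis using assms by (simp add: ennreal_powr_powr)
qed

lemma cube_norm_tendsto_0:
  fixes F :: "nat \<Rightarrow> 'a::euclidean_space \<Rightarrow> ennreal"
  assumes [measurable]: "\<And>n. F n \<in> borel_measurable borel" "G \<in> borel_measurable borel" and p: "1 \<le> p"
    and lim: "AE x in lborel. (\<lambda>n. F n x) \<longlonglongrightarrow> 0"
    and dom: "\<And>n x. x \<in> unit_cube k \<Longrightarrow> F n x \<le> G x" and fin: "cube_norm p G k < top"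
  shows "(\<lambda>n. cube_norm p (F n) k) \<longlonglongrightarrow> 0"
  unfolding cube_norm_def
proof (rule tendsto_ennreal_powr_0)
  have "(\<lambda>n. \<integral>\<^sup>+x. ennreal_powr (F n x * indicator (unit_cube k) x) p \<partial>lborel)
      \<longlonglongrightarrow> (\<integral>\<^sup>+(x::'a). 0 \<partial>lborel)"
  proof (rule nn_integral_dominated_convergence[where u' = "\<lambda>x. 0" and u = "\<lambda>n x. ennreal_powr (F n x * indicator (unit_cube k) x) p" and w = "\<lambda>x. ennreal_powr (G x * indicator (unit_cube k) x) p"])
    show "(\<integral>\<^sup>+x. ennreal_powr (G x * indicator (unit_cube k) x) p \<partial>lborel) < \<infinity>"
      using fin unfolding cube_norm_def infinity_ennreal_def[symmetric] by (simp only: ennreal_powr_less_top_iff)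
    show "AE x in lborel. (\<lambda>n. ennreal_powr (F n x * indicator (unit_cube k) x) p) \<longlonglongrightarrow> 0"
      using lim
    proof eventually_elim
      case (elim x)
      then have "(\<lambda>n. F n x * indicator (unit_cube k) x) \<longlonglongrightarrow> 0" by (simp add: indicator_def)
      then show ?case using p by (intro tendsto_ennreal_powr_0) auto
    qed
    show "AE x in lborel. ennreal_powr (F j x * indicator (unit_cube k) x) p
      \<le> ennreal_powr (G x * indicator (unit_cube k) x) p" for j
      using p dom by (auto simp: indicator_def intro!: ennreal_powr_mono)
  qed (use p in auto)
  then show "(\<lambda>n. \<integral>\<^sup>+x. ennreal_powr (F n x * indicator (unit_cube k) x) p \<partial>lborel) \<longlonglongrightarrow> 0"
    by simp
qed (use p in auto)

text \<open>For M > 0, the projection of the plane onto the disc of radius M. It is continuous and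
  bounded and fixes the disc, so it turns continuous approximants into bounded continuous
  ones.\<close>

definition radial_truncation :: "real \<Rightarrow> complex \<Rightarrow> complex" where
  "radial_truncation M z = (M / max M (norm z)) *\<^sub>R z"

lemma continuous_on_radial_truncation: "0 < M \<Longrightarrow> continuous_on A (radial_truncation M)"
  unfolding radial_truncation_def[abs_def] by (intro continuous_intros) (auto simp: max_def)

lemma measurable_radial_truncation [measurable]: "0 < M \<Longrightarrow> radial_truncation M \<in> borel_measurable borel"
  by (intro borel_measurable_continuous_onI continuous_on_radial_truncation)

lemma radial_truncation_eq: "norm z \<le> M \<Longrightarrow> 0 < M \<Longrightarrow> radial_truncation M z = z"
  by (simp add: radial_truncation_def max_def)

lemma norm_radial_truncation_le: "0 < M \<Longrightarrow> norm (radial_truncation M z) \<le> M"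
  by (auto simp: radial_truncation_def max_def)

lemma norm_diff_radial_truncation_le:
  assumes "0 < M"
  shows "norm (z - radial_truncation M z) \<le> norm z"
proof -
  have "z - radial_truncation M z = (1 - M / max M (norm z)) *\<^sub>R z"
    by (simp add: radial_truncation_def scaleR_diff_left)
  moreover have "\<bar>1 - M / max M (norm z)\<bar> \<le> 1"
  proof -
    have "0 \<le> M / max M (norm z)" "M / max M (norm z) \<le> 1"
      using assms by (auto simp: divide_le_eq_1)
    then show ?thesis by simp
  qed
  ultimately show ?thesis by (simp add: mult_left_le_one_le)
qed

text \<open>Measurability supplies continuous functions that converge to h almost everywhere but
  without a majorant. Truncating h costs little, with the modulus of h as majorant; after truncation
  the constant \<open>2 * real (Suc n)\<close> is a majorant, since cubes have finite
  measure.\<close>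

lemma continuous_approx:
  fixes h :: "'a::euclidean_space \<Rightarrow> complex"
  assumes [measurable]: "h \<in> borel_measurable borel" and p: "1 \<le> p" and I: "finite I"
    and fin: "\<And>k. k \<in> I \<Longrightarrow> cube_norm p (\<lambda>x. ennreal (norm (h x))) k < top" and \<epsilon>: "0 < \<epsilon>"
  shows "\<exists>g. continuous_on UNIV g \<and> (\<Sum>k\<in>I. cube_norm p (\<lambda>x. ennreal (norm (h x - g x))) k) \<le> ennreal \<epsilon>"
proof -
  have h: "h measurable_on UNIV"
    by (intro lebesgue_measurable_imp_measurable_on measurable_completion) auto
  then obtain N g where N: "negligible N" and g: "\<And>n. continuous_on UNIV (g n)"
      "\<And>x. x \<notin> N \<Longrightarrow> (\<lambda>n. g n x) \<longlonglongrightarrow> h x"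
    unfolding measurable_on_def by auto
  have [measurable]: "g n \<in> borel_measurable borel" for n
    using g by (intro borel_measurable_continuous_onI)
  have N': "AE x in lborel. x \<notin> N"
  proof -
    have "AE x in lebesgue. x \<notin> N"
      using N by (simp add: negligible_iff_null_sets AE_not_in)
    then show ?thesis by (simp add: AE_completion_iff)
  qed
  define T where "T n = radial_truncation (real (Suc n))" for n
  have [measurable]: "T n \<in> borel_measurable borel" for n unfolding T_def by measurable
  have "(\<lambda>n. \<Sum>k\<in>I. cube_norm p (\<lambda>x. ennreal (norm (h x - T n (h x)))) k) \<longlonglongrightarrow> (\<Sum>k\<in>I. 0)"
  proof (intro tendsto_sum cube_norm_tendsto_0[where G = "\<lambda>x. ennreal (norm (h x))"] AE_I2 p fin)
    fix x
    have "\<forall>\<^sub>F n in sequentially. norm (h x) \<le> real (Suc n)"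
      using eventually_ge_at_top[of "nat \<lceil>norm (h x)\<rceil>"] by eventually_elim linarith
    then have "\<forall>\<^sub>F n in sequentially. ennreal (norm (h x - T n (h x))) = 0"
      by eventually_elim (simp add: T_def radial_truncation_eq)
    then show "(\<lambda>n. ennreal (norm (h x - T n (h x)))) \<longlonglongrightarrow> 0"
      by (rule tendsto_eventually)
  qed (auto simp: T_def intro!: ennreal_leI norm_diff_radial_truncation_le)
  then have "\<forall>\<^sub>F n in sequentially. (\<Sum>k\<in>I. cube_norm p (\<lambda>x. ennreal (norm (h x - T n (h x)))) k) < ennreal (\<epsilon> / 2)"
    using \<epsilon> by (intro order_tendstoD(2)) auto
  then obtain n where n: "(\<Sum>k\<in>I. cube_norm p (\<lambda>x. ennreal (norm (h x - T n (h x)))) k) < ennreal (\<epsilon> / 2)"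
    by (auto simp: eventually_sequentially)
  have Tc: "continuous_on UNIV (T n)" unfolding T_def by (intro continuous_on_radial_truncation) simp
  have Tg: "continuous_on UNIV (\<lambda>x. T n (g m x))" for m
    by (rule continuous_on_compose2[OF Tc g(1)]) auto
  have "(\<lambda>m. \<Sum>k\<in>I. cube_norm p (\<lambda>x. ennreal (norm (T n (h x) - T n (g m x)))) k) \<longlonglongrightarrow> (\<Sum>k\<in>I. 0)"
  proof (intro tendsto_sum cube_norm_tendsto_0[where G = "\<lambda>x. ennreal (2 * real (Suc n))"] p)
    show "AE x in lborel. (\<lambda>m. ennreal (norm (T n (h x) - T n (g m x)))) \<longlonglongrightarrow> 0"
      using N'
    proof eventually_elim
      case (elim x)
      have "(\<lambda>m. T n (g m x)) \<longlonglongrightarrow> T n (h x)"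
        using continuous_on_tendsto_compose[OF Tc g(2)[OF elim]] by simp
      then have "(\<lambda>m. ennreal (norm (T n (h x) - T n (g m x)))) \<longlonglongrightarrow> ennreal (norm (T n (h x) - T n (h x)))"
        by (intro tendsto_intros)
      then show ?case by simp
    qed
    show "ennreal (norm (T n (h x) - T n (g m x))) \<le> ennreal (2 * real (Suc n))" for m x
      using norm_triangle_ineq4[of "T n (h x)" "T n (g m x)"]
        norm_radial_truncation_le[of "real (Suc n)"]
      unfolding T_def by (intro ennreal_leI) (smt (verit) of_nat_0_less_iff zero_less_Suc)
    show "cube_norm p (\<lambda>x. ennreal (2 * real (Suc n))) k < top" for k :: 'a
      using cube_norm_le_const[of k "\<lambda>x. ennreal (2 * real (Suc n))" _ p] p
      by (meson ennreal_less_top order.refl order.strict_trans1)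
  qed auto
  then have "\<forall>\<^sub>F m in sequentially. (\<Sum>k\<in>I. cube_norm p (\<lambda>x. ennreal (norm (T n (h x) - T n (g m x)))) k) < ennreal (\<epsilon> / 2)"
    using \<epsilon> by (intro order_tendstoD(2)) auto
  then obtain m where m: "(\<Sum>k\<in>I. cube_norm p (\<lambda>x. ennreal (norm (T n (h x) - T n (g m x)))) k) < ennreal (\<epsilon> / 2)"
    by (auto simp: eventually_sequentially)
  have "(\<Sum>k\<in>I. cube_norm p (\<lambda>x. ennreal (norm (h x - T n (g m x)))) k)
      \<le> (\<Sum>k\<in>I. cube_norm p (\<lambda>x. ennreal (norm (h x - T n (h x))) + ennreal (norm (T n (h x) - T n (g m x)))) k)"
  proof (intro sum_mono cube_norm_mono_AE AE_I2 p)
    fix x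
    show "ennreal (norm (h x - T n (g m x))) \<le> ennreal (norm (h x - T n (h x))) + ennreal (norm (T n (h x) - T n (g m x)))"
      using norm_triangle_ineq[of "h x - T n (h x)" "T n (h x) - T n (g m x)"]
      by (simp add: ennreal_leI flip: ennreal_plus)
  qed
  also have "\<dots> \<le> (\<Sum>k\<in>I. cube_norm p (\<lambda>x. ennreal (norm (h x - T n (h x)))) k
      + cube_norm p (\<lambda>x. ennreal (norm (T n (h x) - T n (g m x)))) k)"
    by (intro sum_mono cube_norm_add p) auto
  also have "\<dots> \<le> ennreal (\<epsilon> / 2) + ennreal (\<epsilon> / 2)"
    unfolding sum.distrib using n m by (intro add_mono) auto
  also have "\<dots> = ennreal \<epsilon>" using \<epsilon> by (simp flip: ennreal_plus)
  finally show ?thesis using Tg by blast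
qed

section \<open>Continuity of modulated translations\<close>

lemma zero_in_offsets: "0 \<in> offsets"
  by (simp add: offsets_def zero_in_lattice)

text \<open>A bound uniform in y, which later provides the majorant for dominated convergence over
  the lattice.\<close>

lemma modulated_shift_le:
  fixes h :: "'a::euclidean_space \<Rightarrow> complex"
  assumes [measurable]: "h \<in> borel_measurable borel" "(\<lambda>x. \<phi> x y) \<in> borel_measurable borel"
    and p: "1 \<le> p" and \<phi>: "\<And>x y. norm (\<phi> x y) = 1" and y: "y \<in> unit_cube 0" and k: "k \<in> lattice"
  shows "cube_norm p (\<lambda>x. ennreal (norm (h (x - y) * \<phi> x y - h x))) k
    \<le> 2 * (\<Sum>l\<in>offsets. cube_norm p (\<lambda>x. ennreal (norm (h x))) (k + l))"
proof -
  let ?N = "\<lambda>x. ennreal (norm (h x))"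
  have "cube_norm p (\<lambda>x. ennreal (norm (h (x - y) * \<phi> x y - h x))) k
      \<le> cube_norm p (\<lambda>x. ?N (x - y) + ?N x) k"
  proof (intro cube_norm_mono_AE AE_I2 p)
    show "ennreal (norm (h (x - y) * \<phi> x y - h x)) \<le> ?N (x - y) + ?N x" for x
      using norm_triangle_ineq4[of "h (x - y) * \<phi> x y" "h x"]
      by (simp add: norm_mult \<phi> ennreal_leI flip: ennreal_plus)
  qed
  also have "\<dots> \<le> cube_norm p (\<lambda>x. ?N (x - y)) k + cube_norm p ?N k"
    by (intro cube_norm_add p) auto
  also have "cube_norm p (\<lambda>x. ?N (x - y)) k \<le> (\<Sum>l\<in>offsets. cube_norm p ?N (k - 0 + l))"
    using y k p by (intro cube_norm_shift_le zero_in_lattice) auto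
  also have "cube_norm p ?N k \<le> (\<Sum>l\<in>offsets. cube_norm p ?N (k + l))"
    using sum_mono2[OF finite_offsets, of "{0}" "\<lambda>l. cube_norm p ?N (k + l)"] zero_in_offsets by simp
  finally show ?thesis by (simp add: mult_2 add_mono)
qed

text \<open>Continuity of translation in L^p, with a phase. For continuous g the modulated shift is
  uniformly continuous on the compact product of two cubes. Replacing h by g costs two errors, a
  shifted and an unshifted one; since a shift brings in values from neighbouring cubes, g has to
  approximate h on all cubes k + l with l in \<open>offsets\<close>.\<close>

lemma modulated_shift_continuous:
  fixes h :: "'a::euclidean_space \<Rightarrow> complex"
  assumes [measurable]: "h \<in> borel_measurable borel" and p: "1 \<le> p"
    and fin: "\<And>k. k \<in> lattice \<Longrightarrow> cube_norm p (\<lambda>x. ennreal (norm (h x))) k < top"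
    and \<phi>: "continuous_on UNIV (\<lambda>z. \<phi> (fst z) (snd z))" "\<And>x y. norm (\<phi> x y) = 1" "\<And>x. \<phi> x 0 = 1"
    and k: "k \<in> lattice" and \<epsilon>: "0 < \<epsilon>"
  shows "\<exists>\<delta>>0. \<forall>y\<in>unit_cube 0. norm y < \<delta> \<longrightarrow>
    cube_norm p (\<lambda>x. ennreal (norm (h (x - y) * \<phi> x y - h x))) k \<le> ennreal \<epsilon>"
proof -
  have "finite ((+) k ` offsets)" by (simp add: finite_offsets)
  moreover have "cube_norm p (\<lambda>x. ennreal (norm (h x))) m < top" if "m \<in> (+) k ` offsets" for m
    using that k by (intro fin) (auto simp: lattice_add offsets_lattice)
  ultimately obtain g where g: "continuous_on UNIV g"
      "(\<Sum>m\<in>(+) k ` offsets. cube_norm p (\<lambda>x. ennreal (norm (h x - g x))) m) \<le> ennreal (\<epsilon> / 3)"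
    using continuous_approx[of h p "(+) k ` offsets" "\<epsilon> / 3"] p \<epsilon> by auto
  have [measurable]: "g \<in> borel_measurable borel" using g(1) by (rule borel_measurable_continuous_onI)
  have S: "(\<Sum>l\<in>offsets. cube_norm p (\<lambda>x. ennreal (norm (h x - g x))) (k + l)) \<le> ennreal (\<epsilon> / 3)"
    using g(2) by (subst (asm) sum.reindex) auto
  define u where "u z = g (fst z - snd z) * \<phi> (fst z) (snd z) - g (fst z)" for z
  have u: "continuous_on UNIV u"
    unfolding u_def by (intro continuous_intros \<phi>(1) continuous_on_compose2[OF g(1)]) auto
  have "uniformly_continuous_on (unit_cube k \<times> unit_cube 0) u"
    by (intro compact_uniformly_continuous compact_Times compact_cbox continuous_on_subset[OF u]) auto
  then obtain \<delta> where \<delta>: "0 < \<delta>"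
      "\<And>z w. z \<in> unit_cube k \<times> unit_cube 0 \<Longrightarrow> w \<in> unit_cube k \<times> unit_cube 0 \<Longrightarrow> dist w z < \<delta> \<Longrightarrow> dist (u w) (u z) < \<epsilon> / 3"
    using \<epsilon> unfolding uniformly_continuous_on_def by (metis divide_pos_pos zero_less_numeral)
  show ?thesis
  proof (intro exI[of _ \<delta>] conjI \<delta>(1) ballI impI)
    fix y :: 'a assume y: "y \<in> unit_cube 0" "norm y < \<delta>"
    have \<phi>y: "continuous_on UNIV (\<lambda>x. \<phi> x y)"
      using continuous_on_compose2[OF \<phi>(1), of UNIV "\<lambda>x. (x, y)"]
      by (simp add: continuous_on_Pair)
    have [measurable]: "(\<lambda>x. \<phi> x y) \<in> borel_measurable borel"
      using \<phi>y by (rule borel_measurable_continuous_onI)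
    let ?d = "\<lambda>x. ennreal (norm (h x - g x))"
    have "0 \<in> unit_cube (0 :: 'a)" by (simp add: mem_box)
    then have u_small: "norm (g (x - y) * \<phi> x y - g x) \<le> \<epsilon> / 3" if "x \<in> unit_cube k" for x
      using \<delta>(2)[of "(x, 0)" "(x, y)"] that y by (simp add: u_def \<phi>(3) dist_norm norm_Pair)
    have "cube_norm p (\<lambda>x. ennreal (norm (h (x - y) * \<phi> x y - h x))) k
      \<le> cube_norm p (\<lambda>x. (?d (x - y) + ?d x) + ennreal (norm (g (x - y) * \<phi> x y - g x))) k"
    proof (intro cube_norm_mono_AE AE_I2 p)
      fix x
      have "h (x - y) * \<phi> x y - h x = ((h (x - y) - g (x - y)) * \<phi> x y - (h x - g x)) + (g (x - y) * \<phi> x y - g x)"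
        by (simp add: algebra_simps)
      then have "norm (h (x - y) * \<phi> x y - h x)
          \<le> norm ((h (x - y) - g (x - y)) * \<phi> x y - (h x - g x)) + norm (g (x - y) * \<phi> x y - g x)"
        using norm_triangle_ineq by metis
      also have "norm ((h (x - y) - g (x - y)) * \<phi> x y - (h x - g x)) \<le> norm (h (x - y) - g (x - y)) + norm (h x - g x)"
        using norm_triangle_ineq4[of "(h (x - y) - g (x - y)) * \<phi> x y" "h x - g x"] by (simp add: norm_mult \<phi>(2))
      finally show "ennreal (norm (h (x - y) * \<phi> x y - h x)) \<le> (?d (x - y) + ?d x) + ennreal (norm (g (x - y) * \<phi> x y - g x))"
        by (simp add: ennreal_leI flip: ennreal_plus)
    qed
    also have "\<dots> \<le> (cube_norm p (\<lambda>x. ?d (x - y)) k + cube_norm p ?d k)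
        + cube_norm p (\<lambda>x. ennreal (norm (g (x - y) * \<phi> x y - g x))) k"
      by (intro order_trans[OF cube_norm_add] add_mono order_refl cube_norm_add p) auto
    also have "\<dots> \<le> (ennreal (\<epsilon> / 3) + ennreal (\<epsilon> / 3)) + ennreal (\<epsilon> / 3)"
    proof (intro add_mono)
      have "cube_norm p (\<lambda>x. ?d (x - y)) k \<le> (\<Sum>l\<in>offsets. cube_norm p ?d (k - 0 + l))"
        using y(1) k p by (intro cube_norm_shift_le[of ?d] zero_in_lattice) auto
      then show "cube_norm p (\<lambda>x. ?d (x - y)) k \<le> ennreal (\<epsilon> / 3)" using S by simp
      have "cube_norm p ?d k \<le> (\<Sum>l\<in>offsets. cube_norm p ?d (k + l))"
        using sum_mono2[OF finite_offsets, of "{0}" "\<lambda>l. cube_norm p ?d (k + l)"] zero_in_offsets by simp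
      then show "cube_norm p ?d k \<le> ennreal (\<epsilon> / 3)" using S by simp
      show "cube_norm p (\<lambda>x. ennreal (norm (g (x - y) * \<phi> x y - g x))) k \<le> ennreal (\<epsilon> / 3)"
        using u_small p by (intro cube_norm_le_const) (auto intro: ennreal_leI)
    qed
    also have "\<dots> = ennreal \<epsilon>" using \<epsilon> by (simp flip: ennreal_plus)
    finally show "cube_norm p (\<lambda>x. ennreal (norm (h (x - y) * \<phi> x y - h x))) k \<le> ennreal \<epsilon>" .
  qed
qed

text \<open>The worst local deviation \<Theta> n k over the support of e n bounds the local norm of
  the average, because e n has mass 1. It tends to 0 for each k and has a majorant in l^q, so a
  second dominated convergence, now over the lattice and with q finite, finishes the
  argument.\<close>

lemma amalgam_approx_identity:
  fixes h :: "'a::euclidean_space \<Rightarrow> complex"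
  assumes [measurable]: "h \<in> borel_measurable borel" "\<And>n. e n \<in> borel_measurable borel"
    and par: "0 < r" "r \<le> 1" "1 \<le> p" "r \<le> q"
    and pos: "\<And>k. 0 < \<omega> k" and "0 \<le> E" and E: "\<And>k l. l \<in> offsets \<Longrightarrow> \<omega> k \<le> E * \<omega> (k + l)"
    and fin: "amalgam r p q \<omega> (\<lambda>x. ennreal (norm (h x))) < top"
    and \<phi>: "continuous_on UNIV (\<lambda>z. \<phi> (fst z) (snd z))" "\<And>x y. norm (\<phi> x y) = 1" "\<And>x. \<phi> x 0 = 1"
    and e: "\<And>n y. e n y \<noteq> 0 \<Longrightarrow> y \<in> unit_cube 0 \<and> norm y \<le> \<delta> n" "\<And>n. (\<integral>\<^sup>+y. e n y \<partial>lborel) = 1"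
    and \<delta>: "\<delta> \<longlonglongrightarrow> 0"
  shows "(\<lambda>n. amalgam r p q \<omega> (\<lambda>x. \<integral>\<^sup>+y. e n y * ennreal (norm (h (x - y) * \<phi> x y - h x)) \<partial>lborel)) \<longlonglongrightarrow> 0"
proof -
  define \<beta> where "\<beta> = cube_norm p (\<lambda>x. ennreal (norm (h x)))"
  define D where "D x y = ennreal (norm (h (x - y) * \<phi> x y - h x))" for x y
  define \<Theta> where "\<Theta> n k = (SUP y\<in>{y\<in>unit_cube 0. norm y \<le> \<delta> n}. cube_norm p (\<lambda>x. D x y) k)" for n and k :: 'a
  have [measurable]: "(\<lambda>z. \<phi> (fst z) (snd z)) \<in> borel_measurable (borel \<Otimes>\<^sub>M borel)"
    unfolding borel_prod using \<phi>(1) by (rule borel_measurable_continuous_onI)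
  have D_meas: "case_prod D \<in> borel_measurable (borel \<Otimes>\<^sub>M borel)"
    unfolding D_def case_prod_beta by measurable
  have \<beta>_fin: "\<beta> k < top" if "k \<in> lattice" for k
    unfolding \<beta>_def using cube_norm_less_top[OF fin pos that] par by auto
  have \<phi>m: "(\<lambda>x. \<phi> x y) \<in> borel_measurable borel" for y
    using continuous_on_compose2[OF \<phi>(1), of UNIV "\<lambda>x. (x, y)"]
    by (intro borel_measurable_continuous_onI) (simp add: continuous_on_Pair)
  have \<Theta>_le: "\<Theta> n k \<le> 2 * (\<Sum>l\<in>offsets. \<beta> (k + l))" if "k \<in> lattice" for n k
    unfolding \<Theta>_def D_def \<beta>_def using that par \<phi> \<phi>m
    by (intro SUP_least modulated_shift_le) auto
  have \<Theta>_lim: "(\<lambda>n. \<Theta> n k) \<longlonglongrightarrow> 0" if k: "k \<in> lattice" for k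
  proof (rule order_tendstoI)
    fix a :: ennreal assume "0 < a"
    then obtain \<epsilon> where \<epsilon>: "0 < \<epsilon>" "ennreal \<epsilon> < a"
      by (metis dense ennreal_cases ennreal_less_zero_iff less_top order.strict_trans2 top_greatest less_imp_le)
    obtain d where d: "0 < d" "\<And>y. y \<in> unit_cube 0 \<Longrightarrow> norm y < d \<Longrightarrow> cube_norm p (\<lambda>x. D x y) k \<le> ennreal \<epsilon>"
      using modulated_shift_continuous[OF assms(1) par(3) \<beta>_fin[unfolded \<beta>_def] \<phi> k \<epsilon>(1)]
      unfolding D_def by blast
    have "\<forall>\<^sub>F n in sequentially. \<delta> n < d" using \<delta> d(1) by (rule order_tendstoD)
    then show "\<forall>\<^sub>F n in sequentially. \<Theta> n k < a"
    proof eventually_elim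
      case (elim n)
      have "\<Theta> n k \<le> ennreal \<epsilon>" unfolding \<Theta>_def using elim by (intro SUP_least d(2)) auto
      then show ?case using \<epsilon>(2) by (rule order.strict_trans1)
    qed
  qed simp
  \<comment> \<open>Written with k - 0 + l in order to match \<open>seq_norm_shifts_le\<close> at j
    = 0.\<close>
  define B where "B k = (\<Sum>l\<in>offsets. (2 * ennreal E) * (\<beta> (k - 0 + l) * ennreal (\<omega> (k - 0 + l))))" for k
  have B: "\<Theta> n k * ennreal (\<omega> k) \<le> B k" if "k \<in> lattice" for n k
  proof -
    have "\<Theta> n k * ennreal (\<omega> k) \<le> 2 * (\<Sum>l\<in>offsets. \<beta> (k + l)) * ennreal (\<omega> k)"
      using \<Theta>_le[OF that] by (intro mult_right_mono) auto
    also have "\<dots> = (\<Sum>l\<in>offsets. 2 * (\<beta> (k + l) * ennreal (\<omega> k)))"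
      by (simp add: sum_distrib_left sum_distrib_right mult.assoc)
    also have "\<dots> \<le> (\<Sum>l\<in>offsets. 2 * (\<beta> (k + l) * (ennreal E * ennreal (\<omega> (k + l)))))"
      using E pos[THEN less_imp_le] \<open>0 \<le> E\<close>
      by (intro sum_mono mult_left_mono) (auto simp: ennreal_leI simp flip: ennreal_mult)
    finally show ?thesis by (simp add: B_def mult_ac)
  qed
  have "seq_norm r q B \<le> of_nat (card (offsets :: 'a set)) * (ennreal_powr (2 * ennreal E) r *
      amalgam r p q \<omega> (\<lambda>x. ennreal (norm (h x))))"
    unfolding B_def[abs_def] amalgam_seq_norm \<beta>_def using par
    by (intro seq_norm_shifts_le[where \<gamma> = "\<lambda>k. cube_norm p (\<lambda>x. ennreal (norm (h x))) k * ennreal (\<omega> k)"] zero_in_lattice) auto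
  also have "\<dots> < top"
  proof -
    have "ennreal_powr (2 * ennreal E) r < \<infinity>"
      by (subst ennreal_powr_less_top_iff) (simp add: ennreal_mult_less_top)
    then show ?thesis using fin by (simp add: ennreal_mult_less_top of_nat_less_top)
  qed
  finally have "(\<integral>\<^sup>+k. ennreal_powr (B k) q \<partial>count_space lattice) < \<infinity>"
    unfolding seq_norm_def infinity_ennreal_def[symmetric] by (simp only: ennreal_powr_less_top_iff)
  then have "(\<lambda>n. \<integral>\<^sup>+k. ennreal_powr (\<Theta> n k * ennreal (\<omega> k)) q \<partial>count_space lattice)
      \<longlonglongrightarrow> (\<integral>\<^sup>+(k::'a). 0 \<partial>count_space lattice)"
  proof (rule nn_integral_dominated_convergence[where u' = "\<lambda>x. 0" and u = "\<lambda>n k. ennreal_powr (\<Theta> n k * ennreal (\<omega> k)) q" and w = "\<lambda>k. ennreal_powr (B k) q", rotated 4])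
    have "(\<lambda>n. ennreal_powr (\<Theta> n k * ennreal (\<omega> k)) q) \<longlonglongrightarrow> 0" if "k \<in> lattice" for k
      using par ennreal_tendsto_cmult[OF _ \<Theta>_lim[OF that], of "ennreal (\<omega> k)"]
      by (intro tendsto_ennreal_powr_0) (auto simp: mult.commute)
    then show "AE k in count_space lattice. (\<lambda>n. ennreal_powr (\<Theta> n k * ennreal (\<omega> k)) q) \<longlonglongrightarrow> 0"
      by (simp add: AE_count_space)
    show "AE k in count_space lattice. ennreal_powr (\<Theta> n k * ennreal (\<omega> k)) q \<le> ennreal_powr (B k) q" for n
      using B par by (auto simp: AE_count_space intro!: ennreal_powr_mono)
  qed auto
  then have lim: "(\<lambda>n. seq_norm r q (\<lambda>k. \<Theta> n k * ennreal (\<omega> k))) \<longlonglongrightarrow> 0"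
    unfolding seq_norm_def using par by (intro tendsto_ennreal_powr_0) auto
  have "amalgam r p q \<omega> (\<lambda>x. \<integral>\<^sup>+y. e n y * D x y \<partial>lborel) \<le> seq_norm r q (\<lambda>k. \<Theta> n k * ennreal (\<omega> k))" for n
    unfolding amalgam_seq_norm
  proof (intro seq_norm_mono mult_right_mono)
    fix k :: 'a
    have "cube_norm p (\<lambda>x. \<integral>\<^sup>+y. e n y * D x y \<partial>lborel) k \<le> (\<integral>\<^sup>+y. e n y \<partial>lborel) * \<Theta> n k"
    proof (rule cube_norm_integral_le)
      show "cube_norm p (\<lambda>x. D x y) k \<le> \<Theta> n k" if "e n y \<noteq> 0" for y
        unfolding \<Theta>_def using e(1)[OF that] by (intro SUP_upper) auto
    qed (use D_meas par e in auto)
    then show "cube_norm p (\<lambda>x. \<integral>\<^sup>+y. e n y * D x y \<partial>lborel) k \<le> \<Theta> n k" by (simp add: e)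
  qed (use par in auto)
  then have "(\<lambda>n. amalgam r p q \<omega> (\<lambda>x. \<integral>\<^sup>+y. e n y * D x y \<partial>lborel)) \<longlonglongrightarrow> 0"
    by (intro tendsto_sandwich[OF _ _ tendsto_const lim]) auto
  then show ?thesis by (simp add: D_def)
qed

subsection \<open>Twisted convolution\<close>

lemma lborel_distr_reflect:
  fixes c :: "'a::euclidean_space"
  shows "distr lborel borel (\<lambda>x. c - x) = lborel"
  using lborel_affine[of "-1" c] by (simp add: density_1)

lemma nn_integral_lborel_reflect:
  fixes c :: "'a::euclidean_space"
  assumes [measurable]: "f \<in> borel_measurable borel"
  shows "(\<integral>\<^sup>+x. f (c - x) \<partial>lborel) = (\<integral>\<^sup>+x. f x \<partial>lborel)"
  by (subst lborel_distr_reflect[of c, symmetric]) (simp add: nn_integral_distr)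

lemma integral_lborel_reflect:
  fixes c :: "'a::euclidean_space" and f :: "'a \<Rightarrow> 'b::{banach, second_countable_topology}"
  assumes [measurable]: "f \<in> borel_measurable borel"
  shows "(LINT x|lborel. f (c - x)) = (LINT x|lborel. f x)"
  by (subst (2) lborel_distr_reflect[of c, symmetric]) (simp add: integral_distr)

lemma integral_lborel_shift:
  fixes c :: "'a::euclidean_space" and f :: "'a \<Rightarrow> 'b::{banach, second_countable_topology}"
  assumes [measurable]: "f \<in> borel_measurable borel"
  shows "(LINT x|lborel. f (c + x)) = (LINT x|lborel. f x)"
  by (subst (2) lborel_distr_plus[of c, symmetric]) (simp add: integral_distr)

abbreviation (input) nn_norm :: "('a \<Rightarrow> complex) \<Rightarrow> 'a \<Rightarrow> ennreal" where
  "nn_norm f x \<equiv> ennreal (norm (f x))"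

definition kappa :: "'d::finite itself \<Rightarrow> real" where
  "kappa _ = (2 / pi) powr (real CARD('d) / 2)"

lemma kappa_pos: "0 < kappa d"
  by (simp add: kappa_def)

lemma sympl_simps:
  "sympl X (Y + Z) = sympl X Y + sympl X Z"
  "sympl X (Y - Z) = sympl X Y - sympl X Z"
  "sympl (Y + Z) X = sympl Y X + sympl Z X"
  "sympl (Y - Z) X = sympl Y X - sympl Z X"
  "sympl X X = 0"
  by (simp_all add: sympl_def inner_add_left inner_add_right inner_diff_left inner_diff_right
      inner_commute algebra_simps)

lemma sympl_commute: "sympl X Y = - sympl Y X"
  by (simp add: sympl_def inner_commute)

lemma continuous_on_sympl [continuous_intros]:
  assumes "continuous_on S f" "continuous_on S g"
  shows "continuous_on S (\<lambda>x. sympl (f x) (g x))"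
  unfolding sympl_def by (intro continuous_intros assms)

lemma measurable_sympl [measurable]:
  assumes [measurable]: "f \<in> borel_measurable M" "g \<in> borel_measurable M"
  shows "(\<lambda>x. sympl (f x) (g x)) \<in> borel_measurable M"
proof -
  have "(\<lambda>z. sympl (fst z) (snd z)) \<in> borel_measurable (borel :: ('d::finite phase \<times> 'd phase) measure)"
    by (intro borel_measurable_continuous_onI continuous_intros)
  then have [measurable]: "(\<lambda>z. sympl (fst z) (snd z)) \<in> borel_measurable (borel \<Otimes>\<^sub>M borel :: ('d::finite phase \<times> 'd phase) measure)"
    by (simp add: borel_prod)
  have "(\<lambda>x. sympl (fst (f x, g x)) (snd (f x, g x))) \<in> borel_measurable M" by measurable
  then show ?thesis by simp
qed

lemma measurable_twisted_integrand [measurable]: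
  assumes [measurable]: "a \<in> borel_measurable borel" "b \<in> borel_measurable borel"
    "f \<in> borel_measurable M" "g \<in> borel_measurable M"
  shows "(\<lambda>x. twisted_integrand a b (f x) (g x)) \<in> borel_measurable M"
  unfolding twisted_integrand_def by measurable

lemma norm_twisted_integrand: "norm (twisted_integrand a b X Y) = norm (a (X - Y)) * norm (b Y)"
  by (simp add: twisted_integrand_def norm_mult norm_exp_eq_Re)

lemma twisted_conv_lborel:
  fixes a b :: "'d::finite phase \<Rightarrow> complex"
  assumes [measurable]: "a \<in> borel_measurable borel" "b \<in> borel_measurable borel"
  shows "(a *\<^sub>\<sigma> b) X = of_real (kappa TYPE('d)) * (LINT Y|lborel. twisted_integrand a b X Y)"
  unfolding twisted_conv_def kappa_def by (subst integral_completion) auto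

lemma measurable_twisted_conv [measurable]:
  fixes a b :: "'d::finite phase \<Rightarrow> complex"
  assumes [measurable]: "a \<in> borel_measurable borel" "b \<in> borel_measurable borel"
  shows "a *\<^sub>\<sigma> b \<in> borel_measurable borel"
proof -
  have "(\<lambda>X. of_real (kappa TYPE('d)) * (LINT Y|lborel. twisted_integrand a b X Y)) \<in> borel_measurable borel"
    by measurable
  also have "(\<lambda>X. of_real (kappa TYPE('d)) * (LINT Y|lborel. twisted_integrand a b X Y)) = a *\<^sub>\<sigma> b"
    by (rule ext) (rule twisted_conv_lborel[OF assms, symmetric])
  finally show ?thesis .
qed

lemma nn_integral_twisted_integrand:
  fixes a b :: "'d::finite phase \<Rightarrow> complex"
  assumes [measurable]: "a \<in> borel_measurable borel" "b \<in> borel_measurable borel"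
  shows "(\<integral>\<^sup>+Y. norm (twisted_integrand a b X Y) \<partial>lborel) = nn_conv (nn_norm a) (nn_norm b) X"
proof -
  have "nn_conv (nn_norm a) (nn_norm b) X = (\<integral>\<^sup>+Y. nn_norm a (X - Y) * nn_norm b (X - (X - Y)) \<partial>lborel)"
    unfolding nn_conv_def by (subst nn_integral_lborel_reflect[of _ X, symmetric]) auto
  then show ?thesis by (simp add: norm_twisted_integrand ennreal_mult)
qed

lemma integrable_twisted_integrand_iff:
  fixes a b :: "'d::finite phase \<Rightarrow> complex"
  assumes [measurable]: "a \<in> borel_measurable borel" "b \<in> borel_measurable borel"
  shows "integrable lborel (twisted_integrand a b X) \<longleftrightarrow> nn_conv (nn_norm a) (nn_norm b) X < top"
  using nn_integral_twisted_integrand[OF assms, of X]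
  by (simp add: integrable_iff_bounded)

lemma norm_twisted_conv_le:
  fixes a b :: "'d::finite phase \<Rightarrow> complex"
  assumes [measurable]: "a \<in> borel_measurable borel" "b \<in> borel_measurable borel"
  shows "nn_norm (a *\<^sub>\<sigma> b) X \<le> ennreal (kappa TYPE('d)) * nn_conv (nn_norm a) (nn_norm b) X"
proof -
  have "ennreal (norm (LINT Y|lborel. twisted_integrand a b X Y)) \<le> nn_conv (nn_norm a) (nn_norm b) X"
  proof (cases "integrable lborel (twisted_integrand a b X)")
    case True
    then show ?thesis
      using integral_norm_bound_ennreal[OF True] nn_integral_twisted_integrand[OF assms] by simp
  qed (simp add: not_integrable_integral_eq)
  then show ?thesis
    using kappa_pos[of "TYPE('d)"]
    by (simp add: twisted_conv_lborel norm_mult ennreal_mult mult_left_mono)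
qed

lemma twisted_conv_add_left:
  assumes [measurable]: "a \<in> borel_measurable borel" "a' \<in> borel_measurable borel" "b \<in> borel_measurable borel"
    and "integrable lborel (twisted_integrand a b X)" "integrable lborel (twisted_integrand a' b X)"
  shows "((\<lambda>x. a x + a' x) *\<^sub>\<sigma> b) X = (a *\<^sub>\<sigma> b) X + (a' *\<^sub>\<sigma> b) X"
proof -
  have "twisted_integrand (\<lambda>x. a x + a' x) b X Y = twisted_integrand a b X Y + twisted_integrand a' b X Y" for Y
    by (simp add: twisted_integrand_def algebra_simps)
  then show ?thesis using assms by (simp add: twisted_conv_lborel algebra_simps)
qed

lemma twisted_conv_add_right:
  assumes [measurable]: "a \<in> borel_measurable borel" "b \<in> borel_measurable borel" "b' \<in> borel_measurable borel"
    and "integrable lborel (twisted_integrand a b X)" "integrable lborel (twisted_integrand a b' X)"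
  shows "(a *\<^sub>\<sigma> (\<lambda>x. b x + b' x)) X = (a *\<^sub>\<sigma> b) X + (a *\<^sub>\<sigma> b') X"
proof -
  have "twisted_integrand a (\<lambda>x. b x + b' x) X Y = twisted_integrand a b X Y + twisted_integrand a b' X Y" for Y
    by (simp add: twisted_integrand_def algebra_simps)
  then show ?thesis using assms by (simp add: twisted_conv_lborel algebra_simps)
qed

lemma twisted_conv_scale:
  assumes [measurable]: "a \<in> borel_measurable borel" "b \<in> borel_measurable borel"
  shows "((\<lambda>x. c * a x) *\<^sub>\<sigma> b) X = c * (a *\<^sub>\<sigma> b) X" "(a *\<^sub>\<sigma> (\<lambda>x. c * b x)) X = c * (a *\<^sub>\<sigma> b) X"
proof -
  have "twisted_integrand (\<lambda>x. c * a x) b X Y = c * twisted_integrand a b X Y"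
    "twisted_integrand a (\<lambda>x. c * b x) X Y = c * twisted_integrand a b X Y" for Y
    by (simp_all add: twisted_integrand_def)
  then show "((\<lambda>x. c * a x) *\<^sub>\<sigma> b) X = c * (a *\<^sub>\<sigma> b) X" "(a *\<^sub>\<sigma> (\<lambda>x. c * b x)) X = c * (a *\<^sub>\<sigma> b) X"
    by (simp_all add: twisted_conv_lborel)
qed

text \<open>For fixed X the integrands differ only on a null set of Y, so the convolutions agree at
  every X, not merely almost everywhere.\<close>

lemma twisted_conv_cong_AE:
  fixes a b a' b' :: "'d::finite phase \<Rightarrow> complex"
  assumes [measurable]: "a \<in> borel_measurable borel" "b \<in> borel_measurable borel"
      "a' \<in> borel_measurable borel" "b' \<in> borel_measurable borel"
    and a: "AE x in lborel. a x = a' x" and b: "AE x in lborel. b x = b' x"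
  shows "a *\<^sub>\<sigma> b = a' *\<^sub>\<sigma> b'"
proof
  fix X
  have "AE Y in distr lborel borel (\<lambda>Y. X - Y). a Y = a' Y"
    by (subst lborel_distr_reflect) (rule a)
  then have "AE Y in lborel. a (X - Y) = a' (X - Y)"
    by (subst (asm) AE_distr_iff) auto
  with b have "AE Y in lborel. twisted_integrand a b X Y = twisted_integrand a' b' X Y"
    by eventually_elim (simp add: twisted_integrand_def)
  then show "(a *\<^sub>\<sigma> b) X = (a' *\<^sub>\<sigma> b') X"
    unfolding twisted_conv_lborel[OF assms(1,2)] twisted_conv_lborel[OF assms(3,4)]
    by (intro arg_cong2[where f = "(*)"] refl integral_cong_AE) auto
qed

text \<open>The substitution of X - Y for Y inverts the phase, since
  \<open>sympl X X = 0\<close>.\<close>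

lemma twisted_conv_reflect:
  fixes a b :: "'d::finite phase \<Rightarrow> complex"
  assumes [measurable]: "a \<in> borel_measurable borel" "b \<in> borel_measurable borel"
  shows "(a *\<^sub>\<sigma> b) X = of_real (kappa TYPE('d)) *
    (LINT Y|lborel. a Y * (b (X - Y) * exp (- (2 * \<i> * of_real (sympl X Y)))))"
proof -
  have "(LINT Y|lborel. twisted_integrand a b X (X - Y)) = (LINT Y|lborel. twisted_integrand a b X Y)"
    by (intro integral_lborel_reflect) measurable
  then show ?thesis
    by (simp add: twisted_conv_lborel twisted_integrand_def sympl_simps mult.assoc)
qed

text \<open>Exchanging the factors inverts the phase, and conjugation inverts it back. This is how
  one-sided results are carried to the other side.\<close>

lemma twisted_conv_commute_cnj:
  fixes a b :: "'d::finite phase \<Rightarrow> complex"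
  assumes [measurable]: "a \<in> borel_measurable borel" "b \<in> borel_measurable borel"
  shows "(b *\<^sub>\<sigma> a) X = cnj (((\<lambda>x. cnj (a x)) *\<^sub>\<sigma> (\<lambda>x. cnj (b x))) X)"
proof -
  have [measurable]: "(\<lambda>x. cnj (a x)) \<in> borel_measurable borel" "(\<lambda>x. cnj (b x)) \<in> borel_measurable borel"
    by (auto intro: borel_measurable_continuous_on[OF continuous_on_cnj[OF continuous_on_id]] assms)
  have "cnj (LINT Y|lborel. twisted_integrand (\<lambda>x. cnj (a x)) (\<lambda>x. cnj (b x)) X Y)
      = (LINT Y|lborel. cnj (twisted_integrand (\<lambda>x. cnj (a x)) (\<lambda>x. cnj (b x)) X Y))"
    by simp
  also have "\<dots> = (LINT Y|lborel. b Y * (a (X - Y) * exp (- (2 * \<i> * of_real (sympl X Y)))))"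
    by (simp add: twisted_integrand_def exp_cnj mult_ac)
  finally show ?thesis
    by (subst twisted_conv_reflect) (auto simp: twisted_conv_lborel)
qed

text \<open>Finiteness of the triple convolution of moduli at X permits Fubini. After the shift Y =
  Z + W, the identity \<open>sympl X Y + sympl Y Z = sympl (X - Z) W + sympl X Z\<close> matches the
  two phases.\<close>

lemma twisted_conv_assoc:
  fixes a a' h :: "'d::finite phase \<Rightarrow> complex"
  assumes [measurable]: "a \<in> borel_measurable borel" "a' \<in> borel_measurable borel" "h \<in> borel_measurable borel"
    and fin: "nn_conv (nn_norm a) (nn_conv (nn_norm a') (nn_norm h)) X < top"
  shows "((a *\<^sub>\<sigma> a') *\<^sub>\<sigma> h) X = (a *\<^sub>\<sigma> (a' *\<^sub>\<sigma> h)) X"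
proof -
  let ?\<kappa> = "of_real (kappa TYPE('d)) :: complex"
  \<comment> \<open>Taking 1 as second function isolates a (X - Y) together with its phase.\<close>
  define \<Phi> where "\<Phi> Y Z = twisted_integrand a (\<lambda>_. 1) X Y * twisted_integrand a' h Y Z" for Y Z
  have [measurable]: "case_prod \<Phi> \<in> borel_measurable (borel \<Otimes>\<^sub>M borel)"
    unfolding \<Phi>_def case_prod_beta by measurable
  have "(\<integral>\<^sup>+Y. \<integral>\<^sup>+Z. norm (\<Phi> Y Z) \<partial>lborel \<partial>lborel)
      = (\<integral>\<^sup>+Y. nn_norm a (X - Y) * nn_conv (nn_norm a') (nn_norm h) Y \<partial>lborel)"
    by (intro nn_integral_cong)
      (simp add: \<Phi>_def norm_mult ennreal_mult nn_integral_cmult nn_integral_twisted_integrand[symmetric] norm_twisted_integrand)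
  also have "\<dots> = (\<integral>\<^sup>+Y. nn_norm a (X - (X - Y)) * nn_conv (nn_norm a') (nn_norm h) (X - Y) \<partial>lborel)"
    by (subst nn_integral_lborel_reflect[of _ X, symmetric]) auto
  also have "\<dots> < top" using fin by (simp add: nn_conv_def)
  finally have "integrable (lborel \<Otimes>\<^sub>M lborel) (case_prod \<Phi>)"
    by (intro integrableI_bounded) (auto simp: lborel.nn_integral_fst[symmetric])
  from lborel_pair.Fubini_integral[OF this]
  have Fub: "(LINT Z|lborel. LINT Y|lborel. \<Phi> Y Z) = (LINT Y|lborel. LINT Z|lborel. \<Phi> Y Z)" .
  have R: "(LINT Y|lborel. LINT Z|lborel. \<Phi> Y Z) = (LINT Y|lborel. twisted_integrand a (\<lambda>_. 1) X Y * (LINT Z|lborel. twisted_integrand a' h Y Z))"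
    by (simp add: \<Phi>_def)
  have "?\<kappa> * ?\<kappa> * (LINT Y|lborel. LINT Z|lborel. \<Phi> Y Z) = (a *\<^sub>\<sigma> (a' *\<^sub>\<sigma> h)) X"
  proof -
    have "(a *\<^sub>\<sigma> (a' *\<^sub>\<sigma> h)) X = ?\<kappa> * (LINT Y|lborel. ?\<kappa> * (twisted_integrand a (\<lambda>_. 1) X Y * (LINT Z|lborel. twisted_integrand a' h Y Z)))"
      by (simp add: twisted_conv_lborel[of a] twisted_integrand_def[of a] twisted_conv_lborel[of a' h] mult_ac del: integral_mult_right_zero)
    then show ?thesis unfolding R by (simp add: mult_ac)
  qed
  moreover have "?\<kappa> * ?\<kappa> * (LINT Z|lborel. LINT Y|lborel. \<Phi> Y Z) = ((a *\<^sub>\<sigma> a') *\<^sub>\<sigma> h) X"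
  proof -
    have "(LINT Y|lborel. \<Phi> Y Z) = (LINT W|lborel. twisted_integrand a a' (X - Z) W) * (h Z * exp (2 * \<i> * of_real (sympl X Z)))" for Z
    proof -
      have "(LINT Y|lborel. \<Phi> Y Z) = (LINT W|lborel. \<Phi> (Z + W) Z)"
        by (intro integral_lborel_shift[symmetric]) (simp add: \<Phi>_def)
      moreover have "\<Phi> (Z + W) Z = twisted_integrand a a' (X - Z) W * (h Z * exp (2 * \<i> * of_real (sympl X Z)))" for W
        using sympl_commute[of W Z]
        by (simp add: \<Phi>_def twisted_integrand_def sympl_simps diff_diff_eq algebra_simps exp_add exp_diff exp_minus divide_inverse)
      ultimately show ?thesis by simp
    qed
    then have "?\<kappa> * ?\<kappa> * (LINT Z|lborel. LINT Y|lborel. \<Phi> Y Z) =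
        ?\<kappa> * (LINT Z|lborel. ?\<kappa> * ((LINT W|lborel. twisted_integrand a a' (X - Z) W) * (h Z * exp (2 * \<i> * of_real (sympl X Z)))))"
      by simp
    then show ?thesis
      by (simp add: twisted_conv_lborel[of "a *\<^sub>\<sigma> a'"] twisted_integrand_def[of "a *\<^sub>\<sigma> a'"] twisted_conv_lborel[of a a'] mult_ac del: integral_mult_right_zero)
  qed
  ultimately show ?thesis using Fub by simp
qed

subsection \<open>Amalgam spaces as modules under twisted convolution\<close>

definition wl :: "real \<Rightarrow> real \<Rightarrow> real \<Rightarrow> ('a::euclidean_space \<Rightarrow> real) \<Rightarrow> ('a \<Rightarrow> complex) \<Rightarrow> ennreal" where
  "wl r p q \<omega> f = amalgam r p q \<omega> (nn_norm f)"

locale amalgam_space =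
  fixes r p q :: real and \<omega> :: "'a::euclidean_space \<Rightarrow> real"
  assumes par: "0 < r" "r \<le> 1" "1 \<le> p" "r \<le> q" and \<omega>_pos: "\<And>k. 0 < \<omega> k"
begin

lemma wl_cnj [simp]: "wl r p q \<omega> (\<lambda>x. cnj (f x)) = wl r p q \<omega> f"
  by (simp add: wl_def)

lemma wl_add:
  assumes [measurable]: "f \<in> borel_measurable borel" "g \<in> borel_measurable borel"
  shows "wl r p q \<omega> (\<lambda>x. f x + g x) \<le> wl r p q \<omega> f + wl r p q \<omega> g"
proof -
  have "wl r p q \<omega> (\<lambda>x. f x + g x) \<le> amalgam r p q \<omega> (\<lambda>x. nn_norm f x + nn_norm g x)"
    unfolding wl_def using par
    by (intro amalgam_mono_AE) (auto simp: norm_triangle_ineq ennreal_leI simp flip: ennreal_plus)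
  also have "\<dots> \<le> wl r p q \<omega> f + wl r p q \<omega> g"
    unfolding wl_def using par by (intro amalgam_add) auto
  finally show ?thesis .
qed

lemma wl_scale:
  assumes [measurable]: "f \<in> borel_measurable borel"
  shows "wl r p q \<omega> (\<lambda>x. c * f x) = ennreal (norm c powr r) * wl r p q \<omega> f"
  unfolding wl_def using par amalgam_cmult[of r p q "nn_norm f" \<omega> "ennreal (norm c)"]
  by (simp add: norm_mult ennreal_mult ennreal_powr_ennreal)

lemma wl_eq_0:
  assumes "wl r p q \<omega> f = 0" and [measurable]: "f \<in> borel_measurable borel"
  shows "AE x in lborel. f x = 0"
  using AE_eq_0_of_amalgam[OF assms(1)[unfolded wl_def] \<omega>_pos] par by simp

text \<open>The Riesz-Fischer argument: subadditivity makes the sum of the moduli finite almost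
  everywhere, so the series converges absolutely there and its remainders are dominated by the tails
  of the moduli.\<close>

lemma wl_complete:
  assumes [measurable]: "\<And>n. u n \<in> borel_measurable borel" and fin: "(\<Sum>n. wl r p q \<omega> (u n)) < top"
  shows "\<exists>s\<in>borel_measurable borel. \<forall>n.
    wl r p q \<omega> (\<lambda>x. s x - (\<Sum>i<n. u i x)) \<le> (\<Sum>i. wl r p q \<omega> (u (i + n)))"
proof (intro bexI[of _ "\<lambda>x. \<Sum>i. u i x"] allI)
  fix n
  have "amalgam r p q \<omega> (\<lambda>x. \<Sum>i. nn_norm (u i) x) < top"
    using par by (intro order.strict_trans1[OF amalgam_suminf fin[unfolded wl_def]]) auto
  then have "AE x in lborel. (\<Sum>i. nn_norm (u i) x) < top"
    using par \<omega>_pos by (intro AE_less_top_of_amalgam[of r p q \<omega>]) auto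
  then have "AE x in lborel. nn_norm (\<lambda>x. (\<Sum>i. u i x) - (\<Sum>i<n. u i x)) x \<le> (\<Sum>i. nn_norm (u (i + n)) x)"
  proof eventually_elim
    case (elim x)
    have sn: "summable (\<lambda>i. norm (u i x))"
      using elim by (intro summable_suminf_not_top) auto
    then have sm: "summable (\<lambda>i. u i x)" by (rule summable_norm_cancel)
    have sn': "summable (\<lambda>i. norm (u (i + n) x))" using sn by (subst summable_iff_shift)
    have "(\<Sum>i. u i x) - (\<Sum>i<n. u i x) = (\<Sum>i. u (i + n) x)"
      using suminf_minus_initial_segment[OF sm, of n] by simp
    then have "norm ((\<Sum>i. u i x) - (\<Sum>i<n. u i x)) \<le> (\<Sum>i. norm (u (i + n) x))"
      using summable_norm[OF sn'] by simp
    then have "nn_norm (\<lambda>x. (\<Sum>i. u i x) - (\<Sum>i<n. u i x)) x \<le> ennreal (\<Sum>i. norm (u (i + n) x))"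
      by (rule ennreal_leI)
    also have "ennreal (\<Sum>i. norm (u (i + n) x)) = (\<Sum>i. nn_norm (u (i + n)) x)"
      using sn' by (intro suminf_ennreal2[symmetric]) auto
    finally show ?case .
  qed
  then have "wl r p q \<omega> (\<lambda>x. (\<Sum>i. u i x) - (\<Sum>i<n. u i x)) \<le> amalgam r p q \<omega> (\<lambda>x. \<Sum>i. nn_norm (u (i + n)) x)"
    unfolding wl_def using par by (intro amalgam_mono_AE)
  also have "\<dots> \<le> (\<Sum>i. wl r p q \<omega> (u (i + n)))"
    unfolding wl_def using par by (intro amalgam_suminf) auto
  finally show "wl r p q \<omega> (\<lambda>x. (\<Sum>i. u i x) - (\<Sum>i<n. u i x)) \<le> (\<Sum>i. wl r p q \<omega> (u (i + n)))" .
qed measurable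

end

text \<open>\<open>E_bound\<close> is moderateness in the form that the cube estimates use:
  \<open>v\<close> is evaluated at j, and the effect of the offset l is absorbed into
  \<open>E\<close>. The algebra itself is the instance with p = 1, q = r and \<omega> = v.\<close>

locale amalgam_module = amalgam_space r p q \<omega>
  for r p q :: real and \<omega> :: "'d::finite phase \<Rightarrow> real" +
  fixes v :: "'d phase \<Rightarrow> real" and E :: real
  assumes v_pos: "\<And>k. 0 < v k" and E_nonneg: "0 \<le> E"
    and E_bound: "\<And>k j l. l \<in> offsets \<Longrightarrow> \<omega> k \<le> E * \<omega> (k - j + l) * v j"
begin

text \<open>The constants \<open>kappa\<close> and \<open>E\<close> scale functions and are
  therefore raised to the power r; the number of offsets counts summands of a subadditive functional
  and is not.\<close>

definition conv_const :: real where
  "conv_const = kappa TYPE('d) powr r * (E powr r * real (card (offsets :: 'd phase set)))"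

lemma amalgam_conv_finite:
  assumes "a \<in> borel_measurable borel" "H \<in> borel_measurable borel"
    and "amalgam r 1 r v a < top" "amalgam r p q \<omega> H < top"
  shows "amalgam r p q \<omega> (nn_conv a H) < top"
proof -
  have "amalgam r p q \<omega> (nn_conv a H) \<le>
    ennreal (E powr r * real (card (offsets :: 'd phase set))) * amalgam r 1 r v a * amalgam r p q \<omega> H"
    using par \<omega>_pos v_pos E_nonneg E_bound assms by (intro amalgam_conv_le) auto
  also have "\<dots> < top" using assms by (simp add: ennreal_mult_less_top)
  finally show ?thesis .
qed

lemma wl_twisted_conv_le:
  assumes [measurable]: "a \<in> borel_measurable borel" "b \<in> borel_measurable borel"
    and fin: "wl r 1 r v a < top"
  shows "wl r p q \<omega> (a *\<^sub>\<sigma> b) \<le> ennreal conv_const * wl r 1 r v a * wl r p q \<omega> b"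
proof -
  have "wl r p q \<omega> (a *\<^sub>\<sigma> b) \<le> amalgam r p q \<omega> (\<lambda>X. ennreal (kappa TYPE('d)) * nn_conv (nn_norm a) (nn_norm b) X)"
    unfolding wl_def using par by (intro amalgam_mono_AE AE_I2 norm_twisted_conv_le) auto
  also have "\<dots> = ennreal (kappa TYPE('d) powr r) * amalgam r p q \<omega> (nn_conv (nn_norm a) (nn_norm b))"
    using par kappa_pos[of "TYPE('d)"] by (simp add: amalgam_cmult ennreal_powr_ennreal)
  also have "\<dots> \<le> ennreal (kappa TYPE('d) powr r) * (ennreal (E powr r * real (card (offsets :: 'd phase set)))
      * wl r 1 r v a * wl r p q \<omega> b)"
    unfolding wl_def using par \<omega>_pos v_pos E_nonneg E_bound fin[unfolded wl_def]
    by (intro mult_left_mono amalgam_conv_le) auto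
  also have "\<dots> = ennreal conv_const * wl r 1 r v a * wl r p q \<omega> b"
    by (simp add: conv_const_def ennreal_mult mult.assoc)
  finally show ?thesis .
qed

lemma wl_twisted_conv_finite:
  assumes "a \<in> borel_measurable borel" "b \<in> borel_measurable borel"
    and "wl r 1 r v a < top" "wl r p q \<omega> b < top"
  shows "wl r p q \<omega> (a *\<^sub>\<sigma> b) < top"
  using order.strict_trans1[OF wl_twisted_conv_le[OF assms(1-3)]] assms
  by (simp add: ennreal_mult_less_top)

lemma AE_integrable_twisted_integrand:
  assumes [measurable]: "a \<in> borel_measurable borel" "b \<in> borel_measurable borel"
    and "wl r 1 r v a < top" "wl r p q \<omega> b < top"
  shows "AE X in lborel. integrable lborel (twisted_integrand a b X)"
proof -
  have "amalgam r p q \<omega> (nn_conv (nn_norm a) (nn_norm b)) < top"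
    using assms unfolding wl_def by (intro amalgam_conv_finite) auto
  then have "AE X in lborel. nn_conv (nn_norm a) (nn_norm b) X < top"
    using par \<omega>_pos by (intro AE_less_top_of_amalgam[of r p q \<omega>]) auto
  then show ?thesis by (simp add: integrable_twisted_integrand_iff)
qed

text \<open>The module bound, applied twice to moduli, yields the finiteness that
  \<open>twisted_conv_assoc\<close> asks for at almost every X.\<close>

lemma AE_twisted_conv_assoc:
  assumes [measurable]: "a \<in> borel_measurable borel" "a' \<in> borel_measurable borel" "h \<in> borel_measurable borel"
    and "wl r 1 r v a < top" "wl r 1 r v a' < top" "wl r p q \<omega> h < top"
  shows "AE X in lborel. ((a *\<^sub>\<sigma> a') *\<^sub>\<sigma> h) X = (a *\<^sub>\<sigma> (a' *\<^sub>\<sigma> h)) X"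
proof -
  have "amalgam r p q \<omega> (nn_conv (nn_norm a) (nn_conv (nn_norm a') (nn_norm h))) < top"
    using assms unfolding wl_def by (intro amalgam_conv_finite) auto
  then have "AE X in lborel. nn_conv (nn_norm a) (nn_conv (nn_norm a') (nn_norm h)) X < top"
    using par \<omega>_pos by (intro AE_less_top_of_amalgam[of r p q \<omega>]) auto
  then show ?thesis
    by eventually_elim (intro twisted_conv_assoc, auto)
qed

end

section \<open>Normalized indicators of small cubes\<close>

definition bump_height :: "'d::finite itself \<Rightarrow> nat \<Rightarrow> real" where
  "bump_height _ n = real (n + 2) ^ DIM('d phase) / kappa TYPE('d)"

lemma bump_height_nonneg: "0 \<le> bump_height TYPE('d::finite) n"
  using kappa_pos[of "TYPE('d)"] by (simp add: bump_height_def)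

text \<open>The height makes the integral equal to 1 / kappa, which cancels the constant in front of
  the twisted convolution. The open box of side 1 / (n + 2) < 1 keeps the support away from every
  lattice cube but the one at 0.\<close>

definition bump :: "nat \<Rightarrow> 'd::finite phase \<Rightarrow> complex" where
  "bump n Y = of_real (bump_height TYPE('d) n)
     * indicator (box 0 ((1 / real (n + 2)) *\<^sub>R One)) Y"

lemma measurable_bump [measurable]: "bump n \<in> borel_measurable borel"
  unfolding bump_def[abs_def] by measurable

lemma cnj_bump: "cnj (bump n Y) = bump n Y"
  by (simp add: bump_def indicator_def)

lemma nn_norm_bump:
  "nn_norm (bump n) Y = ennreal (bump_height TYPE('d::finite) n)
     * indicator (box 0 ((1 / real (n + 2)) *\<^sub>R One)) (Y :: 'd phase)"
  using bump_height_nonneg[where 'd = 'd] by (simp add: bump_def norm_mult indicator_def)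

lemma nn_integral_bump:
  "(\<integral>\<^sup>+Y. nn_norm (bump n) Y \<partial>(lborel :: 'd::finite phase measure)) = ennreal (1 / kappa TYPE('d))"
proof -
  have "emeasure lborel (box 0 ((1 / real (n + 2)) *\<^sub>R One) :: 'd phase set) = ennreal ((1 / real (n + 2)) ^ DIM('d phase))"
    by (subst emeasure_lborel_box) auto
  then have "(\<integral>\<^sup>+Y. nn_norm (bump n) Y \<partial>(lborel :: 'd phase measure))
      = ennreal (bump_height TYPE('d) n) * ennreal ((1 / real (n + 2)) ^ DIM('d phase))"
    unfolding nn_norm_bump by (subst nn_integral_cmult_indicator) auto
  also have "\<dots> = ennreal (1 / kappa TYPE('d))"
  proof -
    have "bump_height TYPE('d) n * (1 / real (n + 2)) ^ DIM('d phase) = 1 / kappa TYPE('d)"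
      by (simp only: bump_height_def power_one_over times_divide_times_eq) simp
    then show ?thesis
      using bump_height_nonneg[where 'd = 'd] by (simp only: zero_le_power zero_le_divide_1_iff of_nat_0_le_iff flip: ennreal_mult)
  qed
  finally show ?thesis .
qed

lemma bump_support:
  assumes "bump n (Y :: 'd::finite phase) \<noteq> 0"
  shows "Y \<in> unit_cube 0" "norm Y \<le> real DIM('d phase) / real (n + 2)"
    "\<And>k. k \<in> lattice \<Longrightarrow> Y \<in> unit_cube k \<Longrightarrow> k = 0"
proof -
  have Y: "0 < Y \<bullet> b \<and> Y \<bullet> b < 1 / real (n + 2)" if "b \<in> Basis" for b
    using assms that by (auto simp: bump_def indicator_def mem_box split: if_splits)
  have lt1: "1 / real (n + 2) < 1" by simp
  have Y1: "0 < Y \<bullet> b" "Y \<bullet> b < 1" if "b \<in> Basis" for b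
    using Y[OF that] lt1 by linarith+
  then show "Y \<in> unit_cube 0" by (auto simp: mem_box intro: less_imp_le)
  have "norm Y \<le> (\<Sum>b\<in>Basis. \<bar>Y \<bullet> b\<bar>)" by (rule norm_le_l1)
  also have "\<dots> \<le> (\<Sum>b\<in>(Basis :: 'd phase set). 1 / real (n + 2))"
    using Y by (intro sum_mono) (auto simp: abs_of_pos less_imp_le)
  finally show "norm Y \<le> real DIM('d phase) / real (n + 2)" by simp
  fix k assume k: "k \<in> lattice" "Y \<in> unit_cube k"
  show "k = 0"
  proof (rule euclidean_eqI)
    fix b :: "'d phase" assume b: "b \<in> Basis"
    then obtain m where m: "k \<bullet> b = real_of_int m" using k(1) by (auto simp: lattice_def elim!: Ints_cases)
    have "k \<bullet> b \<le> Y \<bullet> b" "Y \<bullet> b \<le> k \<bullet> b + 1" using k(2) b by (auto simp: mem_box inner_add_left)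
    then have "real_of_int m < 1" "-1 < real_of_int m" using Y1[OF b] m by linarith+
    then show "k \<bullet> b = 0 \<bullet> b" using m by simp
  qed
qed

text \<open>Only the lattice point 0 contributes, and the mass there is fixed; hence the bound is
  uniform in n although the bumps concentrate.\<close>

lemma wl_bump_le:
  assumes "0 < r" "\<And>k. 0 < (v :: 'd::finite phase \<Rightarrow> real) k"
  shows "wl r 1 r v (bump n) \<le> ennreal ((v 0 / kappa TYPE('d)) powr r)"
proof -
  have *: "cube_norm 1 (nn_norm (bump n)) k = 0" if "k \<in> lattice" "k \<noteq> 0" for k :: "'d phase"
  proof -
    have "ennreal (norm (bump n Y)) * indicator (unit_cube k) Y = 0" for Y :: "'d phase"
      using bump_support(3)[of n Y, OF _ that(1)] that(2) by (auto simp: indicator_def)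
    then have "cube_norm 1 (nn_norm (bump n)) k = (\<integral>\<^sup>+(Y :: 'd phase). 0 \<partial>lborel)"
      unfolding cube_norm_1 by (intro nn_integral_cong)
    then show ?thesis by simp
  qed
  have "cube_norm 1 (nn_norm (bump n :: 'd phase \<Rightarrow> complex)) 0 \<le> (\<integral>\<^sup>+Y. ennreal (norm (bump n Y :: complex)) \<partial>(lborel :: 'd phase measure))"
    unfolding cube_norm_1 by (intro nn_integral_mono) (auto simp: indicator_def)
  also have "\<dots> = ennreal (1 / kappa TYPE('d))" by (rule nn_integral_bump)
  finally have le: "cube_norm 1 (nn_norm (bump n)) (0 :: 'd phase) \<le> ennreal (1 / kappa TYPE('d))" .
  have "wl r 1 r v (bump n) = (\<integral>\<^sup>+k. ennreal_powr (cube_norm 1 (nn_norm (bump n)) k * ennreal (v k)) r \<partial>count_space lattice)"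
    using assms by (simp add: wl_def amalgam_def)
  also have "\<dots> = (\<Sum>k\<in>{0 :: 'd phase}. ennreal_powr (cube_norm 1 (nn_norm (bump n)) k * ennreal (v k)) r)"
    using * zero_in_lattice by (intro nn_integral_count_space') auto
  also have "\<dots> \<le> ennreal_powr (ennreal (1 / kappa TYPE('d)) * ennreal (v 0)) r"
    using assms le by (auto intro!: ennreal_powr_mono mult_right_mono)
  also have "\<dots> = ennreal ((v 0 / kappa TYPE('d)) powr r)"
    using assms(2)[of 0] kappa_pos[of "TYPE('d)"]
    by (simp add: ennreal_powr_ennreal flip: ennreal_mult)
  finally show ?thesis .
qed

context amalgam_module
begin

text \<open>Since kappa times the bump has mass 1, the difference is an average of h (X - Y) \<phi>
  X Y - h X, where \<phi> is the phase of the reflected integral.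
  \<open>amalgam_approx_identity\<close> treats such averages.\<close>

lemma bump_approx_identity:
  assumes [measurable]: "h \<in> borel_measurable borel" and h: "wl r p q \<omega> h < top"
  shows "(\<lambda>n. wl r p q \<omega> (\<lambda>X. (bump n *\<^sub>\<sigma> h) X - h X)) \<longlonglongrightarrow> 0"
proof -
  let ?\<kappa> = "kappa TYPE('d)"
  have \<kappa>: "0 < ?\<kappa>" by (rule kappa_pos)
  define \<phi> where "\<phi> X Y = exp (- (2 * \<i> * of_real (sympl X Y)))" for X Y :: "'d phase"
  define e where "e n Y = ennreal ?\<kappa> * nn_norm (bump n) Y" for n and Y :: "'d phase"
  have e1: "(\<integral>\<^sup>+Y. e n Y \<partial>lborel) = 1" for n
    unfolding e_def using \<kappa>
    by (subst nn_integral_cmult) (auto simp: nn_integral_bump simp flip: ennreal_mult)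
  have lim: "(\<lambda>n. amalgam r p q \<omega> (\<lambda>X. \<integral>\<^sup>+Y. e n Y * ennreal (norm (h (X - Y) * \<phi> X Y - h X)) \<partial>lborel)) \<longlonglongrightarrow> 0"
  proof (rule amalgam_approx_identity)
    \<comment> \<open>At j = 0 the bound on \<omega> loses its shift and picks up the factor v
      0.\<close>
    show "0 \<le> E * v 0" using E_nonneg v_pos[of 0] by simp
    show "\<omega> k \<le> (E * v 0) * \<omega> (k + l)" if "l \<in> offsets" for k l
      using E_bound[OF that, of k 0] by (simp add: mult_ac)
    show "amalgam r p q \<omega> (\<lambda>x. ennreal (norm (h x))) < top" using h by (simp add: wl_def)
    show "continuous_on UNIV (\<lambda>z. \<phi> (fst z) (snd z))" unfolding \<phi>_def by (intro continuous_intros)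
    show "norm (\<phi> X Y) = 1" for X Y by (simp add: \<phi>_def norm_exp_eq_Re)
    show "\<phi> X 0 = 1" for X by (simp add: \<phi>_def sympl_def)
    show "Y \<in> unit_cube 0 \<and> norm Y \<le> real DIM('d phase) / real (n + 2)" if "e n Y \<noteq> 0" for n Y
    proof -
      have "bump n Y \<noteq> 0" using that by (auto simp: e_def)
      then show ?thesis using bump_support(1,2)[of n Y] by blast
    qed
    show "(\<lambda>n. real DIM('d phase) / real (n + 2)) \<longlonglongrightarrow> 0"
      using LIMSEQ_ignore_initial_segment[OF lim_const_over_n[of "real DIM(('d phase))"], of 2] by simp
    show "e n \<in> borel_measurable borel" for n unfolding e_def[abs_def] by measurable
  qed (use par \<omega>_pos e1 in auto)
  have "wl r 1 r v (bump n) < top" for n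
    using order.strict_trans1[OF wl_bump_le[of r v n]] par v_pos by simp
  then have AE: "AE X in lborel. integrable lborel (twisted_integrand (bump n) h X)" for n
    using h by (intro AE_integrable_twisted_integrand) auto
  have "wl r p q \<omega> (\<lambda>X. (bump n *\<^sub>\<sigma> h) X - h X)
      \<le> amalgam r p q \<omega> (\<lambda>X. \<integral>\<^sup>+Y. e n Y * ennreal (norm (h (X - Y) * \<phi> X Y - h X)) \<partial>lborel)" for n
    unfolding wl_def
  proof (intro amalgam_mono_AE par)
    show "AE X in lborel. ennreal (norm ((bump n *\<^sub>\<sigma> h) X - h X))
      \<le> (\<integral>\<^sup>+Y. e n Y * ennreal (norm (h (X - Y) * \<phi> X Y - h X)) \<partial>lborel)"
      using AE[of n]
    proof eventually_elim
      case (elim X)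
      define w where "w Y = bump n Y * (h (X - Y) * \<phi> X Y)" for Y
      have [measurable]: "(\<lambda>Y. \<phi> X Y) \<in> borel_measurable borel" unfolding \<phi>_def by measurable
      have wint: "integrable lborel w"
      proof -
        have "(\<integral>\<^sup>+Y. norm (w Y) \<partial>lborel) = nn_conv (nn_norm (bump n)) (nn_norm h) X"
          by (simp add: nn_conv_def w_def norm_mult \<phi>_def norm_exp_eq_Re ennreal_mult)
        then show ?thesis using elim
          by (intro integrableI_bounded) (auto simp: integrable_twisted_integrand_iff w_def[abs_def])
      qed
      have bint: "integrable lborel (bump n :: 'd phase \<Rightarrow> complex)"
        using nn_integral_bump[of n, where 'd = 'd] by (intro integrableI_bounded) auto
      have "(LINT Y|(lborel :: 'd phase measure). bump n Y) = of_real (1 / ?\<kappa>)"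
      proof -
        have b: "bump n Y = of_real (norm (bump n Y))" for Y :: "'d phase"
          using bump_height_nonneg[where 'd = 'd] by (simp add: bump_def indicator_def norm_mult)
        have "(LINT Y|(lborel :: 'd phase measure). norm (bump n Y)) = 1 / ?\<kappa>"
          using nn_integral_bump[of n, where 'd = 'd] \<kappa>
          by (subst integral_eq_nn_integral) auto
        moreover have "(LINT Y|(lborel :: 'd phase measure). bump n Y) = (LINT Y|(lborel :: 'd phase measure). of_real (norm (bump n Y)))"
          by (rule Bochner_Integration.integral_cong[OF refl b])
        ultimately show ?thesis by simp
      qed
      then have hX: "h X = of_real ?\<kappa> * (LINT Y|(lborel :: 'd phase measure). bump n Y * h X)"
        using \<kappa> by simp
      have "(bump n *\<^sub>\<sigma> h) X = of_real ?\<kappa> * (LINT Y|lborel. w Y)"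
        by (simp add: twisted_conv_reflect w_def \<phi>_def)
      then have "(bump n *\<^sub>\<sigma> h) X - h X = of_real ?\<kappa> * ((LINT Y|lborel. w Y) - (LINT Y|(lborel :: 'd phase measure). bump n Y * h X))"
        by (subst hX) (simp only: right_diff_distrib)
      also have "(LINT Y|lborel. w Y) - (LINT Y|(lborel :: 'd phase measure). bump n Y * h X) = (LINT Y|lborel. bump n Y * (h (X - Y) * \<phi> X Y - h X))"
        using wint bint by (subst Bochner_Integration.integral_diff[symmetric]) (auto simp: w_def right_diff_distrib)
      finally have eq: "ennreal (norm ((bump n *\<^sub>\<sigma> h) X - h X))
          = ennreal ?\<kappa> * ennreal (norm (LINT Y|lborel. bump n Y * (h (X - Y) * \<phi> X Y - h X)))"
        using \<kappa> by (simp add: norm_mult ennreal_mult)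
      have "integrable lborel (\<lambda>Y. bump n Y * (h (X - Y) * \<phi> X Y - h X))"
        using wint bint unfolding w_def[abs_def] right_diff_distrib by (intro Bochner_Integration.integrable_diff) auto
      from integral_norm_bound_ennreal[OF this]
      have "ennreal (norm ((bump n *\<^sub>\<sigma> h) X - h X))
          \<le> ennreal ?\<kappa> * (\<integral>\<^sup>+Y. norm (bump n Y * (h (X - Y) * \<phi> X Y - h X)) \<partial>lborel)"
        unfolding eq by (intro mult_left_mono) auto
      also have "\<dots> = (\<integral>\<^sup>+Y. e n Y * ennreal (norm (h (X - Y) * \<phi> X Y - h X)) \<partial>lborel)"
        by (subst nn_integral_cmult[symmetric]) (auto simp: e_def norm_mult ennreal_mult mult.assoc)
      finally show ?case .
    qed
  qed
  then show ?thesis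
    by (intro tendsto_sandwich[OF _ _ tendsto_const lim]) auto
qed

text \<open>The bump is real, so conjugation turns a right product with it into a left
  product.\<close>

lemma bump_approx_identity_right:
  assumes [measurable]: "h \<in> borel_measurable borel" and h: "wl r p q \<omega> h < top"
  shows "(\<lambda>n. wl r p q \<omega> (\<lambda>X. (h *\<^sub>\<sigma> bump n) X - h X)) \<longlonglongrightarrow> 0"
proof -
  have [measurable]: "(\<lambda>x. cnj (h x)) \<in> borel_measurable borel"
    by (rule borel_measurable_continuous_on[OF continuous_on_cnj[OF continuous_on_id]]) simp
  have eq: "(\<lambda>X. (h *\<^sub>\<sigma> bump n) X - h X) = (\<lambda>X. cnj ((bump n *\<^sub>\<sigma> (\<lambda>x. cnj (h x))) X - cnj (h X)))" for n
    by (intro ext) (simp add: twisted_conv_commute_cnj[of "bump n" h] cnj_bump)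
  have "(\<lambda>n. wl r p q \<omega> (\<lambda>X. (bump n *\<^sub>\<sigma> (\<lambda>x. cnj (h x))) X - cnj (h X))) \<longlonglongrightarrow> 0"
    using h by (intro bump_approx_identity) auto
  then show ?thesis unfolding eq wl_cnj .
qed

end

subsection \<open>Classes of Borel functions\<close>

\<comment> \<open>Definiteness in \<open>quasi_norm\<close> holds only modulo null sets, so classes
  are needed as a type of their own. The relation is partial in order that every representative be
  Borel measurable.\<close>
quotient_type (overloaded) 'a borel_class = "'a::euclidean_space \<Rightarrow> complex" / partial:
  "\<lambda>f g. f \<in> borel_measurable borel \<and> g \<in> borel_measurable borel \<and> (AE x in lborel. f x = g x)"
proof (rule part_equivpI)
  show "\<exists>f. f \<in> borel_measurable borel \<and> f \<in> borel_measurable borel \<and> (AE x in lborel. f x = (f x :: complex))"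
    by (intro exI[of _ "\<lambda>_. 0"]) simp
  show "symp (\<lambda>f g. f \<in> borel_measurable borel \<and> g \<in> borel_measurable borel \<and> (AE x in lborel. f x = (g x :: complex)))"
    by (intro sympI) (auto elim: eventually_mono)
  show "transp (\<lambda>f g. f \<in> borel_measurable borel \<and> g \<in> borel_measurable borel \<and> (AE x in lborel. f x = (g x :: complex)))"
    by (intro transpI) (auto elim: eventually_elim2)
qed

instantiation borel_class :: (euclidean_space) real_vector
begin

lift_definition zero_borel_class :: "'a borel_class" is "\<lambda>_. 0" by simp

lift_definition plus_borel_class :: "'a borel_class \<Rightarrow> 'a borel_class \<Rightarrow> 'a borel_class"
  is "\<lambda>f g x. f x + g x" by (auto elim: eventually_elim2)

lift_definition uminus_borel_class :: "'a borel_class \<Rightarrow> 'a borel_class"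
  is "\<lambda>f x. - f x" by (auto elim: eventually_mono)

lift_definition minus_borel_class :: "'a borel_class \<Rightarrow> 'a borel_class \<Rightarrow> 'a borel_class"
  is "\<lambda>f g x. f x - g x" by (auto elim: eventually_elim2)

lift_definition scaleR_borel_class :: "real \<Rightarrow> 'a borel_class \<Rightarrow> 'a borel_class"
  is "\<lambda>c f x. of_real c * f x" by (auto elim: eventually_mono)

instance
  by standard (transfer; force simp: algebra_simps)+

end

lift_definition wl_class :: "real \<Rightarrow> real \<Rightarrow> real \<Rightarrow> ('a::euclidean_space \<Rightarrow> real) \<Rightarrow> 'a borel_class \<Rightarrow> ennreal"
  is wl unfolding wl_def by (intro amalgam_cong) (auto elim: eventually_mono)

text \<open>Total on classes: a divergent integral has the default value 0, and changing
  representatives does not change the convolution at any point.\<close>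

lift_definition class_conv :: "'d::finite phase borel_class \<Rightarrow> 'd phase borel_class \<Rightarrow> 'd phase borel_class"
  is "(*\<^sub>\<sigma>)"
proof goal_cases
  case (1 a a' b b')
  then have "a *\<^sub>\<sigma> b = a' *\<^sub>\<sigma> b'" by (intro twisted_conv_cong_AE) auto
  with 1 show ?case using measurable_twisted_conv[of a b] by auto
qed

lemma borel_class_cases:
  obtains f where "f \<in> borel_measurable borel" "x = abs_borel_class f"
proof -
  have "\<exists>f. f \<in> borel_measurable borel \<and> x = abs_borel_class f"
    by (induction x rule: borel_class.abs_induct) auto
  then show ?thesis using that by blast
qed

lemma abs_borel_class_eq_iff:
  "f \<in> borel_measurable borel \<Longrightarrow> g \<in> borel_measurable borel \<Longrightarrow>
    abs_borel_class f = abs_borel_class g \<longleftrightarrow> (AE x in lborel. f x = g x)"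
  using Quotient_rel[OF Quotient_borel_class, of f g] by simp

lemma abs_borel_class_plus_minus:
  assumes "f \<in> borel_measurable borel" "g \<in> borel_measurable borel"
  shows "abs_borel_class f + abs_borel_class g = abs_borel_class (\<lambda>x. f x + g x)"
    "abs_borel_class f - abs_borel_class g = abs_borel_class (\<lambda>x. f x - g x)"
  using assms by (simp_all add: plus_borel_class.abs_eq minus_borel_class.abs_eq)

lemma scaleR_abs_borel_class:
  "f \<in> borel_measurable borel \<Longrightarrow> c *\<^sub>R abs_borel_class f = abs_borel_class (\<lambda>x. of_real c * f x)"
  by (simp add: scaleR_borel_class.abs_eq)

lemma wl_class_abs:
  "f \<in> borel_measurable borel \<Longrightarrow> wl_class r p q \<omega> (abs_borel_class f) = wl r p q \<omega> f"
  by (simp add: wl_class.abs_eq)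

lemma class_conv_abs:
  assumes "f \<in> borel_measurable borel" "g \<in> borel_measurable borel"
  shows "class_conv (abs_borel_class f) (abs_borel_class g) = abs_borel_class (f *\<^sub>\<sigma> g)"
  using assms by (simp add: class_conv.abs_eq)

lemmas abs_borel_class_simps = abs_borel_class_plus_minus scaleR_abs_borel_class wl_class_abs

lemma sum_abs_borel_class:
  assumes "\<And>i. u i \<in> borel_measurable borel"
  shows "(\<Sum>i<(n::nat). abs_borel_class (u i)) = abs_borel_class (\<lambda>x. \<Sum>i<n. u i x)"
proof (induction n)
  case 0
  then show ?case by (simp add: zero_borel_class.abs_eq)
next
  case (Suc n)
  have "(\<lambda>x. \<Sum>i<n. u i x) \<in> borel_measurable borel" using assms by measurable
  then show ?case using Suc assms by (simp add: abs_borel_class_simps)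
qed

lemma (in amalgam_space) quasi_norm_wl_class: "quasi_norm r (wl_class r p q \<omega>)"
proof
  show "0 < r" by (rule par)
next
  fix x y :: "'a borel_class"
  obtain f g where [measurable]: "f \<in> borel_measurable borel" "g \<in> borel_measurable borel"
    and xy: "x = abs_borel_class f" "y = abs_borel_class g" by (metis borel_class_cases)
  show "wl_class r p q \<omega> (x + y) \<le> wl_class r p q \<omega> x + wl_class r p q \<omega> y"
    by (simp add: xy abs_borel_class_simps wl_add)
next
  fix c and x :: "'a borel_class"
  obtain f where [measurable]: "f \<in> borel_measurable borel" and x: "x = abs_borel_class f"
    by (metis borel_class_cases)
  show "wl_class r p q \<omega> (c *\<^sub>R x) = ennreal (\<bar>c\<bar> powr r) * wl_class r p q \<omega> x"
    by (simp add: x abs_borel_class_simps wl_scale)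
next
  fix x :: "'a borel_class" assume *: "wl_class r p q \<omega> x = 0"
  obtain f where [measurable]: "f \<in> borel_measurable borel" and x: "x = abs_borel_class f"
    by (metis borel_class_cases)
  have "AE t in lborel. f t = 0" using * by (intro wl_eq_0) (auto simp: x abs_borel_class_simps)
  then show "x = 0" by (simp add: x zero_borel_class.abs_eq abs_borel_class_eq_iff)
next
  fix u :: "nat \<Rightarrow> 'a borel_class" assume fin: "(\<Sum>n. wl_class r p q \<omega> (u n)) < top"
  have "\<forall>n. \<exists>f. f \<in> borel_measurable borel \<and> u n = abs_borel_class f"
    by (metis borel_class_cases)
  then obtain f where f [measurable]: "\<And>n. f n \<in> borel_measurable borel" and u: "\<And>n. u n = abs_borel_class (f n)"
    by metis
  obtain s where s: "s \<in> borel_measurable borel"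
    "\<And>n. wl r p q \<omega> (\<lambda>x. s x - (\<Sum>i<n. f i x)) \<le> (\<Sum>i. wl r p q \<omega> (f (i + n)))"
    using wl_complete[of f, OF f] fin by (auto simp: u abs_borel_class_simps)
  have "(\<lambda>x. \<Sum>i<n. f i x) \<in> borel_measurable borel" for n by measurable
  then show "\<exists>s. \<forall>n. wl_class r p q \<omega> (s - (\<Sum>i<n. u i)) \<le> (\<Sum>i. wl_class r p q \<omega> (u (i + n)))"
    using s by (intro exI[of _ "abs_borel_class s"]) (simp add: u sum_abs_borel_class abs_borel_class_simps)
qed

lemma (in amalgam_module) quasi_module_wl_class:
  assumes K: "1 \<le> K" "conv_const \<le> K"
  shows "quasi_module r (wl_class r p q \<omega>) class_conv (wl_class r 1 r v) K"
proof (intro quasi_module.intro quasi_norm_wl_class quasi_module_axioms.intro K(1))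
  fix a h :: "'d phase borel_class" assume fin: "wl_class r 1 r v a < top" "wl_class r p q \<omega> h < top"
  obtain f g where [measurable]: "f \<in> borel_measurable borel" "g \<in> borel_measurable borel"
    and ah: "a = abs_borel_class f" "h = abs_borel_class g" by (metis borel_class_cases)
  have "wl r p q \<omega> (f *\<^sub>\<sigma> g) \<le> ennreal conv_const * wl r 1 r v f * wl r p q \<omega> g"
    using fin by (intro wl_twisted_conv_le) (auto simp: ah abs_borel_class_simps)
  also have "\<dots> \<le> ennreal K * wl r 1 r v f * wl r p q \<omega> g"
    using K by (intro mult_right_mono ennreal_leI) auto
  finally show "wl_class r p q \<omega> (class_conv a h) \<le> ennreal K * wl_class r 1 r v a * wl_class r p q \<omega> h"
    by (simp add: ah class_conv_abs abs_borel_class_simps measurable_twisted_conv)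
  fix c :: real
  show "class_conv (c *\<^sub>R a) h = c *\<^sub>R class_conv a h" "class_conv a (c *\<^sub>R h) = c *\<^sub>R class_conv a h"
    by (simp_all add: ah class_conv_abs abs_borel_class_simps measurable_twisted_conv twisted_conv_scale abs_borel_class_eq_iff)
next
  fix a a' h :: "'d phase borel_class"
  assume fin: "wl_class r 1 r v a < top" "wl_class r 1 r v a' < top" "wl_class r p q \<omega> h < top"
  obtain f f' g where [measurable]: "f \<in> borel_measurable borel" "f' \<in> borel_measurable borel" "g \<in> borel_measurable borel"
    and ah: "a = abs_borel_class f" "a' = abs_borel_class f'" "h = abs_borel_class g" by (metis borel_class_cases)
  have fin': "wl r 1 r v f < top" "wl r 1 r v f' < top" "wl r p q \<omega> g < top"
    using fin by (auto simp: ah abs_borel_class_simps)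
  have "AE X in lborel. ((\<lambda>x. f x + f' x) *\<^sub>\<sigma> g) X = (f *\<^sub>\<sigma> g) X + (f' *\<^sub>\<sigma> g) X"
    using AE_integrable_twisted_integrand[of f g] AE_integrable_twisted_integrand[of f' g] fin'
    by (auto elim!: eventually_elim2 intro!: twisted_conv_add_left)
  then show "class_conv (a + a') h = class_conv a h + class_conv a' h"
    by (simp add: ah class_conv_abs abs_borel_class_simps measurable_twisted_conv abs_borel_class_eq_iff)
  have "AE X in lborel. ((f *\<^sub>\<sigma> f') *\<^sub>\<sigma> g) X = (f *\<^sub>\<sigma> (f' *\<^sub>\<sigma> g)) X"
    using fin' by (intro AE_twisted_conv_assoc) auto
  then show "class_conv (class_conv a a') h = class_conv a (class_conv a' h)"
    by (simp add: ah class_conv_abs measurable_twisted_conv abs_borel_class_eq_iff)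
next
  fix a h h' :: "'d phase borel_class"
  assume fin: "wl_class r 1 r v a < top" "wl_class r p q \<omega> h < top" "wl_class r p q \<omega> h' < top"
  obtain f g g' where [measurable]: "f \<in> borel_measurable borel" "g \<in> borel_measurable borel" "g' \<in> borel_measurable borel"
    and ah: "a = abs_borel_class f" "h = abs_borel_class g" "h' = abs_borel_class g'" by (metis borel_class_cases)
  have fin': "wl r 1 r v f < top" "wl r p q \<omega> g < top" "wl r p q \<omega> g' < top"
    using fin by (auto simp: ah abs_borel_class_simps)
  have "AE X in lborel. (f *\<^sub>\<sigma> (\<lambda>x. g x + g' x)) X = (f *\<^sub>\<sigma> g) X + (f *\<^sub>\<sigma> g') X"
    using AE_integrable_twisted_integrand[of f g] AE_integrable_twisted_integrand[of f g'] fin'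
    by (auto elim!: eventually_elim2 intro!: twisted_conv_add_right)
  then show "class_conv a (h + h') = class_conv a h + class_conv a h'"
    by (simp add: ah class_conv_abs abs_borel_class_simps measurable_twisted_conv abs_borel_class_eq_iff)
qed

text \<open>The assumption \<open>alg\<close> makes the L^1 amalgam of weight \<open>v\<close> an
  algebra. The lemma is applied with the submultiplicative majorant in the place of
  \<open>v\<close>.\<close>

lemma (in amalgam_module) borel_factorization:
  assumes alg: "amalgam_module r 1 r v v E'"
    and f [measurable]: "f \<in> borel_measurable borel" and fin: "wl r p q \<omega> f < top"
  obtains a b where "a \<in> borel_measurable borel" "b \<in> borel_measurable borel"
    "wl r 1 r v a < top" "wl r p q \<omega> b < top" "AE X in lborel. f X = (a *\<^sub>\<sigma> b) X"
proof -
  interpret V: amalgam_module r 1 r v v E' by (rule alg)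
  \<comment> \<open>One constant for the algebra and the module together, at least 1 as the locale
    demands.\<close>
  define K where "K = max 1 (max conv_const V.conv_const)"
  define M where "M = (v 0 / kappa TYPE('d)) powr r"
  have "quasi_algebra_module r K (wl_class r 1 r v) (wl_class r p q \<omega>) class_conv M"
  proof (intro quasi_algebra_module.intro quasi_algebra_module_axioms.intro)
    show "quasi_module r (wl_class r 1 r v) class_conv (wl_class r 1 r v) K"
      by (intro V.quasi_module_wl_class) (auto simp: K_def)
    show "quasi_module r (wl_class r p q \<omega>) class_conv (wl_class r 1 r v) K"
      by (intro quasi_module_wl_class) (auto simp: K_def)
    fix a b :: "'d phase borel_class" and \<epsilon> :: real
    assume ab_fin: "wl_class r 1 r v a < top" "wl_class r p q \<omega> b < top" and \<epsilon>: "0 < \<epsilon>"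
    obtain g h where [measurable]: "g \<in> borel_measurable borel" "h \<in> borel_measurable borel"
      and ab: "a = abs_borel_class g" "b = abs_borel_class h" by (metis borel_class_cases)
    have "(\<lambda>n. wl r 1 r v (\<lambda>X. (g *\<^sub>\<sigma> bump n) X - g X)) \<longlonglongrightarrow> 0"
      using ab_fin by (intro V.bump_approx_identity_right) (auto simp: ab abs_borel_class_simps)
    then have "\<forall>\<^sub>F n in sequentially. wl r 1 r v (\<lambda>X. (g *\<^sub>\<sigma> bump n) X - g X) < ennreal \<epsilon>"
      using \<epsilon> by (intro order_tendstoD) auto
    moreover have "(\<lambda>n. wl r p q \<omega> (\<lambda>X. (bump n *\<^sub>\<sigma> h) X - h X)) \<longlonglongrightarrow> 0"
      using ab_fin by (intro bump_approx_identity) (auto simp: ab abs_borel_class_simps)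
    then have "\<forall>\<^sub>F n in sequentially. wl r p q \<omega> (\<lambda>X. (bump n *\<^sub>\<sigma> h) X - h X) < ennreal \<epsilon>"
      using \<epsilon> by (intro order_tendstoD) auto
    \<comment> \<open>A single bump has to serve a from the right and b from the left.\<close>
    ultimately have "\<forall>\<^sub>F n in sequentially. wl r 1 r v (\<lambda>X. (g *\<^sub>\<sigma> bump n) X - g X) < ennreal \<epsilon> \<and>
        wl r p q \<omega> (\<lambda>X. (bump n *\<^sub>\<sigma> h) X - h X) < ennreal \<epsilon>"
      by (rule eventually_conj)
    then obtain n where n: "wl r 1 r v (\<lambda>X. (g *\<^sub>\<sigma> bump n) X - g X) < ennreal \<epsilon>"
        "wl r p q \<omega> (\<lambda>X. (bump n *\<^sub>\<sigma> h) X - h X) < ennreal \<epsilon>"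
      by (auto simp: eventually_sequentially)
    show "\<exists>e. wl_class r 1 r v e \<le> ennreal M \<and> wl_class r 1 r v (class_conv a e - a) \<le> ennreal \<epsilon> \<and>
        wl_class r p q \<omega> (class_conv e b - b) \<le> ennreal \<epsilon>"
      using n wl_bump_le[of r v n] par v_pos
      by (intro exI[of _ "abs_borel_class (bump n)"])
        (simp add: ab class_conv_abs abs_borel_class_simps measurable_twisted_conv M_def less_imp_le)
  qed
  then obtain x y where xy: "wl_class r 1 r v x < top" "wl_class r p q \<omega> y < top" "abs_borel_class f = class_conv x y"
    using quasi_algebra_module.factorization[of r K "wl_class r 1 r v" "wl_class r p q \<omega>" class_conv M "abs_borel_class f"] fin
    by (auto simp: abs_borel_class_simps)
  obtain a b where [measurable]: "a \<in> borel_measurable borel" "b \<in> borel_measurable borel"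
    and ab: "x = abs_borel_class a" "y = abs_borel_class b" by (metis borel_class_cases)
  show ?thesis
    using xy by (intro that[of a b]) (auto simp: ab class_conv_abs abs_borel_class_simps measurable_twisted_conv abs_borel_class_eq_iff)
qed

subsection \<open>Passage to Lebesgue measurable functions\<close>

lemma lebesgue_ex_borel:
  fixes f :: "'a::euclidean_space \<Rightarrow> complex"
  assumes "f \<in> borel_measurable lebesgue"
  obtains g where "g \<in> borel_measurable borel" "AE x in lborel. f x = g x"
proof -
  have "(\<lambda>x. Re (f x)) \<in> borel_measurable lebesgue" "(\<lambda>x. Im (f x)) \<in> borel_measurable lebesgue"
    using assms by auto
  then obtain u w where [measurable]: "u \<in> borel_measurable borel" "w \<in> borel_measurable borel"
    and uw: "AE x in lborel. Re (f x) = u x" "AE x in lborel. Im (f x) = w x"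
    using completion_ex_borel_measurable_real[of "\<lambda>x. Re (f x)" lborel]
      completion_ex_borel_measurable_real[of "\<lambda>x. Im (f x)" lborel] by auto
  from uw have "AE x in lborel. f x = of_real (u x) + \<i> * of_real (w x)"
    by eventually_elim (metis complex_eq)
  then show ?thesis by (intro that) auto
qed

lemma lebesgue_measurable_AE_borel:
  fixes f :: "'a::euclidean_space \<Rightarrow> complex"
  assumes g: "g \<in> borel_measurable borel" and eq: "AE x in lborel. f x = g x"
  shows "f \<in> borel_measurable lebesgue"
proof (rule measurableI)
  fix A :: "complex set" assume A: "A \<in> sets borel"
  have "g \<in> borel_measurable lebesgue" using g by (simp add: measurable_completion)
  then have gA: "g -` A \<inter> space lebesgue \<in> sets lebesgue" using A by (rule measurable_sets)
  have ae: "AE x in lebesgue. x \<in> g -` A \<inter> space lebesgue \<longleftrightarrow> x \<in> f -` A \<inter> space lebesgue"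
    using AE_completion[OF eq] by eventually_elim auto
  show "f -` A \<inter> space lebesgue \<in> sets lebesgue"
    by (rule completion.in_sets_AE[OF ae gA]) simp
qed simp

lemma local_norm_eq:
  assumes "1 \<le> p"
  shows "local_norm (ennreal p) f k = cube_norm p (nn_norm f) k"
proof -
  have cube: "(+) k ` cbox 0 One = unit_cube k"
    using cbox_translation[of k 0 One] by simp
  have "(\<integral>\<^sup>+x. ennreal_powr (nn_norm f x) p \<partial>restrict_space lebesgue (unit_cube k))
      = (\<integral>\<^sup>+x. ennreal_powr (nn_norm f x) p * indicator (unit_cube k) x \<partial>lborel)"
    by (subst nn_integral_restrict_space) (auto simp: nn_integral_completion)
  also have "\<dots> = (\<integral>\<^sup>+x. ennreal_powr (nn_norm f x * indicator (unit_cube k) x) p \<partial>lborel)"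
    by (intro nn_integral_cong) (simp add: indicator_def)
  finally show ?thesis
    using assms by (simp add: local_norm_def Lp_norm_def cube cube_norm_def)
qed

lemma WL_norm_less_top_iff:
  assumes "1 \<le> p" "0 < q"
  shows "WL_norm (ennreal p) (ennreal q) \<omega> f < \<infinity> \<longleftrightarrow> wl r p q \<omega> f < top"
  using assms unfolding wl_def amalgam_def infinity_ennreal_def[symmetric]
  by (simp only: ennreal_powr_less_top_iff)
    (simp add: WL_norm_def local_norm_eq Lp_norm_def ennreal_powr_less_top_iff[unfolded infinity_ennreal_def])

lemma WL_iff:
  fixes f :: "'a::euclidean_space \<Rightarrow> complex"
  assumes g: "g \<in> borel_measurable borel" "AE x in lborel. f x = g x" and "1 \<le> p" "0 < q"
  shows "f \<in> WL (ennreal p) (ennreal q) \<omega> \<longleftrightarrow> wl r p q \<omega> g < top"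
proof -
  have "wl r p q \<omega> f = wl r p q \<omega> g"
    unfolding wl_def using g(2) by (intro amalgam_cong) (auto elim: eventually_mono)
  then show ?thesis
    using lebesgue_measurable_AE_borel[OF g] WL_norm_less_top_iff[OF assms(3,4), of \<omega> f r]
    by (simp add: WL_def)
qed

text \<open>Measurability of the map taking Y to a (X - Y) follows from almost everywhere equality
  with a Borel function: the exceptional set lies in a Borel null set, and reflection preserves null
  sets.\<close>

lemma twisted_integrand_lebesgue:
  fixes a b a' b' :: "'d::finite phase \<Rightarrow> complex"
  assumes [measurable]: "a' \<in> borel_measurable borel" "b' \<in> borel_measurable borel"
    and a: "AE x in lborel. a x = a' x" and b: "AE x in lborel. b x = b' x"
  shows "(a *\<^sub>\<sigma> b) X = (a' *\<^sub>\<sigma> b') X"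
    and "integrable lborel (twisted_integrand a' b' X) \<Longrightarrow> integrable lebesgue (twisted_integrand a b X)"
proof -
  obtain N where N: "\<And>x. x \<in> space lborel - N \<Longrightarrow> a x = a' x" "N \<in> null_sets lborel"
    using AE_E3[OF a] by blast
  have "AE Y in distr lborel borel (\<lambda>Y. X - Y). Y \<notin> N"
    using N(2) by (subst lborel_distr_reflect) (rule AE_not_in)
  then have "AE Y in lborel. X - Y \<notin> N"
    using N(2) by (subst (asm) AE_distr_iff) auto
  with b have eq: "AE Y in lborel. twisted_integrand a b X Y = twisted_integrand a' b' X Y"
    by eventually_elim (use N(1) in \<open>auto simp: twisted_integrand_def\<close>)
  have m': "twisted_integrand a' b' X \<in> borel_measurable borel" by measurable
  have m: "twisted_integrand a b X \<in> borel_measurable lebesgue"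
    by (rule lebesgue_measurable_AE_borel[OF m' eq])
  have m'': "twisted_integrand a' b' X \<in> borel_measurable lebesgue"
    using m' by (simp add: measurable_completion)
  show "(a *\<^sub>\<sigma> b) X = (a' *\<^sub>\<sigma> b') X"
    unfolding twisted_conv_def
    by (intro arg_cong2[where f = "(*)"] refl integral_cong_AE m m'' AE_completion eq)
  show "integrable lebesgue (twisted_integrand a b X)" if "integrable lborel (twisted_integrand a' b' X)"
    using that m' integrable_cong_AE[OF m m'' AE_completion[OF eq]] by (simp add: integrable_completion)
qed

lemma nn_conv_commute:
  assumes [measurable]: "a \<in> borel_measurable borel" "b \<in> borel_measurable borel"
  shows "nn_conv a b X = nn_conv b a X"
proof -
  have "nn_conv a b X = (\<integral>\<^sup>+Y. a (X - Y) * b (X - (X - Y)) \<partial>lborel)"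
    unfolding nn_conv_def by (subst nn_integral_lborel_reflect[of _ X, symmetric]) auto
  then show ?thesis by (simp add: nn_conv_def mult.commute)
qed

text \<open>Split k as (k - j + l) + (j - l) and use moderateness of \<omega>, then that of v to
  separate w (- l) from v j. The finitely many values w (- l) are bounded by their sum.\<close>

lemma moderate_bound:
  fixes \<omega> v w :: "'a::euclidean_space \<Rightarrow> real"
  assumes "moderate v \<omega>" "moderate w v" and pos: "\<And>x. 0 < \<omega> x" "\<And>x. 0 < v x" "\<And>x. 0 < w x"
  obtains E where "0 \<le> E" "\<And>k j l. l \<in> offsets \<Longrightarrow> \<omega> k \<le> E * \<omega> (k - j + l) * v j"
proof -
  obtain C where C: "0 < C" "\<And>X Y. \<omega> (X + Y) \<le> C * \<omega> X * v Y"
    using assms(1) by (auto simp: moderate_def)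
  obtain C' where C': "0 < C'" "\<And>X Y. v (X + Y) \<le> C' * v X * w Y"
    using assms(2) by (auto simp: moderate_def)
  define S where "S = (\<Sum>l\<in>(offsets :: 'a set). w (- l))"
  have S: "0 \<le> S" unfolding S_def using pos by (intro sum_nonneg) (auto intro: less_imp_le)
  show ?thesis
  proof (rule that)
    show "0 \<le> C * C' * S" using C C' S by simp
    fix k j l :: 'a assume l: "l \<in> offsets"
    have "w (- l) \<le> S" unfolding S_def using l finite_offsets pos
      by (intro member_le_sum[of l offsets "\<lambda>l. w (- l)"]) (auto intro: less_imp_le)
    then have "v (j + - l) \<le> C' * v j * S"
      using C'(2)[of j "- l"] C'(1) pos(2)[of j] by (smt (verit) mult_left_mono mult_pos_pos)
    then have "\<omega> ((k - j + l) + (j + - l)) \<le> C * \<omega> (k - j + l) * (C' * v j * S)"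
      using C(2)[of "k - j + l" "j + - l"] C(1) pos(1)[of "k - j + l"] by (smt (verit) mult_left_mono mult_pos_pos)
    then show "\<omega> k \<le> C * C' * S * \<omega> (k - j + l) * v j" by (simp add: mult_ac)
  qed
qed

text \<open>
  \<open>v\<close> itself need not be submultiplicative, so it is dominated by the submultiplicative
  function \<open>Y \<mapsto> sup\<^sub>X v (X + Y) / v X\<close>.
\<close>

lemma submultiplicative_majorant:
  fixes v w :: "'a::euclidean_space \<Rightarrow> real"
  assumes "moderate w v" and pos: "\<And>x. 0 < v x" "\<And>x. 0 < w x"
  obtains u where "\<And>x. 0 < u x" "\<And>x. v x \<le> v 0 * u x" "moderate u u"
proof -
  obtain C where C: "0 < C" "\<And>X Y. v (X + Y) \<le> C * v X * w Y"
    using assms(1) by (auto simp: moderate_def)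
  \<comment> \<open>Moderateness of v bounds these quotients by C * w Y. The quasi-norms evaluate
    weights at lattice points only, so pointwise properties of u suffice for its later use.\<close>
  define u where "u Y = (SUP X. v (X + Y) / v X)" for Y
  have bdd: "bdd_above (range (\<lambda>X. v (X + Y) / v X))" for Y
  proof (rule bdd_aboveI)
    fix t assume "t \<in> range (\<lambda>X. v (X + Y) / v X)"
    then show "t \<le> C * w Y" using C(2) pos(1) by (auto simp: divide_le_eq mult_ac)
  qed
  have le: "v (X + Y) / v X \<le> u Y" for X Y
    unfolding u_def by (rule cSUP_upper[OF _ bdd]) simp
  have u_pos: "0 < u Y" for Y
    using le[of 0 Y] pos(1) by (smt (verit) divide_pos_pos)
  have le': "v (X + Y) \<le> v X * u Y" for X Y
    using le[of X Y] pos(1)[of X] by (simp add: divide_le_eq mult.commute)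
  have "u (Y + Z) \<le> u Y * u Z" for Y Z
    unfolding u_def[of "Y + Z"]
  proof (rule cSUP_least)
    fix X
    have "v (X + (Y + Z)) \<le> v (X + Y) * u Z" using le'[of "X + Y" Z] by (simp add: add.assoc)
    also have "\<dots> \<le> v X * u Y * u Z" using le'[of X Y] u_pos[of Z] by (intro mult_right_mono) auto
    finally show "v (X + (Y + Z)) / v X \<le> u Y * u Z"
      using pos(1)[of X] by (simp add: divide_le_eq mult_ac)
  qed simp
  then have "moderate u u" unfolding moderate_def by (intro exI[of _ 1]) auto
  moreover have "v x \<le> v 0 * u x" for x using le'[of 0 x] by simp
  ultimately show ?thesis using u_pos by (intro that)
qed

lemma wl_weight_mono:
  assumes "wl r p q u f < top" "\<And>k. v k \<le> c * u k" "0 < c" "\<And>k. 0 < u k" "0 < r" "r \<le> q"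
  shows "wl r p q v f < top"
proof -
  have "wl r p q v f \<le> seq_norm r q (\<lambda>k. ennreal c * (cube_norm p (nn_norm f) k * ennreal (u k)))"
    unfolding wl_def amalgam_seq_norm
  proof (intro seq_norm_mono assms(5,6))
    fix k
    have "ennreal (v k) \<le> ennreal c * ennreal (u k)"
      using assms(2)[of k] assms(3) assms(4)[of k] by (simp add: ennreal_leI flip: ennreal_mult)
    then have "cube_norm p (nn_norm f) k * ennreal (v k) \<le> cube_norm p (nn_norm f) k * (ennreal c * ennreal (u k))"
      by (intro mult_left_mono) auto
    then show "cube_norm p (nn_norm f) k * ennreal (v k) \<le> ennreal c * (cube_norm p (nn_norm f) k * ennreal (u k))"
      by (simp add: mult_ac)
  qed
  also have "\<dots> = ennreal (c powr r) * wl r p q u f"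
    using assms by (simp add: seq_norm_cmult wl_def amalgam_seq_norm ennreal_powr_ennreal)
  also have "\<dots> < top" using assms(1) by (simp add: ennreal_mult_less_top)
  finally show ?thesis .
qed

text \<open>Real p and q express that both exponents are finite. The first conjunct ensures that the
  set identities do not rest on the default value of divergent integrals.\<close>

theorem theorem3p5:
  fixes r p q :: real
    and \<omega> v :: "'d::finite phase \<Rightarrow> real"
  assumes "0 < r" and "r \<le> 1"
    and "1 \<le> p"
    and "r \<le> q"
    and "\<omega> \<in> P_E" and "v \<in> P_E"
    and "moderate v \<omega>"
  shows "(\<forall>a \<in> WL 1 (ennreal r) v. \<forall>b \<in> WL (ennreal p) (ennreal q) \<omega>.
            twisted_convolvable a b \<and> twisted_convolvable b a) \<and>
         WL 1 (ennreal r) v \<^bold>*\<^sub>\<sigma> WL (ennreal p) (ennreal q) \<omega>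
           = WL (ennreal p) (ennreal q) \<omega> \<^bold>*\<^sub>\<sigma> WL 1 (ennreal r) v \<and>
         WL (ennreal p) (ennreal q) \<omega> \<^bold>*\<^sub>\<sigma> WL 1 (ennreal r) v
           = WL (ennreal p) (ennreal q) \<omega>"
proof -
  let ?A = "WL 1 (ennreal r) v" and ?B = "WL (ennreal p) (ennreal q) \<omega>"
  have q: "0 < q" using assms by simp
  have pos: "\<And>x. 0 < \<omega> x" "\<And>x. 0 < v x"
    using assms(5,6) by (auto simp: P_E_def weight_def)
  obtain w where w: "moderate w v" "\<And>x. 0 < w x"
    using assms(6) by (auto simp: P_E_def weight_def)
  obtain E where E: "0 \<le> E" "\<And>k j l. l \<in> offsets \<Longrightarrow> \<omega> k \<le> E * \<omega> (k - j + l) * v j"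
    using moderate_bound[OF assms(7) w(1) pos w(2)] by blast
  \<comment> \<open>Two weights are in play: v for convergence and for the inclusion of the
    products, and its majorant u for the factorization.\<close>
  interpret V: amalgam_module r p q \<omega> v E
    using assms pos E by unfold_locales auto
  obtain u where u: "\<And>x. 0 < u x" "\<And>x. v x \<le> v 0 * u x" "moderate u u"
    using submultiplicative_majorant[OF w(1) pos(2) w(2)] by blast
  have mu: "moderate u \<omega>"
  proof -
    obtain C where C: "0 < C" "\<And>X Y. \<omega> (X + Y) \<le> C * \<omega> X * v Y"
      using assms(7) by (auto simp: moderate_def)
    have "\<omega> (X + Y) \<le> C * v 0 * \<omega> X * u Y" for X Y
    proof -
      have "\<omega> (X + Y) \<le> C * \<omega> X * v Y" by (rule C(2))
      also have "\<dots> \<le> C * \<omega> X * (v 0 * u Y)"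
        using C(1) pos(1)[of X] u(2)[of Y] by (intro mult_left_mono) auto
      finally show ?thesis by (simp add: mult_ac)
    qed
    then show ?thesis using C(1) pos(2)[of 0] unfolding moderate_def by (intro exI[of _ "C * v 0"]) auto
  qed
  obtain E1 where E1: "0 \<le> E1" "\<And>k j l. l \<in> offsets \<Longrightarrow> \<omega> k \<le> E1 * \<omega> (k - j + l) * u j"
    using moderate_bound[OF mu u(3) pos(1) u(1) u(1)] by blast
  obtain E2 where E2: "0 \<le> E2" "\<And>k j l. l \<in> offsets \<Longrightarrow> u k \<le> E2 * u (k - j + l) * u j"
    using moderate_bound[OF u(3) u(3) u(1) u(1) u(1)] by blast
  interpret U: amalgam_module r p q \<omega> u E1
    using assms pos u E1 by unfold_locales auto
  have UU: "amalgam_module r 1 r u u E2"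
    using assms pos u E2 by unfold_locales auto
  have A_iff: "f \<in> ?A \<longleftrightarrow> wl r 1 r v g < top" if "g \<in> borel_measurable borel" "AE x in lborel. f x = g x" for f g
    using WL_iff[OF that, of 1 r v r] assms by simp
  have B_iff: "f \<in> ?B \<longleftrightarrow> wl r p q \<omega> g < top" if "g \<in> borel_measurable borel" "AE x in lborel. f x = g x" for f g
    using WL_iff[OF that, of p q \<omega> r] assms q by simp
  have cnj_meas: "(\<lambda>x. cnj (f x)) \<in> borel_measurable borel" if "f \<in> borel_measurable borel" for f :: "'d phase \<Rightarrow> complex"
    by (rule borel_measurable_continuous_on[OF continuous_on_cnj[OF continuous_on_id] that])
  have rep: "\<exists>a' b'. a' \<in> borel_measurable borel \<and> b' \<in> borel_measurable borel \<and>
      (AE x in lborel. a x = a' x) \<and> (AE x in lborel. b x = b' x) \<and> wl r 1 r v a' < top \<and> wl r p q \<omega> b' < top"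
    if "a \<in> ?A" "b \<in> ?B" for a b
  proof -
    have m: "a \<in> borel_measurable lebesgue" "b \<in> borel_measurable lebesgue" using that by (auto simp: WL_def)
    obtain a' where a': "a' \<in> borel_measurable borel" "AE x in lborel. a x = a' x"
      using lebesgue_ex_borel[OF m(1)] by blast
    obtain b' where b': "b' \<in> borel_measurable borel" "AE x in lborel. b x = b' x"
      using lebesgue_ex_borel[OF m(2)] by blast
    have "wl r 1 r v a' < top" "wl r p q \<omega> b' < top"
      using that A_iff[OF a'] B_iff[OF b'] by simp_all
    then show ?thesis using a' b' by blast
  qed
  have convolvable: "twisted_convolvable a b \<and> twisted_convolvable b a" if inAB: "a \<in> ?A" "b \<in> ?B" for a b
  proof -
    obtain a' b' where [measurable]: "a' \<in> borel_measurable borel" "b' \<in> borel_measurable borel"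
      and ae: "AE x in lborel. a x = a' x" "AE x in lborel. b x = b' x"
      and fin: "wl r 1 r v a' < top" "wl r p q \<omega> b' < top" using rep[OF inAB] by blast
    have *: "AE X in lborel. integrable lborel (twisted_integrand a' b' X)"
      using fin by (intro V.AE_integrable_twisted_integrand) auto
    have "AE X in lborel. integrable lborel (twisted_integrand b' a' X)"
      using * by eventually_elim (simp add: integrable_twisted_integrand_iff nn_conv_commute[of "nn_norm b'"])
    then have "AE X in lborel. integrable lebesgue (twisted_integrand b a X)"
      by eventually_elim (rule twisted_integrand_lebesgue(2)[of b' a'], auto simp: ae)
    moreover have "AE X in lborel. integrable lebesgue (twisted_integrand a b X)"
      using * by eventually_elim (rule twisted_integrand_lebesgue(2)[of a' b'], auto simp: ae)
    ultimately show ?thesis by (auto simp: twisted_convolvable_def AE_completion)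
  qed
  have conv_in: "f \<in> ?B" if inAB: "a \<in> ?A" "b \<in> ?B" and f: "f \<in> borel_measurable lebesgue"
    "(AE X in lebesgue. f X = (a *\<^sub>\<sigma> b) X) \<or> (AE X in lebesgue. f X = (b *\<^sub>\<sigma> a) X)" for f a b
  proof -
    obtain a' b' where [measurable]: "a' \<in> borel_measurable borel" "b' \<in> borel_measurable borel"
      and ae: "AE x in lborel. a x = a' x" "AE x in lborel. b x = b' x"
      and fin: "wl r 1 r v a' < top" "wl r p q \<omega> b' < top" using rep[OF inAB] by blast
    have ab: "wl r p q \<omega> (a' *\<^sub>\<sigma> b') < top"
      using fin by (intro V.wl_twisted_conv_finite) auto
    interpret S: amalgam_space r 1 r v using assms pos by unfold_locales auto
    \<comment> \<open>For the other order, the bound is applied to the conjugated factors and the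
      result is conjugated back.\<close>
    have "wl r p q \<omega> ((\<lambda>x. cnj (a' x)) *\<^sub>\<sigma> (\<lambda>x. cnj (b' x))) < top"
      using fin by (intro V.wl_twisted_conv_finite cnj_meas) (auto simp: S.wl_cnj V.wl_cnj)
    moreover have "b' *\<^sub>\<sigma> a' = (\<lambda>X. cnj (((\<lambda>x. cnj (a' x)) *\<^sub>\<sigma> (\<lambda>x. cnj (b' x))) X))"
      by (intro ext twisted_conv_commute_cnj) auto
    ultimately have ba: "wl r p q \<omega> (b' *\<^sub>\<sigma> a') < top" by (simp add: V.wl_cnj)
    have "a *\<^sub>\<sigma> b = a' *\<^sub>\<sigma> b'" "b *\<^sub>\<sigma> a = b' *\<^sub>\<sigma> a'"
      using ae by (auto intro!: ext twisted_integrand_lebesgue(1))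
    then have "(AE X in lborel. f X = (a' *\<^sub>\<sigma> b') X) \<or> (AE X in lborel. f X = (b' *\<^sub>\<sigma> a') X)"
      using f(2) by (simp add: AE_completion_iff)
    then show ?thesis
      using B_iff[of "a' *\<^sub>\<sigma> b'" f] B_iff[of "b' *\<^sub>\<sigma> a'" f] ab ba by (auto intro: measurable_twisted_conv)
  qed
  have fact: "\<exists>a b. a \<in> ?A \<and> b \<in> ?B \<and> a \<in> borel_measurable borel \<and> b \<in> borel_measurable borel \<and> (AE X in lborel. g X = (a *\<^sub>\<sigma> b) X)"
    if g: "g \<in> borel_measurable borel" "wl r p q \<omega> g < top" for g
  proof -
    obtain a b where ab: "a \<in> borel_measurable borel" "b \<in> borel_measurable borel"
      "wl r 1 r u a < top" "wl r p q \<omega> b < top" "AE X in lborel. g X = (a *\<^sub>\<sigma> b) X"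
      using U.borel_factorization[OF UU g] by blast
    \<comment> \<open>The left factor obtained for u belongs to the space with weight v because v <=
      v 0 * u.\<close>
    have "wl r 1 r v a < top"
      using ab(3) u(2) pos(2) u(1) assms by (intro wl_weight_mono[of r 1 r u a v "v 0"]) auto
    then have "a \<in> ?A" "b \<in> ?B" using A_iff[of a a] B_iff[of b b] ab by auto
    then show ?thesis using ab by blast
  qed
  have 1: "?A \<^bold>*\<^sub>\<sigma> ?B = ?B"
  proof (intro equalityI subsetI)
    fix f assume "f \<in> ?A \<^bold>*\<^sub>\<sigma> ?B"
    then show "f \<in> ?B" unfolding twisted_conv_set_def by (blast intro: conv_in)
  next
    fix f assume f: "f \<in> ?B"
    then have fm: "f \<in> borel_measurable lebesgue" by (simp add: WL_def)
    obtain g where g: "g \<in> borel_measurable borel" "AE x in lborel. f x = g x"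
      using lebesgue_ex_borel[OF fm] by blast
    then obtain a b where ab: "a \<in> ?A" "b \<in> ?B" "AE X in lborel. g X = (a *\<^sub>\<sigma> b) X"
      using fact[OF g(1)] f B_iff[OF g] by blast
    from g(2) ab(3) have "AE X in lborel. f X = (a *\<^sub>\<sigma> b) X" by eventually_elim simp
    then show "f \<in> ?A \<^bold>*\<^sub>\<sigma> ?B"
      using ab fm unfolding twisted_conv_set_def by (blast intro: AE_completion)
  qed
  have 2: "?B \<^bold>*\<^sub>\<sigma> ?A = ?B"
  proof (intro equalityI subsetI)
    fix f assume "f \<in> ?B \<^bold>*\<^sub>\<sigma> ?A"
    then show "f \<in> ?B" unfolding twisted_conv_set_def by (blast intro: conv_in)
  next
    fix f assume f: "f \<in> ?B"
    then have fm: "f \<in> borel_measurable lebesgue" by (simp add: WL_def)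
    obtain g where g: "g \<in> borel_measurable borel" "AE x in lborel. f x = g x"
      using lebesgue_ex_borel[OF fm] by blast
    \<comment> \<open>If the conjugate of g factors as a times b, then g is the conjugate of b times
      the conjugate of a.\<close>
    have "wl r p q \<omega> (\<lambda>x. cnj (g x)) < top" using f B_iff[OF g] by (simp add: V.wl_cnj)
    then obtain a b where ab: "a \<in> ?A" "b \<in> ?B" "a \<in> borel_measurable borel" "b \<in> borel_measurable borel"
        "AE X in lborel. cnj (g X) = (a *\<^sub>\<sigma> b) X"
      using fact[OF cnj_meas[OF g(1)]] by blast
    interpret S: amalgam_space r 1 r v using assms pos by unfold_locales auto
    let ?a = "\<lambda>x. cnj (a x)" and ?b = "\<lambda>x. cnj (b x)"
    have in': "?a \<in> ?A" "?b \<in> ?B"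
      using A_iff[of a a] A_iff[of ?a ?a] B_iff[of b b] B_iff[of ?b ?b] ab cnj_meas
      by (auto simp: V.wl_cnj S.wl_cnj)
    have R: "(?b *\<^sub>\<sigma> ?a) X = cnj ((a *\<^sub>\<sigma> b) X)" for X
      using twisted_conv_commute_cnj[of ?a ?b X] ab cnj_meas by simp
    from g(2) ab(5) have "AE X in lborel. f X = (?b *\<^sub>\<sigma> ?a) X"
      by eventually_elim (metis R complex_cnj_cnj)
    then show "f \<in> ?B \<^bold>*\<^sub>\<sigma> ?A"
      using in' fm unfolding twisted_conv_set_def by (blast intro: AE_completion)
  qed
  show ?thesis using convolvable 1 2 by simp
qed

end
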